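(* Let $0<\alpha<2$ and let $X(t)$, $t\in T$ ($T\ne\emptyset$), be a separable symmetric $\alpha$-stable process. Let $\rho(s,t)$ be the scale parameter of $X(t)-X(s)$, assume $\sigma=\operatorname{diam}(T,\rho)<\infty$ and $(T,\rho)$ relatively compact, and let $N(\varepsilon)$ be the covering numbers of $(T,\rho)$. Assume that for some $C>0$ and $\beta>\max(1,\alpha)$, $$N(\varepsilon)\le C\varepsilon^{-\alpha}|\log\varepsilon|^{-\beta}\qquad\text{for }\varepsilon<\sigma.$$ Then there is a constant $K>0$ such that for all sufficiently small $\varepsilon>0$, $$\log\mathbb{P}\Big(\sup_{s,t\in T}|X(s)-X(t)|\le\varepsilon\Big)\ge\begin{cases}-K\varepsilon^{-1/(\beta/\alpha-1)}, & \max(1,\alpha)<\beta<1+\alpha,\\ -K\varepsilon^{-\alpha}|\log\varepsilon|^{1+\alpha}, & \beta=1+\alpha,\\ -K\varepsilon^{-\alpha}|\log\varepsilon|^{-\beta+1+\alpha}, & \beta>1+\alpha.\end{cases}$$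
   Context: The scale parameter $\rho(s,t)$ is defined by $\mathbb{E}\exp\{iu(X(t)-X(s))\}=\exp\{-\rho(t,s)^\alpha|u|^\alpha\}$. A process is symmetric $\alpha$-stable if all finite-dimensional distributions are symmetric $\alpha$-stable vectors. $N(\varepsilon)$ is the minimal number of points $t_1,\dots,t_n\in T$ such that every $t\in T$ has $\rho(t,t_i)\le\varepsilon$ for some $i$. *)

theory Defs
  imports "HOL-Probability.Probability"
begin

text \<open>A random vector indexed by a finite set S (components Y t, t in S) is symmetric
alpha-stable if its joint characteristic function has the spectral form
exp(- integral over the unit sphere of |<u,s>|^alpha with respect to Gamma(ds)) for a finite
symmetric measure Gamma on the unit sphere of R^S (vectors in R^S are represented as
extensional functions on S).\<close>

definition sas_vector :: "'a measure \<Rightarrow> real \<Rightarrow> 'i set \<Rightarrow> ('i \<Rightarrow> 'a \<Rightarrow> real) \<Rightarrow> bool" where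
  "sas_vector M \<alpha> S Y \<longleftrightarrow>
     (\<exists>\<Gamma>. finite_measure \<Gamma> \<and> sets \<Gamma> = sets (PiM S (\<lambda>_. borel)) \<and>
        emeasure \<Gamma> (space \<Gamma> - {s \<in> space \<Gamma>. (\<Sum>t\<in>S. (s t)\<^sup>2) = 1}) = 0 \<and>
        distr \<Gamma> (PiM S (\<lambda>_. borel)) (\<lambda>s. restrict (\<lambda>t. - s t) S) = \<Gamma> \<and>
        (\<forall>u :: 'i \<Rightarrow> real.
           (CLINT \<omega>|M. cis (\<Sum>t\<in>S. u t * Y t \<omega>))
             = complex_of_real (exp (- (\<integral>s. \<bar>\<Sum>t\<in>S. u t * s t\<bar> powr \<alpha> \<partial>\<Gamma>)))))"

definition sas_process :: "'a measure \<Rightarrow> real \<Rightarrow> 'i set \<Rightarrow> ('i \<Rightarrow> 'a \<Rightarrow> real) \<Rightarrow> bool" where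
  "sas_process M \<alpha> T X \<longleftrightarrow>
     (\<forall>t\<in>T. X t \<in> borel_measurable M) \<and>
     (\<forall>S. finite S \<and> S \<subseteq> T \<longrightarrow> sas_vector M \<alpha> S X)"

definition separable_process ::
    "'a measure \<Rightarrow> 'i set \<Rightarrow> ('i \<Rightarrow> 'i \<Rightarrow> real) \<Rightarrow> ('i \<Rightarrow> 'a \<Rightarrow> real) \<Rightarrow> bool" where
  "separable_process M T \<rho> X \<longleftrightarrow>
     (\<exists>D N. countable D \<and> D \<subseteq> T \<and> N \<in> null_sets M \<and>
        (\<forall>\<omega>\<in>space M - N. \<forall>t\<in>T. \<exists>d :: nat \<Rightarrow> 'i. (\<forall>n. d n \<in> D) \<and>
           (\<lambda>n. \<rho> (d n) t) \<longlonglongrightarrow> 0 \<and> (\<lambda>n. X (d n) \<omega>) \<longlonglongrightarrow> X t \<omega>))"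

definition is_eps_net :: "'i set \<Rightarrow> ('i \<Rightarrow> 'i \<Rightarrow> real) \<Rightarrow> real \<Rightarrow> 'i set \<Rightarrow> bool" where
  "is_eps_net T \<rho> \<epsilon> F \<longleftrightarrow> finite F \<and> F \<subseteq> T \<and> (\<forall>t\<in>T. \<exists>s\<in>F. \<rho> t s \<le> \<epsilon>)"

definition covering_number :: "'i set \<Rightarrow> ('i \<Rightarrow> 'i \<Rightarrow> real) \<Rightarrow> real \<Rightarrow> nat" where
  "covering_number T \<rho> \<epsilon> = (LEAST n. \<exists>F. is_eps_net T \<rho> \<epsilon> F \<and> card F = n)"

text \<open>(T, rho) relatively compact = totally bounded (finite eps-nets for every eps > 0).\<close>

definition totally_bounded_pm :: "'i set \<Rightarrow> ('i \<Rightarrow> 'i \<Rightarrow> real) \<Rightarrow> bool" where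
  "totally_bounded_pm T \<rho> \<longleftrightarrow> (\<forall>\<epsilon>>0. \<exists>F. is_eps_net T \<rho> \<epsilon> F)"

definition diam_pm :: "'i set \<Rightarrow> ('i \<Rightarrow> 'i \<Rightarrow> real) \<Rightarrow> real" where
  "diam_pm T \<rho> = (SUP p \<in> T \<times> T. \<rho> (fst p) (snd p))"

end

theory Submission
  imports Defs
begin

text \<open>Sidak-type correlation inequalities for the increments are replaced by a positive definite
tilt. Let $h$ be a compactly supported function with nonnegative Fourier transform (the dual of
$(\sin u / u)^4$), and weight $P$ by $W = \prod_i h(Y_i / a_i)$, where the $Y_i$ are increments of scale
$\rho_i$; this restricts to $|Y_i| \le 4 a_i$. Since
$\frac12(|x+y|^\alpha + |x-y|^\alpha) \le |x|^\alpha + |y|^\alpha$, every such $W$ satisfies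
$E[W \cos Z \cos V] \ge e^{-\psi(V)} E[W \cos Z]$ for linear combinations $Z, V$ of the process, where
$e^{-\psi}$ is the characteristic function. Consequently $E W$ is at least the product of the
one-dimensional expectations $E\,h(Y_i/a_i)$, which are at least $\exp(-c(\rho_i/a_i)^\alpha)$, and
increments have under the tilted law the same small-frequency tail bounds as before, although they are now bounded.

The small ball is then estimated by chaining along nets of mesh $2^{-n}$. The coarse levels
$2^{-n} \gtrsim \varepsilon$ are skipped. For $n$ below $n_1 \approx \varepsilon^{-\alpha/(\beta-\alpha)}$ the links are
confined to $a_n \propto n^{-\beta/(1+\alpha)}$, which minimises the cost $\sum n^{-\beta} a_n^{-\alpha}$ for given
$\sum a_n$. For $n \ge n_1$ they are only confined to $\varepsilon / n_1$, and the sum of the level maxima is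
controlled by Markov's inequality under the tilted law.\<close>

subsection \<open>Power inequalities\<close>

text \<open>The obstacle is that caps a_n with sum \<epsilon> on all links cost at least of order
  \<epsilon>^(-\<alpha>) (sum n^(-\<beta>/(1+\<alpha>)))^(1+\<alpha>), which is infinite for \<beta>
  \<le> 1+\<alpha>. Fine levels must therefore use that most links are far below their cap. A
  nondegenerate stable law has no moments of order \<alpha> or more, so Markov's inequality needs
  the truncation that the tilt supplies. The moment order \<gamma> lies strictly between
  max(1,\<alpha>) and \<beta>: above \<alpha> the truncated moment is governed by the cap, above 1
  it controls a level maximum, below \<beta> the series sum n^(-\<beta>/\<gamma>) converges. The
  fourth power is needed because the kernel's frequency law must have a finite \<alpha>-moment: the
  square of sin u / u already fails for \<alpha> \<ge> 1, while the fourth power has a finite second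
  moment. Skipping the coarse levels is affordable because confining one link of macroscopic scale
  to order \<epsilon> is only polynomially unlikely. About \<epsilon>^(-\<alpha>) |log
  \<epsilon>|^(-\<beta>) such links cost \<epsilon>^(-\<alpha>) |log \<epsilon>|^(1-\<beta>), within
  the claimed rate in each regime.\<close>

lemma powr_add_le_add_powr:
  fixes x y \<theta> :: real
  assumes "0 \<le> x" "0 \<le> y" "0 < \<theta>" "\<theta> \<le> 1"
  shows "(x + y) powr \<theta> \<le> x powr \<theta> + y powr \<theta>"
proof (cases "x + y = 0")
  case True
  then show ?thesis using assms by simp
next
  case False
  then have p: "x + y > 0" using assms by simp
  have le: "t \<le> t powr \<theta>" if "0 \<le> t" "t \<le> 1" for t :: real
  proof (cases "t = 0")
    case False
    then show ?thesis using that assms powr_mono'[of \<theta> 1 t] by simp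
  qed simp
  have "1 = x / (x + y) + y / (x + y)" using False by (simp add: add_divide_distrib[symmetric])
  also have "\<dots> \<le> (x / (x + y)) powr \<theta> + (y / (x + y)) powr \<theta>"
    using assms p by (intro add_mono le) auto
  also have "\<dots> = (x powr \<theta> + y powr \<theta>) / (x + y) powr \<theta>"
    using assms p by (simp add: powr_divide add_divide_distrib)
  finally show ?thesis using p by (simp add: field_simps)
qed

text \<open>The graph of t^\<theta> lies below its tangent at t = 1, which is convexity of exp
  between 0 and ln t. The rescaled points x/m and y/m average to 1, so the linear terms
  cancel.\<close>

lemma powr_midpoint_concave:
  fixes x y \<theta> :: real
  assumes "0 \<le> x" "0 \<le> y" "0 < \<theta>" "\<theta> \<le> 1"
  shows "x powr \<theta> + y powr \<theta> \<le> 2 * ((x + y) / 2) powr \<theta>"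
proof (cases "x + y = 0")
  case True
  then have "x = 0" "y = 0" using assms by auto
  then show ?thesis using assms by simp
next
  case False
  define m where "m = (x + y) / 2"
  have p: "m > 0" using assms False by (simp add: m_def)
  have le: "t powr \<theta> \<le> 1 - \<theta> + \<theta> * t" if "0 \<le> t" for t :: real
  proof (cases "t = 0")
    case False
    then have t: "t > 0" using that by simp
    have "exp ((1 - \<theta>) *\<^sub>R 0 + \<theta> *\<^sub>R ln t) \<le> (1 - \<theta>) * exp 0 + \<theta> * exp (ln t)"
      using assms by (intro convex_onD[OF exp_convex]) auto
    then show ?thesis using t by (simp add: powr_def)
  qed (use assms in auto)
  have "(x / m) powr \<theta> + (y / m) powr \<theta> \<le> (1 - \<theta> + \<theta> * (x / m)) + (1 - \<theta> + \<theta> * (y / m))"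
    using assms p by (intro add_mono le) auto
  also have "\<dots> = 2 - 2 * \<theta> + \<theta> * ((x + y) / m)" by (simp add: algebra_simps add_divide_distrib)
  also have "(x + y) / m = 2" using p by (simp add: field_simps, simp add: m_def)
  finally have "(x powr \<theta> + y powr \<theta>) / m powr \<theta> \<le> 2"
    using assms p by (simp add: powr_divide add_divide_distrib)
  then show ?thesis using p by (simp add: field_simps m_def)
qed

text \<open>In terms of squares the exponent is \<alpha>/2 \<le> 1: concavity averages the two
  squares, the Euclidean parallelogram law evaluates the average, and subadditivity splits
  it.\<close>

lemma abs_powr_parallelogram_le:
  fixes a b \<alpha> :: real
  assumes "0 < \<alpha>" "\<alpha> \<le> 2"
  shows "\<bar>a + b\<bar> powr \<alpha> + \<bar>a - b\<bar> powr \<alpha> \<le> 2 * (\<bar>a\<bar> powr \<alpha> + \<bar>b\<bar> powr \<alpha>)"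
proof -
  have sq: "\<bar>x\<bar> powr \<alpha> = (x\<^sup>2) powr (\<alpha> / 2)" for x :: real
  proof -
    have "x\<^sup>2 = \<bar>x\<bar> powr 2" by (cases "x = 0") (simp_all add: powr_numeral)
    then show ?thesis by (simp only: powr_powr) simp
  qed
  have "\<bar>a + b\<bar> powr \<alpha> + \<bar>a - b\<bar> powr \<alpha> \<le> 2 * (((a + b)\<^sup>2 + (a - b)\<^sup>2) / 2) powr (\<alpha> / 2)"
    unfolding sq using assms by (intro powr_midpoint_concave) auto
  also have "((a + b)\<^sup>2 + (a - b)\<^sup>2) / 2 = a\<^sup>2 + b\<^sup>2" by (simp add: power2_eq_square algebra_simps)
  also have "(a\<^sup>2 + b\<^sup>2) powr (\<alpha> / 2) \<le> (a\<^sup>2) powr (\<alpha> / 2) + (b\<^sup>2) powr (\<alpha> / 2)"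
    using assms by (intro powr_add_le_add_powr) auto
  finally show ?thesis unfolding sq by simp
qed

text \<open>Dyadic replacement for the integral formula for $|y|^\gamma$ in terms of $1 - \cos(vy)$.\<close>

lemma abs_powr_le_sum_one_minus_cos:
  fixes y \<gamma> :: real
  assumes "\<bar>y\<bar> \<le> 1" "0 < \<gamma>"
  shows "\<bar>y\<bar> powr \<gamma> \<le> (\<Sum>k<K. 16 * 2 powr (- \<gamma> * real k) * (1 - cos (2 ^ k * y))) + 2 powr (- \<gamma> * real K)"
  using assms(1)
proof (induction K arbitrary: y)
  case 0
  then show ?case using assms(2) powr_le1[of \<gamma> "\<bar>y\<bar>"] by simp
next
  case (Suc K)
  show ?case
  proof (cases "\<bar>y\<bar> \<le> 1/2")
    \<comment> \<open>Doubling y costs a factor 2^(-\<gamma>), which is exactly a shift of the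
      weights by one index. The doubling stops once |y| > 1/2, where the leading term alone is at
      least 1.\<close>
    case True
    have "\<bar>2 * y\<bar> powr \<gamma> \<le> (\<Sum>k<K. 16 * 2 powr (- \<gamma> * real k) * (1 - cos (2 ^ k * (2 * y)))) + 2 powr (- \<gamma> * real K)"
      using True by (intro Suc.IH) auto
    then have "2 powr (- \<gamma>) * \<bar>2 * y\<bar> powr \<gamma> \<le>
       2 powr (- \<gamma>) * ((\<Sum>k<K. 16 * 2 powr (- \<gamma> * real k) * (1 - cos (2 ^ k * (2 * y)))) + 2 powr (- \<gamma> * real K))"
      by (intro mult_left_mono) auto
    also have "\<dots> = (\<Sum>k<K. 16 * 2 powr (- \<gamma> * real (Suc k)) * (1 - cos (2 ^ Suc k * y))) + 2 powr (- \<gamma> * real (Suc K))"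
      unfolding distrib_left sum_distrib_left
      by (intro arg_cong2[where f = "(+)"] sum.cong) (auto simp: powr_add[symmetric] algebra_simps)
    also have "2 powr (- \<gamma>) * \<bar>2 * y\<bar> powr \<gamma> = \<bar>y\<bar> powr \<gamma>"
      by (simp add: abs_mult powr_mult powr_minus)
    also have "(\<Sum>k<K. 16 * 2 powr (- \<gamma> * real (Suc k)) * (1 - cos (2 ^ Suc k * y))) \<le>
       (\<Sum>k<Suc K. 16 * 2 powr (- \<gamma> * real k) * (1 - cos (2 ^ k * y)))"
      by (subst sum.lessThan_Suc_shift) simp
    finally show ?thesis by simp
  next
    case False
    have "cos \<bar>y\<bar> \<le> cos (1/2)" using False Suc.prems pi_gt3 by (intro cos_monotone_0_pi_le) auto
    \<comment> \<open>Otherwise the double angle formula gives cos 1 \<ge> 2 (15/16)^2 - 1 > 3/4,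
      while cos 1 \<le> cos(pi/4) = sqrt 2 / 2 \<le> 3/4.\<close>
    also have "cos (1/2 :: real) \<le> 15/16"
    proof (rule ccontr)
      assume "\<not> cos (1/2 :: real) \<le> 15/16"
      then have "(15/16)\<^sup>2 \<le> (cos (1/2 :: real))\<^sup>2" by (intro power_mono) auto
      moreover have "cos (1 :: real) = 2 * (cos (1/2))\<^sup>2 - 1"
        using cos_double_cos[of "1/2 :: real"] by simp
      moreover have "cos (1 :: real) \<le> cos (pi / 4)"
        using pi_less_4 pi_gt3 by (intro cos_monotone_0_pi_le) auto
      moreover have "sqrt 2 \<le> 3/2" by (rule real_le_lsqrt) (auto simp: power2_eq_square)
      ultimately show False by (simp add: cos_45 power2_eq_square)
    qed
    finally have "1 \<le> 16 * (1 - cos y)" by simp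
    moreover have "\<bar>y\<bar> powr \<gamma> \<le> 1" using Suc.prems assms(2) powr_le1[of \<gamma> "\<bar>y\<bar>"] by simp
    moreover have "0 \<le> (\<Sum>k<K. 16 * 2 powr (- \<gamma> * real (Suc k)) * (1 - cos (2 ^ Suc k * y)))"
      by (intro sum_nonneg mult_nonneg_nonneg) auto
    ultimately show ?thesis
      by (subst sum.lessThan_Suc_shift) (simp add: add_increasing2)
  qed
qed

subsection \<open>A compactly supported positive definite kernel\<close>

lemma char_convolution:
  assumes "real_distribution M" "real_distribution N"
  shows "char (M \<star> N) t = char M t * char N t"
proof -
  interpret M: real_distribution M by fact
  interpret N: real_distribution N by fact
  interpret P: pair_prob_space M N ..
  have sM: "sets M = sets borel" "sets N = sets borel" by simp_all
  note [measurable_cong] = sM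
  have int: "integrable (M \<Otimes>\<^sub>M N) (\<lambda>p. iexp (t * (fst p + snd p)))"
    by (rule P.integrable_const_bound[where B = 1]) (auto simp del: of_real_mult of_real_add)
  have "char (M \<star> N) t = (CLINT p|M \<Otimes>\<^sub>M N. iexp (t * (fst p + snd p)))"
    unfolding char_def convolution_def by (subst integral_distr) (auto simp: case_prod_beta)
  also have "\<dots> = (CLINT x|M. CLINT y|N. iexp (t * (fst (x, y) + snd (x, y))))"
    using P.integral_fst'[OF int] by simp
  also have "\<dots> = (CLINT x|M. CLINT y|N. iexp (t * x) * iexp (t * y))"
    by (simp add: ring_distribs exp_add)
  also have "\<dots> = char M t * char N t"
    unfolding char_def by simp
  finally show ?thesis .
qed

lemma real_distribution_convolution:
  assumes "real_distribution M" "real_distribution N"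
  shows "real_distribution (M \<star> N)"
proof -
  interpret M: real_distribution M by fact
  interpret N: real_distribution N by fact
  interpret P: pair_prob_space M N ..
  have sM: "sets M = sets borel" "sets N = sets borel" by simp_all
  note [measurable_cong] = sM
  have "prob_space (M \<star> N)"
    unfolding convolution_def by (rule P.prob_space_distr) simp
  then show ?thesis
    by (simp add: real_distribution_def real_distribution_axioms_def)
qed

abbreviation uniform_pm1 :: "real measure" where
  "uniform_pm1 \<equiv> uniform_measure lborel {-1..1}"

lemma real_distribution_uniform_pm1: "real_distribution uniform_pm1"
  unfolding real_distribution_def real_distribution_axioms_def
  by (auto intro!: prob_space_uniform_measure)

lemma uniform_pm1_eq_density: "uniform_pm1 = density lborel (\<lambda>x. ennreal (indicator {-1..1} x / 2))"
  unfolding uniform_measure_def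
  by (intro arg_cong2[where f = density] ext refl)
     (auto simp: indicator_def divide_ennreal[symmetric])

lemma char_uniform_pm1:
  assumes "t \<noteq> 0"
  shows "char uniform_pm1 t = of_real (sin t / t)"
proof -
  have "char uniform_pm1 t = (CLINT x|lborel. (indicator {-1..1} x / 2) *\<^sub>R iexp (t * x))"
    unfolding char_def uniform_pm1_eq_density by (subst integral_density) auto
  also have "\<dots> = (1 / 2) * (CLINT x|lborel. indicator {-1..1} x *\<^sub>R iexp (t * x))"
    by (subst integral_mult_right_zero[symmetric]) (auto intro!: Bochner_Integration.integral_cong simp: scaleR_conv_of_real)
  also have "(CLINT x|lborel. indicator {-1..1} x *\<^sub>R iexp (t * x)) =
      iexp (t * 1) / (\<i> * t) - iexp (t * (-1)) / (\<i> * t)"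
  proof (intro integral_FTC_atLeastAtMost)
    fix x :: real
    have "((\<lambda>z. exp (\<i> * (complex_of_real t * z)) / (\<i> * t)) has_field_derivative exp (\<i> * (t * x))) (at (complex_of_real x))"
      using assms by (auto intro!: derivative_eq_intros simp: mult.left_commute[of \<i>])
    from has_vector_derivative_real_field[OF this, of "{-1..1}"]
    show "((\<lambda>x. iexp (t * x) / (\<i> * t)) has_vector_derivative iexp (t * x)) (at x within {-1..1})"
      by simp
  qed (auto intro!: continuous_intros)
  finally show ?thesis
    using assms by (simp only: cis_conv_exp[symmetric]) (simp add: complex_eq_iff Re_divide Im_divide power2_eq_square)
qed


lemma AE_convolution_abs_le:
  assumes "real_distribution M" "real_distribution N"
    and "AE x in M. \<bar>x\<bar> \<le> r" "AE x in N. \<bar>x\<bar> \<le> s"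
  shows "AE x in M \<star> N. \<bar>x\<bar> \<le> r + s"
proof -
  interpret M: real_distribution M by fact
  interpret N: real_distribution N by fact
  have "emeasure (M \<star> N) {x. \<not> \<bar>x\<bar> \<le> r + s} = (\<integral>\<^sup>+x. emeasure N {a. a + x \<in> {x. \<not> \<bar>x\<bar> \<le> r + s}} \<partial>M)"
    by (intro convolution_emeasure) (auto simp: M.finite_measure N.finite_measure)
  also have "\<dots> = (\<integral>\<^sup>+x. 0 \<partial>M)"
  proof (rule nn_integral_cong_AE)
    show "AE x in M. emeasure N {a. a + x \<in> {x. \<not> \<bar>x\<bar> \<le> r + s}} = 0"
      using assms(3)
    proof eventually_elim
      case (elim x)
      have "AE a in N. a \<notin> {a. a + x \<in> {x. \<not> \<bar>x\<bar> \<le> r + s}}"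
        using assms(4) by eventually_elim (use elim in auto)
      moreover have "{a. a + x \<in> {x. \<not> \<bar>x\<bar> \<le> r + s}} \<in> sets N" by simp
      ultimately show ?case by (simp add: AE_iff_measurable[OF _ refl])
    qed
  qed
  finally show ?thesis
    by (subst AE_iff_measurable[of "{x. \<not> \<bar>x\<bar> \<le> r + s}"]) auto
qed

text \<open>Convolution with an atomless law destroys atoms. Levy's inversion formula needs this at
  the two endpoints of its interval.\<close>

lemma measure_convolution_uniform_pm1_singleton:
  assumes "real_distribution M"
  shows "measure (M \<star> uniform_pm1) {a} = 0"
proof -
  interpret M: real_distribution M by fact
  interpret N: real_distribution uniform_pm1 by (rule real_distribution_uniform_pm1)
  have "emeasure (M \<star> uniform_pm1) {a} = (\<integral>\<^sup>+x. emeasure uniform_pm1 {b. b + x \<in> {a}} \<partial>M)"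
    by (intro convolution_emeasure) (auto simp: M.finite_measure N.finite_measure)
  also have "\<dots> = (\<integral>\<^sup>+x. 0 \<partial>M)"
  proof (rule nn_integral_cong)
    fix x
    have "{b. b + x \<in> {a}} = {a - x}" by auto
    moreover have "emeasure uniform_pm1 {a - x} = 0"
    proof -
      have "emeasure lborel ({-1..1} \<inter> {a - x}) \<le> emeasure lborel {a - x}"
        by (rule emeasure_mono) auto
      then show ?thesis by (subst emeasure_uniform_measure) auto
    qed
    ultimately show "emeasure uniform_pm1 {b. b + x \<in> {a}} = 0" by simp
  qed
  finally show ?thesis by (simp add: measure_def)
qed

text \<open>Both (sin t / t)^2 and t^2 (sin t / t)^2 are at most 1; products of two of these bound
  every term. The second inequality is what yields a second moment for the frequency law.\<close>

lemma sinc_power4_bounds: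
  fixes t :: real
  shows "(sin t / t) ^ 4 \<le> 2 * inverse (1 + t\<^sup>2)" "t\<^sup>2 * (sin t / t) ^ 4 \<le> 2 * inverse (1 + t\<^sup>2)"
proof -
  have s1: "(sin t / t)\<^sup>2 \<le> 1"
    using abs_sin_x_le_abs_x[of t] by (simp add: abs_square_le_1 divide_le_eq_1)
  have s2: "t\<^sup>2 * (sin t / t)\<^sup>2 \<le> 1"
    by (cases "t = 0") (auto simp: power_divide abs_square_le_1)
  have pos: "1 + t\<^sup>2 > 0" by (simp add: add_pos_nonneg)
  have e: "(sin t / t) ^ 4 = (sin t / t)\<^sup>2 * (sin t / t)\<^sup>2" by (simp flip: power_add)
  have 1: "(sin t / t)\<^sup>2 * (sin t / t)\<^sup>2 \<le> 1 * 1" using s1 by (intro mult_mono) auto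
  have 2: "(t\<^sup>2 * (sin t / t)\<^sup>2) * (sin t / t)\<^sup>2 \<le> 1 * 1" using s1 s2 by (intro mult_mono) auto
  have 3: "(t\<^sup>2 * (sin t / t)\<^sup>2) * (t\<^sup>2 * (sin t / t)\<^sup>2) \<le> 1 * 1" using s2 by (intro mult_mono) auto
  have "(1 + t\<^sup>2) * (sin t / t) ^ 4 \<le> 2" "(1 + t\<^sup>2) * (t\<^sup>2 * (sin t / t) ^ 4) \<le> 2"
    using 1 2 3 unfolding e by (simp_all add: algebra_simps)
  then show "(sin t / t) ^ 4 \<le> 2 * inverse (1 + t\<^sup>2)" "t\<^sup>2 * (sin t / t) ^ 4 \<le> 2 * inverse (1 + t\<^sup>2)"
    using pos by (simp_all add: field_simps)
qed

lemma integrable_inverse_one_plus_square_lborel: "integrable lborel (\<lambda>x :: real. inverse (1 + x\<^sup>2))"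
  using integrable_inverse_1_plus_square by (simp add: set_integrable_def)

lemma integrable_sinc_power4:
  "integrable lborel (\<lambda>t :: real. (sin t / t) ^ 4)"
  "integrable lborel (\<lambda>t :: real. t\<^sup>2 * (sin t / t) ^ 4)"
proof -
  have i: "integrable lborel (\<lambda>t :: real. 2 * inverse (1 + t\<^sup>2))"
    by (intro integrable_mult_right integrable_inverse_one_plus_square_lborel)
  show "integrable lborel (\<lambda>t :: real. (sin t / t) ^ 4)"
    by (rule Bochner_Integration.integrable_bound[OF i]) (use sinc_power4_bounds in auto)
  show "integrable lborel (\<lambda>t :: real. t\<^sup>2 * (sin t / t) ^ 4)"
    by (rule Bochner_Integration.integrable_bound[OF i]) (use sinc_power4_bounds in auto)
qed

text \<open>Three factors sin t / t form the characteristic function of \<open>M\<close>; the fourth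
  is the interval factor of Levy inversion on an interval of length 2 centred at y. Inversion gives
  a limit of truncated integrals, and dominated convergence turns it into the Lebesgue
  integral.\<close>

lemma sinc_power4_Fourier:
  fixes y :: real
  defines "M \<equiv> (uniform_pm1 \<star> uniform_pm1) \<star> uniform_pm1"
  shows "(\<integral>t. (sin t / t) ^ 4 * cos (t * y) \<partial>lborel) = pi * measure M {y - 1<..y + 1}"
proof -
  have U2: "real_distribution (uniform_pm1 \<star> uniform_pm1)"
    by (intro real_distribution_convolution real_distribution_uniform_pm1)
  then interpret M: real_distribution M
    unfolding M_def by (intro real_distribution_convolution real_distribution_uniform_pm1)
  have ch: "char M t = of_real ((sin t / t) ^ 3)" if "t \<noteq> 0" for t
    using that unfolding M_def
    by (simp add: char_convolution char_uniform_pm1 U2 real_distribution_uniform_pm1 power3_eq_cube)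
  have int: "integrable lborel (\<lambda>t :: real. (sin t / t) ^ 4 * cos (t * y))"
    by (rule Bochner_Integration.integrable_bound[OF integrable_sinc_power4(1)])
       (auto simp: abs_mult mult_left_le)
  have eq: "(iexp (- (t * (y - 1))) - iexp (- (t * (y + 1)))) / (\<i> * t) * char M t =
     (of_real (2 * (sin t / t) ^ 4) * iexp (- (t * y)))" if "t \<noteq> 0" for t
  proof -
    have "iexp (- (t * (y - 1))) - iexp (- (t * (y + 1))) = iexp (- (t * y)) * (iexp t - iexp (- t))"
      by (simp add: algebra_simps exp_add[symmetric])
    also have "iexp t - iexp (- t) = 2 * \<i> * sin t"
      by (simp only: cis_conv_exp[symmetric]) (simp add: complex_eq_iff)
    finally show ?thesis using that by (simp add: ch field_simps eval_nat_numeral)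
  qed
  have lim1: "(\<lambda>n. 1 / (2 * pi) * (CLBINT t=-real n..real n. (iexp (- (t * (y - 1))) - iexp (- (t * (y + 1)))) / (\<i> * t) * char M t))
      \<longlonglongrightarrow> of_real (measure M {y - 1<..y + 1})"
    using M.Levy_Inversion[of "y - 1" "y + 1"]
    by (simp add: M_def measure_convolution_uniform_pm1_singleton U2)
  have "Re (1 / (2 * pi) * (CLBINT t=-real n..real n. (iexp (- (t * (y - 1))) - iexp (- (t * (y + 1)))) / (\<i> * t) * char M t))
     = 1 / pi * (\<integral>t. indicator {- real n..real n} t * ((sin t / t) ^ 4 * cos (t * y)) \<partial>lborel)" for n
  proof -
    have i: "integrable lborel (\<lambda>t. indicator {- real n..real n} t *\<^sub>R (of_real (2 * (sin t / t) ^ 4) * iexp (- (t * y))))"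
      by (rule Bochner_Integration.integrable_bound[OF integrable_mult_right[OF integrable_sinc_power4(1), of 2]])
         (auto simp: norm_mult indicator_def simp del: of_real_mult of_real_power)
    have "(CLBINT t=-real n..real n. (iexp (- (t * (y - 1))) - iexp (- (t * (y + 1)))) / (\<i> * t) * char M t)
      = (CLINT t|lborel. indicator {- real n..real n} t *\<^sub>R ((iexp (- (t * (y - 1))) - iexp (- (t * (y + 1)))) / (\<i> * t) * char M t))"
      by (simp add: interval_integral_Icc set_lebesgue_integral_def)
    also have "\<dots> = (CLINT t|lborel. indicator {- real n..real n} t *\<^sub>R (of_real (2 * (sin t / t) ^ 4) * iexp (- (t * y))))"
    proof (rule Bochner_Integration.integral_cong_AE)
      \<comment> \<open>The pointwise identity was derived for t \<noteq> 0 only, so the point 0 is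
        discarded.\<close>
      show "AE t in lborel. indicat_real {- real n..real n} t *\<^sub>R ((iexp (- (t * (y - 1))) - iexp (- (t * (y + 1)))) / (\<i> * t) * char M t) =
         indicator {- real n..real n} t *\<^sub>R (of_real (2 * (sin t / t) ^ 4) * iexp (- (t * y)))"
        using AE_lborel_singleton[of 0] by eventually_elim (subst eq, simp_all)
    qed auto
    finally have *: "(CLBINT t=-real n..real n. (iexp (- (t * (y - 1))) - iexp (- (t * (y + 1)))) / (\<i> * t) * char M t)
      = (CLINT t|lborel. indicator {- real n..real n} t *\<^sub>R (of_real (2 * (sin t / t) ^ 4) * iexp (- (t * y))))" .
    have "Re (1 / (2 * pi) * (CLINT t|lborel. indicator {- real n..real n} t *\<^sub>R (of_real (2 * (sin t / t) ^ 4) * iexp (- (t * y)))))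
      = 1 / (2 * pi) * (\<integral>t. Re (indicator {- real n..real n} t *\<^sub>R (of_real (2 * (sin t / t) ^ 4) * iexp (- (t * y)))) \<partial>lborel)"
      using i by (subst integral_Re) (simp_all add: Re_divide power2_eq_square)
    also have "(\<lambda>t. Re (indicator {- real n..real n} t *\<^sub>R (of_real (2 * (sin t / t) ^ 4) * iexp (- (t * y)))))
       = (\<lambda>t. 2 * (indicator {- real n..real n} t * ((sin t / t) ^ 4 * cos (t * y))))"
      by (simp only: cis_conv_exp[symmetric]) (auto simp: fun_eq_iff simp del: of_real_power of_real_mult)
    finally show ?thesis unfolding * by simp
  qed
  then have "(\<lambda>n. 1 / pi * (\<integral>t. indicator {- real n..real n} t * ((sin t / t) ^ 4 * cos (t * y)) \<partial>lborel))
      \<longlonglongrightarrow> measure M {y - 1<..y + 1}"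
    using tendsto_Re[OF lim1] by simp
  moreover have "(\<lambda>n. 1 / pi * (\<integral>t. indicator {- real n..real n} t * ((sin t / t) ^ 4 * cos (t * y)) \<partial>lborel))
      \<longlonglongrightarrow> 1 / pi * (\<integral>t. (sin t / t) ^ 4 * cos (t * y) \<partial>lborel)"
  proof (intro tendsto_mult_left integral_dominated_convergence[OF _ _ integrable_norm[OF int]])
    show "AE t in lborel. (\<lambda>n. indicator {- real n..real n} t * ((sin t / t) ^ 4 * cos (t * y))) \<longlonglongrightarrow> (sin t / t) ^ 4 * cos (t * y)"
    proof
      fix t :: real
      have "eventually (\<lambda>n. \<bar>t\<bar> \<le> real n) sequentially"
        by (rule eventually_sequentiallyI[of "nat \<lceil>\<bar>t\<bar>\<rceil>"]) linarith
      then have "eventually (\<lambda>n. indicator {- real n..real n} t * ((sin t / t) ^ 4 * cos (t * y)) = (sin t / t) ^ 4 * cos (t * y)) sequentially"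
        by eventually_elim (auto simp: indicator_def)
      then show "(\<lambda>n. indicator {- real n..real n} t * ((sin t / t) ^ 4 * cos (t * y))) \<longlonglongrightarrow> (sin t / t) ^ 4 * cos (t * y)"
        by (rule tendsto_eventually)
    qed
  qed (auto simp: indicator_def)
  ultimately have "measure M {y - 1<..y + 1} = 1 / pi * (\<integral>t. (sin t / t) ^ 4 * cos (t * y) \<partial>lborel)"
    by (rule LIMSEQ_unique)
  then show ?thesis by simp
qed


section \<open>The kernel and its frequency law\<close>

definition sinc4_mass :: real where
  "sinc4_mass = (\<integral>t. (sin t / t) ^ 4 \<partial>lborel)"

definition sinc4_measure :: "real measure" where
  "sinc4_measure = density lborel (\<lambda>t. ennreal ((sin t / t) ^ 4 / sinc4_mass))"

text \<open>The function h of the overview, normalised to 1 at the origin. Defining it as a mixture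
  of cosines keeps positive definiteness in view; sign and support are recovered in
  \<open>bump_eq\<close> and \<open>bump_eq_0\<close>.\<close>

definition bump :: "real \<Rightarrow> real" where
  "bump y = (\<integral>u. cos (u * y) \<partial>sinc4_measure)"

lemma cos_one_pos: "cos (1 :: real) > 0"
  using pi_gt3 by (intro cos_gt_zero) auto

text \<open>By the mean value theorem sin s / s is a cosine at a point of (0, 1), and evenness
  handles negative t. The purpose is a positive lower bound for the frequency density near
  0.\<close>

lemma sinc_power4_ge:
  fixes t :: real
  assumes "t \<noteq> 0" "\<bar>t\<bar> \<le> 1"
  shows "(cos 1) ^ 4 \<le> (sin t / t) ^ 4"
proof -
  have *: "cos 1 \<le> sin s / s" if s: "0 < s" "s \<le> 1" for s :: real
  proof -
    obtain z where z: "0 < z" "z < s" "sin s - sin 0 = (s - 0) * cos z"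
      using MVT2[of 0 s sin cos] s by (auto intro!: DERIV_sin)
    have "cos 1 \<le> cos z" using z s pi_gt3 by (intro cos_monotone_0_pi_le) auto
    with z s show ?thesis by simp
  qed
  have "cos 1 \<le> sin t / t"
  proof (cases "t > 0")
    case False
    then have "cos 1 \<le> sin (- t) / (- t)" using assms by (intro *) auto
    then show ?thesis by simp
  qed (use * assms in auto)
  then show ?thesis using cos_one_pos by (intro power_mono) auto
qed

lemma sinc_power4_integral_ge:
  fixes s :: real
  assumes "0 < s" "s \<le> 1"
  shows "2 * s * (cos 1) ^ 4 \<le> (\<integral>t. indicator {-s..s} t * (sin t / t) ^ 4 \<partial>lborel)"
proof -
  have "(\<integral>t. indicator {-s..s} t * (cos 1) ^ 4 \<partial>lborel) \<le> (\<integral>t. indicator {-s..s} t * (sin t / t) ^ 4 \<partial>lborel)"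
  proof (rule integral_mono_AE)
    show "integrable lborel (\<lambda>t. indicator {-s..s} t * (sin t / t) ^ 4)"
      by (rule Bochner_Integration.integrable_bound[OF integrable_sinc_power4(1)]) (auto simp: indicator_def)
    show "AE t in lborel. indicator {-s..s} t * (cos 1) ^ 4 \<le> indicator {-s..s} t * (sin t / t) ^ 4"
      using AE_lborel_singleton[of 0]
      by eventually_elim (use assms in \<open>auto simp: indicator_def intro!: sinc_power4_ge\<close>)
    have "integrable lborel (indicator {-s..s} :: real \<Rightarrow> real)"
      by (rule integrable_real_indicator) (use assms in auto)
    then show "integrable lborel (\<lambda>t. indicator {-s..s} t * (cos 1 :: real) ^ 4)" by simp
  qed
  then show ?thesis using assms by simp
qed

lemma sinc4_mass_pos: "sinc4_mass > 0"
proof -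
  have "0 < 2 * 1 * (cos 1 :: real) ^ 4" using cos_one_pos by simp
  also have "\<dots> \<le> (\<integral>t. indicator {-1..1} t * (sin t / t) ^ 4 \<partial>lborel)"
    by (rule sinc_power4_integral_ge) auto
  also have "\<dots> \<le> sinc4_mass" unfolding sinc4_mass_def
  proof (rule integral_mono)
    show "integrable lborel (\<lambda>t :: real. indicator {-1..1} t * (sin t / t) ^ 4)"
      by (rule Bochner_Integration.integrable_bound[OF integrable_sinc_power4(1)]) (auto simp: indicator_def)
  qed (auto simp: indicator_def integrable_sinc_power4)
  finally show ?thesis .
qed

lemma sets_sinc4_measure [simp, measurable_cong]: "sets sinc4_measure = sets borel"
  by (simp add: sinc4_measure_def)

lemma space_sinc4_measure [simp]: "space sinc4_measure = UNIV"
  by (simp add: sinc4_measure_def)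

lemma prob_space_sinc4_measure: "prob_space sinc4_measure"
proof
  have "emeasure sinc4_measure UNIV = (\<integral>\<^sup>+t. ennreal ((sin t / t) ^ 4 / sinc4_mass) \<partial>lborel)"
    unfolding sinc4_measure_def by (subst emeasure_density) auto
  also have "\<dots> = ennreal (\<integral>t. (sin t / t) ^ 4 / sinc4_mass \<partial>lborel)"
    using sinc4_mass_pos integrable_sinc_power4(1) by (intro nn_integral_eq_integral) auto
  also have "(\<integral>t. (sin t / t) ^ 4 / sinc4_mass \<partial>lborel) = 1"
    using sinc4_mass_pos by (simp add: sinc4_mass_def)
  finally show "emeasure sinc4_measure (space sinc4_measure) = 1" by simp
qed

interpretation sinc4: prob_space sinc4_measure by (rule prob_space_sinc4_measure)

lemma integrable_square_sinc4: "integrable sinc4_measure (\<lambda>u. u\<^sup>2)"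
proof -
  have "integrable lborel (\<lambda>u :: real. (u\<^sup>2 * (sin u / u) ^ 4) / sinc4_mass)"
    using integrable_sinc_power4(2) by simp
  then show ?thesis
    unfolding sinc4_measure_def using sinc4_mass_pos by (subst integrable_density) (auto simp: mult.commute)
qed

lemma sinc4_measure_interval_ge:
  assumes "0 < s" "s \<le> 1"
  shows "2 * (cos 1) ^ 4 / sinc4_mass * s \<le> measure sinc4_measure {-s..s}"
proof -
  have "emeasure sinc4_measure {-s..s} = (\<integral>\<^sup>+t. ennreal (indicator {-s..s} t * (sin t / t) ^ 4 / sinc4_mass) \<partial>lborel)"
    unfolding sinc4_measure_def by (subst emeasure_density) (auto intro!: nn_integral_cong simp: indicator_def)
  also have "\<dots> = ennreal (\<integral>t. indicator {-s..s} t * (sin t / t) ^ 4 / sinc4_mass \<partial>lborel)"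
  proof (intro nn_integral_eq_integral)
    have "integrable lborel (\<lambda>t :: real. indicator {-s..s} t * (sin t / t) ^ 4)"
      by (rule Bochner_Integration.integrable_bound[OF integrable_sinc_power4(1)]) (auto simp: indicator_def)
    then show "integrable lborel (\<lambda>t. indicator {-s..s} t * (sin t / t) ^ 4 / sinc4_mass)" by simp
  qed (use sinc4_mass_pos in auto)
  finally have "measure sinc4_measure {-s..s} = (\<integral>t. indicator {-s..s} t * (sin t / t) ^ 4 / sinc4_mass \<partial>lborel)"
    using sinc4_mass_pos by (simp add: measure_def integral_nonneg)
  also have "\<dots> = (\<integral>t. indicator {-s..s} t * (sin t / t) ^ 4 \<partial>lborel) / sinc4_mass" by simp
  finally show ?thesis
    using sinc_power4_integral_ge[OF assms] sinc4_mass_pos by (simp add: field_simps)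
qed

text \<open>Shows the kernel as a multiple of a window probability for a sum of three uniform
  variables, from which nonnegativity and compact support can be read off.\<close>

lemma bump_eq: "bump y = pi / sinc4_mass * measure ((uniform_pm1 \<star> uniform_pm1) \<star> uniform_pm1) {y - 1<..y + 1}"
proof -
  have "bump y = (\<integral>t. (sin t / t) ^ 4 / sinc4_mass * cos (t * y) \<partial>lborel)"
    unfolding bump_def sinc4_measure_def using sinc4_mass_pos by (subst integral_density) auto
  also have "\<dots> = (\<integral>t. (sin t / t) ^ 4 * cos (t * y) \<partial>lborel) / sinc4_mass" by simp
  finally show ?thesis by (simp add: sinc_power4_Fourier)
qed

lemma bump_nonneg: "0 \<le> bump y"
  using sinc4_mass_pos by (simp add: bump_eq)

lemma bump_le_one: "bump y \<le> 1"
proof -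
  have "bump y \<le> (\<integral>u. 1 \<partial>sinc4_measure)" unfolding bump_def
    by (intro integral_mono sinc4.integrable_const_bound[where B = 1]) auto
  then show ?thesis using sinc4.prob_space by simp
qed

text \<open>The sum of three variables in [-1, 1] stays within [-3, 3], and the window has
  half-width 1.\<close>

lemma bump_eq_0:
  assumes "4 < \<bar>y\<bar>"
  shows "bump y = 0"
proof -
  note U = real_distribution_uniform_pm1
  have "AE x in uniform_pm1. \<bar>x\<bar> \<le> 1" by (rule AE_uniform_measureI) auto
  then have "AE x in (uniform_pm1 \<star> uniform_pm1) \<star> uniform_pm1. \<bar>x\<bar> \<le> (1 + 1) + 1"
    by (intro AE_convolution_abs_le real_distribution_convolution U)
  then have "AE x in (uniform_pm1 \<star> uniform_pm1) \<star> uniform_pm1. x \<notin> {y - 1<..y + 1}"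
    by eventually_elim (use assms in auto)
  then have "emeasure ((uniform_pm1 \<star> uniform_pm1) \<star> uniform_pm1) {y - 1<..y + 1} = 0"
    by (subst (asm) AE_iff_measurable[of "{y - 1<..y + 1}"]) auto
  then show ?thesis by (simp add: bump_eq measure_def)
qed

lemma bump_measurable [measurable]: "bump \<in> borel_measurable borel"
  unfolding bump_def by measurable

text \<open>By Fubini this is the expectation of \<open>bump\<close> at a symmetric \<alpha>-stable
  variable of scale r, expressed through frequencies so that no such variable has to be
  constructed.\<close>

definition stable_bump :: "real \<Rightarrow> real \<Rightarrow> real" where
  "stable_bump \<alpha> r = (\<integral>u. exp (- ((r * \<bar>u\<bar>) powr \<alpha>)) \<partial>sinc4_measure)"

definition sinc4_moment :: "real \<Rightarrow> real" where
  "sinc4_moment \<alpha> = (\<integral>u. \<bar>u\<bar> powr \<alpha> \<partial>sinc4_measure)"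

lemma integrable_powr_sinc4:
  assumes "0 < \<alpha>" "\<alpha> \<le> 2"
  shows "integrable sinc4_measure (\<lambda>u. \<bar>u\<bar> powr \<alpha>)"
proof (rule Bochner_Integration.integrable_bound)
  show "integrable sinc4_measure (\<lambda>u. 1 + u\<^sup>2)"
    using integrable_square_sinc4 by simp
  show "AE u in sinc4_measure. norm (\<bar>u\<bar> powr \<alpha>) \<le> norm (1 + u\<^sup>2)"
  proof
    fix u :: real
    have "\<bar>u\<bar> powr \<alpha> \<le> 1 + u\<^sup>2"
    proof (cases "\<bar>u\<bar> \<le> 1")
      case True
      then have "\<bar>u\<bar> powr \<alpha> \<le> 1" using assms powr_le1[of \<alpha> "\<bar>u\<bar>"] by simp
      then show ?thesis by (simp add: add_increasing2)
    next
      case False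
      then have "\<bar>u\<bar> powr \<alpha> \<le> \<bar>u\<bar> powr 2" using assms by (intro powr_mono) auto
      also have "\<dots> = u\<^sup>2" using False by (subst powr_numeral) auto
      finally show ?thesis by simp
    qed
    then show "norm (\<bar>u\<bar> powr \<alpha>) \<le> norm (1 + u\<^sup>2)" by simp
  qed
qed measurable

text \<open>Jensen's inequality for exp, in the form of the tangent at the mean: the linear
  correction integrates to 0. It is the bound for links whose scale is not large compared with their
  cap.\<close>

lemma stable_bump_ge_exp:
  assumes "0 < \<alpha>" "\<alpha> \<le> 2" "0 \<le> r"
  shows "exp (- sinc4_moment \<alpha> * r powr \<alpha>) \<le> stable_bump \<alpha> r"
proof -
  define m where "m = sinc4_moment \<alpha> * r powr \<alpha>"
  have i: "integrable sinc4_measure (\<lambda>u. \<bar>u\<bar> powr \<alpha>)" by (rule integrable_powr_sinc4) fact+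
  have "exp (- m) = (\<integral>u. exp (- m) * (1 + (m - r powr \<alpha> * \<bar>u\<bar> powr \<alpha>)) \<partial>sinc4_measure)"
    using i sinc4.prob_space by (simp add: m_def sinc4_moment_def)
  also have "\<dots> \<le> stable_bump \<alpha> r" unfolding stable_bump_def
  proof (rule integral_mono)
    fix u :: real
    have "exp (- m) * (1 + (m - r powr \<alpha> * \<bar>u\<bar> powr \<alpha>)) \<le> exp (- m) * exp (m - r powr \<alpha> * \<bar>u\<bar> powr \<alpha>)"
      by (intro mult_left_mono exp_ge_add_one_self) auto
    also have "\<dots> = exp (- ((r * \<bar>u\<bar>) powr \<alpha>))"
      using assms by (simp add: powr_mult flip: exp_add)
    finally show "exp (- m) * (1 + (m - r powr \<alpha> * \<bar>u\<bar> powr \<alpha>)) \<le> exp (- ((r * \<bar>u\<bar>) powr \<alpha>))" .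
  next
    show "integrable sinc4_measure (\<lambda>u. exp (- m) * (1 + (m - r powr \<alpha> * \<bar>u\<bar> powr \<alpha>)))"
      using i by simp
    show "integrable sinc4_measure (\<lambda>u. exp (- ((r * \<bar>u\<bar>) powr \<alpha>)))"
      by (rule sinc4.integrable_const_bound[where B = 1]) auto
  qed
  finally show ?thesis by (simp add: m_def)
qed

text \<open>For large r the Jensen bound is far too weak. Frequencies with |u| \<le> 1/r each
  contribute at least e^(-1), and their mass is at least of order 1/r. The logarithmic cost of the
  first links comes from here.\<close>

lemma stable_bump_ge_inverse:
  assumes "0 < \<alpha>" "1 \<le> r"
  shows "exp (- 1) * (2 * (cos 1) ^ 4 / sinc4_mass) / r \<le> stable_bump \<alpha> r"
proof -
  have "exp (- 1) * (2 * (cos 1) ^ 4 / sinc4_mass * (1 / r)) \<le> exp (- 1) * measure sinc4_measure {-(1/r)..1/r}"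
    using assms by (intro mult_left_mono sinc4_measure_interval_ge) auto
  also have "\<dots> = (\<integral>u. exp (- 1) * indicator {-(1/r)..1/r} u \<partial>sinc4_measure)"
    by simp
  also have "\<dots> \<le> stable_bump \<alpha> r" unfolding stable_bump_def
  proof (rule integral_mono)
    fix u :: real
    show "exp (- 1) * indicator {-(1/r)..1/r} u \<le> exp (- ((r * \<bar>u\<bar>) powr \<alpha>))"
    proof (cases "u \<in> {-(1/r)..1/r}")
      case True
      then have "\<bar>u\<bar> \<le> 1 / r" by auto
      then have "r * \<bar>u\<bar> \<le> 1" using assms by (simp add: field_simps)
      then have "(r * \<bar>u\<bar>) powr \<alpha> \<le> 1" using assms by (intro powr_le1) auto
      then show ?thesis using True by simp
    qed auto
  next
    show "integrable sinc4_measure (\<lambda>u. exp (- ((r * \<bar>u\<bar>) powr \<alpha>)))"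
      by (rule sinc4.integrable_const_bound[where B = 1]) auto
    show "integrable sinc4_measure (\<lambda>u. exp (- 1) * indicator {-(1/r)..1/r} u :: real)"
      by (rule sinc4.integrable_const_bound[where B = 1]) (auto simp: indicator_def)
  qed
  finally show ?thesis by simp
qed

text \<open>Allows a link to be charged by an upper bound for its scale, such as the mesh of the
  net.\<close>

lemma stable_bump_antimono:
  assumes "0 < \<alpha>" "0 \<le> r" "r \<le> s"
  shows "stable_bump \<alpha> s \<le> stable_bump \<alpha> r"
  unfolding stable_bump_def
proof (rule integral_mono)
  fix u :: real
  show "exp (- ((s * \<bar>u\<bar>) powr \<alpha>)) \<le> exp (- ((r * \<bar>u\<bar>) powr \<alpha>))"
    using assms by (auto intro!: powr_mono2 mult_right_mono)
qed (rule sinc4.integrable_const_bound[where B = 1]; auto)+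

subsection \<open>Tilted stable laws\<close>

definition lincomb :: "'i set \<Rightarrow> ('i \<Rightarrow> 'a \<Rightarrow> real) \<Rightarrow> ('i \<Rightarrow> real) \<Rightarrow> 'a \<Rightarrow> real" where
  "lincomb S X z \<omega> = (\<Sum>t\<in>S. z t * X t \<omega>)"

lemma lincomb_linear:
  "lincomb S X (\<lambda>t. z t + v t) \<omega> = lincomb S X z \<omega> + lincomb S X v \<omega>"
  "lincomb S X (\<lambda>t. z t - v t) \<omega> = lincomb S X z \<omega> - lincomb S X v \<omega>"
  "lincomb S X (\<lambda>t. c * v t) \<omega> = c * lincomb S X v \<omega>"
  "lincomb S X (\<lambda>t. 0) \<omega> = 0"
  by (simp_all add: lincomb_def sum.distrib sum_subtractf sum_distrib_left algebra_simps)

text \<open>Here $4$ is the radius of the support of \<^const>\<open>bump\<close>.\<close>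

definition moment_const :: "real \<Rightarrow> real \<Rightarrow> real" where
  "moment_const \<alpha> \<gamma> = 4 powr (\<gamma> - \<alpha>) * (16 / (1 - 2 powr (\<alpha> - \<gamma>)))"

text \<open>Isolates the two features of stability on which the tilt rests: real characteristic
  functions exp(-\<psi>) and the parallelogram inequality for \<psi>. Coefficient vectors live on
  the whole index type, but \<open>lincomb\<close> sees only their values on S.\<close>

locale even_exponent = prob_space M for M :: "'a measure" +
  fixes S :: "'i set" and X :: "'i \<Rightarrow> 'a \<Rightarrow> real" and \<psi> :: "('i \<Rightarrow> real) \<Rightarrow> real"
  assumes X_meas: "t \<in> S \<Longrightarrow> X t \<in> borel_measurable M"
    and expectation_cos: "(\<integral>\<omega>. cos (lincomb S X z \<omega>) \<partial>M) = exp (- \<psi> z)"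
    and parallelogram: "\<psi> (\<lambda>t. z t + v t) + \<psi> (\<lambda>t. z t - v t) \<le> 2 * \<psi> z + 2 * \<psi> v"
begin

lemma lincomb_measurable [measurable]: "lincomb S X z \<in> borel_measurable M"
proof -
  have "(\<lambda>\<omega>. \<Sum>t\<in>S. z t * X t \<omega>) \<in> borel_measurable M"
    by (intro borel_measurable_sum borel_measurable_times borel_measurable_const X_meas)
  then show ?thesis by (simp add: lincomb_def[abs_def])
qed

text \<open>With \<Phi>(z) = E[W cos<z,X>], the condition says that the average of \<Phi>(z+v) and
  \<Phi>(z-v) is at least exp(-\<psi>(v)) \<Phi>(z). The shift z must be arbitrary: multiplying W by
  a cosine translates z, and only a condition at all z survives this.\<close>

definition dominated :: "('a \<Rightarrow> real) \<Rightarrow> bool" where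
  "dominated W \<longleftrightarrow> W \<in> borel_measurable M \<and> (\<forall>\<omega>. 0 \<le> W \<omega> \<and> W \<omega> \<le> 1) \<and>
     (\<forall>z v. exp (- \<psi> v) * (\<integral>\<omega>. W \<omega> * cos (lincomb S X z \<omega>) \<partial>M)
        \<le> (\<integral>\<omega>. W \<omega> * cos (lincomb S X z \<omega>) * cos (lincomb S X v \<omega>) \<partial>M))"

lemma dominated_measurable: "dominated W \<Longrightarrow> W \<in> borel_measurable M"
  and dominated_bounds: "dominated W \<Longrightarrow> 0 \<le> W \<omega>" "dominated W \<Longrightarrow> W \<omega> \<le> 1"
  by (simp_all add: dominated_def)

lemma dominatedD:
  "dominated W \<Longrightarrow> exp (- \<psi> v) * (\<integral>\<omega>. W \<omega> * cos (lincomb S X z \<omega>) \<partial>M)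
        \<le> (\<integral>\<omega>. W \<omega> * cos (lincomb S X z \<omega>) * cos (lincomb S X v \<omega>) \<partial>M)"
  by (simp add: dominated_def)

lemma integrable_bounded:
  assumes "f \<in> borel_measurable M" "\<And>\<omega>. \<bar>f \<omega>\<bar> \<le> (1 :: real)"
  shows "integrable M f"
  using assms by (intro integrable_const_bound[where B = 1]) auto

lemma abs_mult_cos_le:
  fixes w x y :: real
  assumes "0 \<le> w" "w \<le> 1"
  shows "\<bar>w * cos x\<bar> \<le> 1" "\<bar>w * cos x * cos y\<bar> \<le> 1"
proof -
  show *: "\<bar>w * cos x\<bar> \<le> 1" for x using assms by (simp add: abs_mult mult_le_one)
  show "\<bar>w * cos x * cos y\<bar> \<le> 1" using mult_le_one[OF *[of x] _ abs_cos_le_one[of y]]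
    by (simp add: abs_mult)
qed

text \<open>Here \<Phi> = exp(-\<psi>), so midpoint convexity of exp reduces the claim to the
  parallelogram inequality.\<close>

lemma dominated_one: "dominated (\<lambda>_. 1)"
proof -
  have "exp (- \<psi> v) * (\<integral>\<omega>. cos (lincomb S X z \<omega>) \<partial>M)
        \<le> (\<integral>\<omega>. cos (lincomb S X z \<omega>) * cos (lincomb S X v \<omega>) \<partial>M)" for z v
  proof -
    define a b where "a = \<psi> (\<lambda>t. z t + v t)" and "b = \<psi> (\<lambda>t. z t - v t)"
    have "exp (- \<psi> v) * (\<integral>\<omega>. cos (lincomb S X z \<omega>) \<partial>M) = exp (- (\<psi> z + \<psi> v))"
      by (simp add: expectation_cos flip: exp_add)
    also have "\<dots> \<le> exp ((1 - 1/2) *\<^sub>R (- a) + (1/2) *\<^sub>R (- b))"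
      using parallelogram[of z v] by (simp add: a_def b_def)
    also have "\<dots> \<le> (1 - 1/2) * exp (- a) + 1/2 * exp (- b)"
      by (intro convex_onD[OF exp_convex]) auto
    also have "\<dots> = 1/2 * ((\<integral>\<omega>. cos (lincomb S X z \<omega> + lincomb S X v \<omega>) \<partial>M) +
         (\<integral>\<omega>. cos (lincomb S X z \<omega> - lincomb S X v \<omega>) \<partial>M))"
      by (simp add: a_def b_def expectation_cos[symmetric] lincomb_linear)
    also have "\<dots> = 1/2 * (\<integral>\<omega>. cos (lincomb S X z \<omega> + lincomb S X v \<omega>) + cos (lincomb S X z \<omega> - lincomb S X v \<omega>) \<partial>M)"
      by (subst Bochner_Integration.integral_add) (auto intro!: integrable_bounded)
    also have "\<dots> = (\<integral>\<omega>. 1/2 * (cos (lincomb S X z \<omega> + lincomb S X v \<omega>) + cos (lincomb S X z \<omega> - lincomb S X v \<omega>)) \<partial>M)"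
      by simp
    also have "\<dots> = (\<integral>\<omega>. cos (lincomb S X z \<omega>) * cos (lincomb S X v \<omega>) \<partial>M)"
      by (simp add: cos_add cos_diff mult.commute)
    finally show ?thesis .
  qed
  then show ?thesis by (simp add: dominated_def)
qed

text \<open>Fubini for the cosine mixture. The bounded test function f is 1, a cosine or a product
  of two cosines in the applications.\<close>

lemma integral_times_bump:
  assumes W: "dominated W" and f: "f \<in> borel_measurable M" "\<And>\<omega>. \<bar>f \<omega>\<bar> \<le> 1"
  shows "(\<integral>\<omega>. W \<omega> * bump (lincomb S X l \<omega> / a) * f \<omega> \<partial>M) =
     (\<integral>u. (\<integral>\<omega>. W \<omega> * f \<omega> * cos (lincomb S X (\<lambda>t. u / a * l t) \<omega>) \<partial>M) \<partial>sinc4_measure)"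
    and "integrable sinc4_measure (\<lambda>u. \<integral>\<omega>. W \<omega> * f \<omega> * cos (lincomb S X (\<lambda>t. u / a * l t) \<omega>) \<partial>M)"
proof -
  interpret P: pair_prob_space M sinc4_measure ..
  have [measurable]: "W \<in> borel_measurable M" "f \<in> borel_measurable M"
    using W f by (auto simp: dominated_def)
  have Wf: "\<bar>W \<omega> * f \<omega>\<bar> \<le> 1" for \<omega>
    using f(2)[of \<omega>] dominated_bounds[OF W, of \<omega>] by (simp add: abs_mult mult_le_one)
  have bd: "\<bar>W \<omega> * f \<omega> * cos x\<bar> \<le> 1" for \<omega> x
    using mult_le_one[OF Wf[of \<omega>] _ abs_cos_le_one[of x]] by (simp add: abs_mult)
  have int: "integrable (M \<Otimes>\<^sub>M sinc4_measure) (\<lambda>(\<omega>, u). W \<omega> * f \<omega> * cos (u / a * lincomb S X l \<omega>))"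
    using bd by (intro P.integrable_const_bound[where B = 1]) (auto simp: split_beta)
  have "(\<integral>\<omega>. W \<omega> * bump (lincomb S X l \<omega> / a) * f \<omega> \<partial>M) =
     (\<integral>\<omega>. (\<integral>u. W \<omega> * f \<omega> * cos (u / a * lincomb S X l \<omega>) \<partial>sinc4_measure) \<partial>M)"
    by (simp add: bump_def mult_ac)
  also have "\<dots> = (\<integral>u. (\<integral>\<omega>. W \<omega> * f \<omega> * cos (u / a * lincomb S X l \<omega>) \<partial>M) \<partial>sinc4_measure)"
    using P.Fubini_integral[OF int] by simp
  finally show "(\<integral>\<omega>. W \<omega> * bump (lincomb S X l \<omega> / a) * f \<omega> \<partial>M) =
     (\<integral>u. (\<integral>\<omega>. W \<omega> * f \<omega> * cos (lincomb S X (\<lambda>t. u / a * l t) \<omega>) \<partial>M) \<partial>sinc4_measure)"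
    by (simp only: lincomb_linear)
  have "integrable sinc4_measure (\<lambda>u. \<integral>\<omega>. W \<omega> * f \<omega> * cos (u / a * lincomb S X l \<omega>) \<partial>M)"
    using P.integrable_snd[OF int] by simp
  then show "integrable sinc4_measure (\<lambda>u. \<integral>\<omega>. W \<omega> * f \<omega> * cos (lincomb S X (\<lambda>t. u / a * l t) \<omega>) \<partial>M)"
    by (simp only: lincomb_linear)
qed

text \<open>The kernel is a positive mixture of cosines, and multiplying by $\cos(uV)$ averages two
translates of the functional $z \mapsto E[W \cos\langle z, X\rangle]$, which respects the defining inequality.\<close>

lemma dominated_times_bump:
  assumes W: "dominated W"
  shows "dominated (\<lambda>\<omega>. W \<omega> * bump (lincomb S X l \<omega> / a))"
  unfolding dominated_def
proof (intro conjI allI)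
  have Wm [measurable]: "W \<in> borel_measurable M" by (rule dominated_measurable[OF W])
  note Wb = dominated_bounds[OF W]
  show "(\<lambda>\<omega>. W \<omega> * bump (lincomb S X l \<omega> / a)) \<in> borel_measurable M" by measurable
  show "0 \<le> W \<omega> * bump (lincomb S X l \<omega> / a)" "W \<omega> * bump (lincomb S X l \<omega> / a) \<le> 1" for \<omega>
    using Wb by (auto simp: bump_nonneg bump_le_one intro!: mult_le_one)
  fix z v :: "'i \<Rightarrow> real"
  \<comment> \<open>Product-to-sum formula with a spare factor f, which is 1 for the left side of
    the inequality and the cosine of the combination v for the right side.\<close>
  have split: "(\<integral>\<omega>. W \<omega> * cos (lincomb S X z \<omega>) * cos (lincomb S X w \<omega>) * f \<omega> \<partial>M) =
     1/2 * ((\<integral>\<omega>. W \<omega> * cos (lincomb S X (\<lambda>t. z t + w t) \<omega>) * f \<omega> \<partial>M) +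
            (\<integral>\<omega>. W \<omega> * cos (lincomb S X (\<lambda>t. z t - w t) \<omega>) * f \<omega> \<partial>M))"
    if f: "f \<in> borel_measurable M" "\<And>\<omega>. \<bar>f \<omega>\<bar> \<le> 1" for w f
  proof -
    have bd: "\<bar>W \<omega> * cos x * f \<omega>\<bar> \<le> 1" for \<omega> x
      using mult_le_one[OF abs_mult_cos_le(1)[OF Wb, of \<omega> x] _ f(2)[of \<omega>]] by (simp add: abs_mult)
    note [measurable] = f(1)
    have "(\<integral>\<omega>. W \<omega> * cos (lincomb S X z \<omega>) * cos (lincomb S X w \<omega>) * f \<omega> \<partial>M) =
       (\<integral>\<omega>. 1/2 * (W \<omega> * cos (lincomb S X (\<lambda>t. z t + w t) \<omega>) * f \<omega> +
                    W \<omega> * cos (lincomb S X (\<lambda>t. z t - w t) \<omega>) * f \<omega>) \<partial>M)"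
      by (intro Bochner_Integration.integral_cong refl) (simp add: lincomb_linear cos_add cos_diff algebra_simps)
    also have "\<dots> = 1/2 * ((\<integral>\<omega>. W \<omega> * cos (lincomb S X (\<lambda>t. z t + w t) \<omega>) * f \<omega> \<partial>M) +
            (\<integral>\<omega>. W \<omega> * cos (lincomb S X (\<lambda>t. z t - w t) \<omega>) * f \<omega> \<partial>M))"
      using bd by (subst integral_mult_right_zero, subst Bochner_Integration.integral_add) (auto intro!: integrable_bounded)
    finally show ?thesis .
  qed
  let ?F = "\<lambda>u. \<integral>\<omega>. W \<omega> * cos (lincomb S X z \<omega>) * cos (lincomb S X (\<lambda>t. u / a * l t) \<omega>) \<partial>M"
  let ?G = "\<lambda>u. \<integral>\<omega>. W \<omega> * (cos (lincomb S X z \<omega>) * cos (lincomb S X v \<omega>)) * cos (lincomb S X (\<lambda>t. u / a * l t) \<omega>) \<partial>M"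
  have le: "exp (- \<psi> v) * ?F u \<le> ?G u" for u
  proof -
    define w where "w = (\<lambda>t. u / a * l t)"
    have "exp (- \<psi> v) * ?F u = 1/2 * (exp (- \<psi> v) * (\<integral>\<omega>. W \<omega> * cos (lincomb S X (\<lambda>t. z t + w t) \<omega>) \<partial>M) +
            exp (- \<psi> v) * (\<integral>\<omega>. W \<omega> * cos (lincomb S X (\<lambda>t. z t - w t) \<omega>) \<partial>M))"
      using split[of "\<lambda>_. 1" w] by (simp add: w_def algebra_simps)
    also have "\<dots> \<le> 1/2 * ((\<integral>\<omega>. W \<omega> * cos (lincomb S X (\<lambda>t. z t + w t) \<omega>) * cos (lincomb S X v \<omega>) \<partial>M) +
            (\<integral>\<omega>. W \<omega> * cos (lincomb S X (\<lambda>t. z t - w t) \<omega>) * cos (lincomb S X v \<omega>) \<partial>M))"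
      by (intro mult_left_mono add_mono dominatedD[OF W]) auto
    also have "\<dots> = (\<integral>\<omega>. W \<omega> * cos (lincomb S X z \<omega>) * cos (lincomb S X w \<omega>) * cos (lincomb S X v \<omega>) \<partial>M)"
      by (rule split[symmetric]) auto
    also have "\<dots> = ?G u" by (simp add: w_def mult_ac)
    finally show ?thesis .
  qed
  have "exp (- \<psi> v) * (\<integral>\<omega>. W \<omega> * bump (lincomb S X l \<omega> / a) * cos (lincomb S X z \<omega>) \<partial>M) =
     (\<integral>u. exp (- \<psi> v) * ?F u \<partial>sinc4_measure)"
    by (subst integral_times_bump[OF W]) auto
  also have "\<dots> \<le> (\<integral>u. ?G u \<partial>sinc4_measure)"
    using le by (intro integral_mono integrable_mult_right integral_times_bump(2)[OF W])
      (auto simp: abs_mult mult_le_one)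
  also have "\<dots> = (\<integral>\<omega>. W \<omega> * bump (lincomb S X l \<omega> / a) * (cos (lincomb S X z \<omega>) * cos (lincomb S X v \<omega>)) \<partial>M)"
    by (rule integral_times_bump(1)[OF W, symmetric]) (auto simp: abs_mult mult_le_one)
  finally show "exp (- \<psi> v) * (\<integral>\<omega>. W \<omega> * bump (lincomb S X l \<omega> / a) * cos (lincomb S X z \<omega>) \<partial>M)
      \<le> (\<integral>\<omega>. W \<omega> * bump (lincomb S X l \<omega> / a) * cos (lincomb S X z \<omega>) * cos (lincomb S X v \<omega>) \<partial>M)"
    by (simp add: mult_ac)
qed

text \<open>The case z = 0: after tilting, the characteristic function of each linear combination
  lies above the original one, so the tilt does not spread the combination out.\<close>

lemma dominated_cos_ge:
  assumes "dominated W"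
  shows "exp (- \<psi> v) * (\<integral>\<omega>. W \<omega> \<partial>M) \<le> (\<integral>\<omega>. W \<omega> * cos (lincomb S X v \<omega>) \<partial>M)"
  using dominatedD[OF assms, of v "\<lambda>_. 0"] by (simp add: lincomb_linear)

text \<open>Integrating \<open>dominated_cos_ge\<close> over the frequencies u/a shows that a
  further factor costs no more than its own one-dimensional expectation. This is the substitute for
  a Sidak inequality.\<close>

lemma expectation_times_bump_ge:
  assumes W: "dominated W" and "0 < a" "0 \<le> r"
    and \<psi>: "\<And>u. \<psi> (\<lambda>t. u * l t) = (r * \<bar>u\<bar>) powr \<alpha>"
  shows "stable_bump \<alpha> (r / a) * (\<integral>\<omega>. W \<omega> \<partial>M) \<le> (\<integral>\<omega>. W \<omega> * bump (lincomb S X l \<omega> / a) \<partial>M)"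
proof -
  have "stable_bump \<alpha> (r / a) * (\<integral>\<omega>. W \<omega> \<partial>M) =
     (\<integral>u. exp (- \<psi> (\<lambda>t. u / a * l t)) * (\<integral>\<omega>. W \<omega> \<partial>M) \<partial>sinc4_measure)"
    using assms unfolding stable_bump_def \<psi> by simp
  also have "\<dots> \<le> (\<integral>u. (\<integral>\<omega>. W \<omega> * 1 * cos (lincomb S X (\<lambda>t. u / a * l t) \<omega>) \<partial>M) \<partial>sinc4_measure)"
  proof (rule integral_mono)
    show "integrable sinc4_measure (\<lambda>u. exp (- \<psi> (\<lambda>t. u / a * l t)) * (\<integral>\<omega>. W \<omega> \<partial>M))"
      unfolding \<psi> by (intro integrable_mult_left sinc4.integrable_const_bound[where B = 1]) auto
    show "integrable sinc4_measure (\<lambda>u. \<integral>\<omega>. W \<omega> * 1 * cos (lincomb S X (\<lambda>t. u / a * l t) \<omega>) \<partial>M)"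
      by (rule integral_times_bump(2)[OF W]) auto
    show "exp (- \<psi> (\<lambda>t. u / a * l t)) * (\<integral>\<omega>. W \<omega> \<partial>M) \<le> (\<integral>\<omega>. W \<omega> * 1 * cos (lincomb S X (\<lambda>t. u / a * l t) \<omega>) \<partial>M)" for u
      using dominated_cos_ge[OF W] by simp
  qed
  also have "\<dots> = (\<integral>\<omega>. W \<omega> * bump (lincomb S X l \<omega> / a) * 1 \<partial>M)"
    by (rule integral_times_bump(1)[OF W, symmetric]) auto
  finally show ?thesis by simp
qed

text \<open>The dyadic bound is applied to Y/(4a), which the support keeps in [-1, 1]. The k-th term
  has tilted mean at most 2^(k\<alpha>) (r/(4a))^\<alpha> E W with weight 2^(-k\<gamma>), a
  geometric series of ratio 2^(\<alpha>-\<gamma>) < 1. The result has the size of a moment of a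
  stable law of scale r truncated at order a.\<close>

lemma dominated_moment_le:
  assumes W: "dominated W" and "0 < a" "0 \<le> r" "0 < \<alpha>" "\<alpha> < \<gamma>"
    and \<psi>: "\<And>u. \<psi> (\<lambda>t. u * l t) = (r * \<bar>u\<bar>) powr \<alpha>"
    and supp: "\<And>\<omega>. W \<omega> \<noteq> 0 \<Longrightarrow> \<bar>lincomb S X l \<omega>\<bar> \<le> 4 * a"
  shows "(\<integral>\<omega>. W \<omega> * \<bar>lincomb S X l \<omega>\<bar> powr \<gamma> \<partial>M)
     \<le> moment_const \<alpha> \<gamma> * r powr \<alpha> * a powr (\<gamma> - \<alpha>) * (\<integral>\<omega>. W \<omega> \<partial>M)"
proof -
  have Wm [measurable]: "W \<in> borel_measurable M" by (rule dominated_measurable[OF W])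
  note Wb = dominated_bounds[OF W]
  define c where "c = 4 * a"
  define E where "E = (\<integral>\<omega>. W \<omega> \<partial>M)"
  define q where "q = 2 powr (\<alpha> - \<gamma>)"
  have c: "c > 0" using assms by (simp add: c_def)
  have q: "0 < q" "q < 1" using assms powr_less_mono[of "\<alpha> - \<gamma>" 0 2] by (auto simp: q_def)
  have E: "E \<ge> 0" unfolding E_def using Wb by (intro Bochner_Integration.integral_nonneg) auto
  have Wi: "integrable M W" using Wb by (intro integrable_bounded) (auto simp: abs_le_iff intro: order_trans[of _ 0])
  let ?Y = "lincomb S X l"
  have cos_int: "integrable M (\<lambda>\<omega>. W \<omega> * (1 - cos (2 ^ k * (?Y \<omega> / c))))" for k :: nat
    unfolding right_diff_distrib using abs_mult_cos_le(1)[OF Wb] Wi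
    by (intro Bochner_Integration.integrable_diff) (auto intro!: integrable_bounded)
  have cos_le: "(\<integral>\<omega>. W \<omega> * (1 - cos (2 ^ k * (?Y \<omega> / c))) \<partial>M) \<le> (2 powr \<alpha>) ^ k * (r / c) powr \<alpha> * E" for k :: nat
  proof -
    have "(\<integral>\<omega>. W \<omega> * (1 - cos (2 ^ k * (?Y \<omega> / c))) \<partial>M) = E - (\<integral>\<omega>. W \<omega> * cos (lincomb S X (\<lambda>t. 2 ^ k / c * l t) \<omega>) \<partial>M)"
      unfolding right_diff_distrib lincomb_linear E_def using abs_mult_cos_le(1)[OF Wb] Wi
      by (subst Bochner_Integration.integral_diff) (auto intro!: integrable_bounded)
    also have "\<dots> \<le> E - exp (- \<psi> (\<lambda>t. 2 ^ k / c * l t)) * E"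
      using dominated_cos_ge[OF W, of "\<lambda>t. 2 ^ k / c * l t"] by (simp add: E_def)
    also have "\<dots> = (1 - exp (- \<psi> (\<lambda>t. 2 ^ k / c * l t))) * E" by (simp add: algebra_simps)
    also have "\<dots> \<le> \<psi> (\<lambda>t. 2 ^ k / c * l t) * E"
      using exp_ge_add_one_self[of "- \<psi> (\<lambda>t. 2 ^ k / c * l t)"] E by (intro mult_right_mono) auto
    also have "\<psi> (\<lambda>t. 2 ^ k / c * l t) = (2 powr \<alpha>) ^ k * (r / c) powr \<alpha>"
    proof -
      have "r * \<bar>2 ^ k / c\<bar> = 2 powr real k * (r / c)" using c by (simp add: powr_realpow)
      also have "(2 powr real k * (r / c)) powr \<alpha> = 2 powr (real k * \<alpha>) * (r / c) powr \<alpha>"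
        using c assms(3) by (simp only: powr_mult[of "2 powr real k" "r / c"] powr_powr)
      also have "2 powr (real k * \<alpha>) = (2 powr \<alpha>) ^ k" by (simp add: powr_powr mult.commute flip: powr_realpow)
      finally show ?thesis unfolding \<psi> .
    qed
    finally show ?thesis .
  qed
  have bound: "(\<integral>\<omega>. W \<omega> * \<bar>?Y \<omega>\<bar> powr \<gamma> \<partial>M) \<le> c powr \<gamma> * (16 / (1 - q) * (r / c) powr \<alpha> * E + 2 powr (- \<gamma> * real K) * E)" for K
  proof -
    let ?g = "\<lambda>\<omega>. (\<Sum>k<K. 16 * 2 powr (- \<gamma> * real k) * (W \<omega> * (1 - cos (2 ^ k * (?Y \<omega> / c))))) + 2 powr (- \<gamma> * real K) * W \<omega>"
    have gi: "integrable M ?g" using cos_int Wi by auto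
    have pt: "W \<omega> * \<bar>?Y \<omega>\<bar> powr \<gamma> \<le> c powr \<gamma> * ?g \<omega>" for \<omega>
    proof (cases "W \<omega> = 0")
      case False
      have "W \<omega> * \<bar>?Y \<omega>\<bar> powr \<gamma> = c powr \<gamma> * (W \<omega> * \<bar>?Y \<omega> / c\<bar> powr \<gamma>)"
        using c by (simp add: powr_divide)
      also have "\<dots> \<le> c powr \<gamma> * (W \<omega> * ((\<Sum>k<K. 16 * 2 powr (- \<gamma> * real k) * (1 - cos (2 ^ k * (?Y \<omega> / c)))) + 2 powr (- \<gamma> * real K)))"
        using supp[OF False] c Wb assms
        by (intro mult_left_mono abs_powr_le_sum_one_minus_cos) (auto simp: c_def)
      also have "\<dots> = c powr \<gamma> * ?g \<omega>"
        by (simp add: distrib_left sum_distrib_left mult_ac)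
      finally show ?thesis .
    qed simp
    have "(\<integral>\<omega>. W \<omega> * \<bar>?Y \<omega>\<bar> powr \<gamma> \<partial>M) \<le> (\<integral>\<omega>. c powr \<gamma> * ?g \<omega> \<partial>M)"
    \<comment> \<open>This rule asks for integrability of the majorant only.\<close>
    proof (rule integral_mono')
      show "0 \<le> c powr \<gamma> * ?g \<omega>" for \<omega>
        by (rule order_trans[OF _ pt]) (use Wb in auto)
    qed (use pt gi in auto)
    also have "\<dots> = c powr \<gamma> * ((\<Sum>k<K. 16 * 2 powr (- \<gamma> * real k) * (\<integral>\<omega>. W \<omega> * (1 - cos (2 ^ k * (?Y \<omega> / c))) \<partial>M)) + 2 powr (- \<gamma> * real K) * E)"
      using cos_int Wi by (subst integral_mult_right_zero, subst Bochner_Integration.integral_add) (auto simp: E_def Bochner_Integration.integral_sum)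
    also have "\<dots> \<le> c powr \<gamma> * ((\<Sum>k<K. 16 * 2 powr (- \<gamma> * real k) * ((2 powr \<alpha>) ^ k * (r / c) powr \<alpha> * E)) + 2 powr (- \<gamma> * real K) * E)"
      by (intro mult_left_mono add_right_mono sum_mono cos_le) auto
    also have "(\<Sum>k<K. 16 * 2 powr (- \<gamma> * real k) * ((2 powr \<alpha>) ^ k * (r / c) powr \<alpha> * E)) = 16 * (\<Sum>k<K. q ^ k) * ((r / c) powr \<alpha> * E)"
    proof -
      have "2 powr (- \<gamma> * real k) * (2 powr \<alpha>) ^ k = q ^ k" for k
        by (simp add: q_def powr_diff powr_powr powr_minus divide_simps flip: powr_realpow)
      then have "16 * 2 powr (- \<gamma> * real k) * ((2 powr \<alpha>) ^ k * (r / c) powr \<alpha> * E) =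
          16 * q ^ k * ((r / c) powr \<alpha> * E)" for k
        by (simp only: mult.assoc[symmetric]) (simp only: mult.assoc)
      then show ?thesis by (simp only: sum_distrib_left sum_distrib_right)
    qed
    also have "c powr \<gamma> * (16 * (\<Sum>k<K. q ^ k) * ((r / c) powr \<alpha> * E) + 2 powr (- \<gamma> * real K) * E) \<le>
        c powr \<gamma> * (16 * (1 / (1 - q)) * ((r / c) powr \<alpha> * E) + 2 powr (- \<gamma> * real K) * E)"
    proof (intro mult_left_mono add_right_mono mult_right_mono)
      show "(\<Sum>k<K. q ^ k) \<le> 1 / (1 - q)"
        using q sum_le_suminf[of "\<lambda>k. q ^ k" "{..<K}"] by (simp add: suminf_geometric summable_geometric)
    qed (use E in auto)
    finally show ?thesis by (simp add: mult.assoc)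
  qed
  \<comment> \<open>The number K of dyadic scales is free; letting it grow removes the remainder
    2^(-\<gamma> K), which carries no factor r^\<alpha>.\<close>
  have "(\<lambda>K. c powr \<gamma> * (16 / (1 - q) * (r / c) powr \<alpha> * E + 2 powr (- \<gamma> * real K) * E)) \<longlonglongrightarrow>
     c powr \<gamma> * (16 / (1 - q) * (r / c) powr \<alpha> * E)"
  proof (intro tendsto_intros)
    have "(\<lambda>K. (2 powr (- \<gamma>)) ^ K) \<longlonglongrightarrow> 0"
      using assms powr_less_mono[of "- \<gamma>" 0 2] by (intro LIMSEQ_power_zero) auto
    then have "(\<lambda>K. 2 powr (- \<gamma> * real K)) \<longlonglongrightarrow> 0" by (simp add: powr_powr flip: powr_realpow)
    from tendsto_add[OF tendsto_const tendsto_mult_right[OF this, of E], of "16 / (1 - q) * (r / c) powr \<alpha> * E"]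
    show "(\<lambda>K. 16 / (1 - q) * (r / c) powr \<alpha> * E + 2 powr (- \<gamma> * real K) * E) \<longlonglongrightarrow> 16 / (1 - q) * (r / c) powr \<alpha> * E"
      by simp
  qed
  then have "(\<integral>\<omega>. W \<omega> * \<bar>?Y \<omega>\<bar> powr \<gamma> \<partial>M) \<le> c powr \<gamma> * (16 / (1 - q) * (r / c) powr \<alpha> * E)"
    by (rule LIMSEQ_le_const) (use bound in auto)
  also have "\<dots> = moment_const \<alpha> \<gamma> * r powr \<alpha> * a powr (\<gamma> - \<alpha>) * E"
  proof -
    have "c powr \<gamma> * (r / c) powr \<alpha> = 4 powr (\<gamma> - \<alpha>) * a powr (\<gamma> - \<alpha>) * r powr \<alpha>"
      using assms c by (simp add: powr_divide powr_diff c_def powr_mult)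
    moreover have "c powr \<gamma> * (16 / (1 - q) * (r / c) powr \<alpha> * E) =
        16 / (1 - q) * (c powr \<gamma> * (r / c) powr \<alpha>) * E"
      by (simp only: mult_ac)
    ultimately have "c powr \<gamma> * (16 / (1 - q) * (r / c) powr \<alpha> * E) =
        16 / (1 - q) * (4 powr (\<gamma> - \<alpha>) * a powr (\<gamma> - \<alpha>) * r powr \<alpha>) * E"
      by simp
    then show ?thesis unfolding moment_const_def q_def by (simp only: mult_ac)
  qed
  finally show ?thesis by (simp add: E_def)
qed

end

subsection \<open>Chaining under the tilted law\<close>

context even_exponent
begin

lemma dominated_prod_bump:
  assumes "finite I"
  shows "dominated (\<lambda>\<omega>. \<Prod>k\<in>I. bump (lincomb S X (l k) \<omega> / a k))"
  using assms
proof (induction I rule: finite_induct)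
  case empty
  then show ?case by (simp add: dominated_one)
next
  case (insert x F)
  then show ?case using dominated_times_bump[OF insert.IH, of "l x" "a x"]
    by (simp add: mult.commute)
qed

text \<open>Factors are attached one at a time. Each partial product is again
  \<open>dominated\<close>, so no dependence between the links has to be examined.\<close>

lemma expectation_prod_bump_ge:
  assumes "finite I" and "\<And>k. k \<in> I \<Longrightarrow> 0 < a k" "\<And>k. k \<in> I \<Longrightarrow> 0 \<le> r k"
    and "\<And>k u. k \<in> I \<Longrightarrow> \<psi> (\<lambda>t. u * l k t) = (r k * \<bar>u\<bar>) powr \<alpha>"
  shows "(\<Prod>k\<in>I. stable_bump \<alpha> (r k / a k)) \<le> (\<integral>\<omega>. (\<Prod>k\<in>I. bump (lincomb S X (l k) \<omega> / a k)) \<partial>M)"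
  using assms
proof (induction I rule: finite_induct)
  case empty
  then show ?case by (simp add: prob_space)
next
  case (insert x F)
  have "(\<Prod>k\<in>insert x F. stable_bump \<alpha> (r k / a k)) = stable_bump \<alpha> (r x / a x) * (\<Prod>k\<in>F. stable_bump \<alpha> (r k / a k))"
    using insert by simp
  also have "\<dots> \<le> stable_bump \<alpha> (r x / a x) * (\<integral>\<omega>. (\<Prod>k\<in>F. bump (lincomb S X (l k) \<omega> / a k)) \<partial>M)"
    using insert by (intro mult_left_mono insert.IH) (auto simp: stable_bump_def intro!: Bochner_Integration.integral_nonneg)
  also have "\<dots> \<le> (\<integral>\<omega>. (\<Prod>k\<in>F. bump (lincomb S X (l k) \<omega> / a k)) * bump (lincomb S X (l x) \<omega> / a x) \<partial>M)"
    using insert by (intro expectation_times_bump_ge dominated_prod_bump) auto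
  also have "\<dots> = (\<integral>\<omega>. (\<Prod>k\<in>insert x F. bump (lincomb S X (l k) \<omega> / a k)) \<partial>M)"
    using insert by (simp add: mult.commute)
  finally show ?case .
qed

lemma prod_bump_nonzero_imp:
  assumes "finite I" "(\<Prod>k\<in>I. bump (lincomb S X (l k) \<omega> / a k)) \<noteq> 0" "k \<in> I" "0 < a k"
  shows "\<bar>lincomb S X (l k) \<omega>\<bar> \<le> 4 * a k"
proof -
  have "bump (lincomb S X (l k) \<omega> / a k) \<noteq> 0" using assms by auto
  then have "\<bar>lincomb S X (l k) \<omega> / a k\<bar> \<le> 4" using bump_eq_0 by (meson not_le)
  then show ?thesis using assms by (simp add: abs_divide field_simps)
qed

end

section \<open>Stable vectors as instances of the locale, and the chaining bound\<close>

lemma cis_measurable [measurable (raw)]: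
  assumes "f \<in> borel_measurable M"
  shows "(\<lambda>x. cis (f x)) \<in> borel_measurable M"
  unfolding cis_conv_exp using assms by measurable

text \<open>The exponent is the spectral integral of |<u,s>|^\<alpha>; its parallelogram inequality
  holds for each s and is then integrated over the spectral measure.\<close>

lemma sas_vector_even_exponent:
  assumes "prob_space M" "finite S" and meas: "\<And>t. t \<in> S \<Longrightarrow> X t \<in> borel_measurable M"
    and \<alpha>: "0 < \<alpha>" "\<alpha> \<le> 2" and "sas_vector M \<alpha> S X"
  obtains \<psi> where "even_exponent M S X \<psi>"
    "\<And>u. (CLINT \<omega>|M. cis (lincomb S X u \<omega>)) = complex_of_real (exp (- \<psi> u))"
proof -
  interpret prob_space M by fact
  obtain \<Gamma> where fin: "finite_measure \<Gamma>" and sets [measurable_cong]: "sets \<Gamma> = sets (PiM S (\<lambda>_. borel))"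
    and null: "emeasure \<Gamma> (space \<Gamma> - {s \<in> space \<Gamma>. (\<Sum>t\<in>S. (s t)\<^sup>2) = (1 :: real)}) = 0"
    and cf: "\<And>u :: 'b \<Rightarrow> real. (CLINT \<omega>|M. cis (\<Sum>t\<in>S. u t * X t \<omega>))
             = complex_of_real (exp (- (\<integral>s. \<bar>\<Sum>t\<in>S. u t * s t\<bar> powr \<alpha> \<partial>\<Gamma>)))"
    using assms(6) unfolding sas_vector_def by blast
  interpret G: finite_measure \<Gamma> by fact
  define \<psi> where "\<psi> u = (\<integral>s. \<bar>\<Sum>t\<in>S. u t * s t\<bar> powr \<alpha> \<partial>\<Gamma>)" for u :: "'b \<Rightarrow> real"
  have [measurable]: "(\<lambda>s. \<Sum>t\<in>S. u t * s t) \<in> borel_measurable \<Gamma>" for u :: "'b \<Rightarrow> real"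
  proof (intro borel_measurable_sum borel_measurable_times borel_measurable_const)
    fix t assume "t \<in> S"
    then have "(\<lambda>s. s t) \<in> borel_measurable (PiM S (\<lambda>_. borel :: real measure))"
      by (rule measurable_component_singleton)
    then show "(\<lambda>s. s t) \<in> borel_measurable \<Gamma>" by (simp add: measurable_cong_sets[OF sets])
  qed
  have [measurable]: "(\<lambda>s. \<Sum>t\<in>S. (s t)\<^sup>2) \<in> borel_measurable \<Gamma>"
  proof (intro borel_measurable_sum borel_measurable_power)
    fix t assume "t \<in> S"
    then have "(\<lambda>s. s t) \<in> borel_measurable (PiM S (\<lambda>_. borel :: real measure))"
      by (rule measurable_component_singleton)
    then show "(\<lambda>s. s t) \<in> borel_measurable \<Gamma>" by (simp add: measurable_cong_sets[OF sets])
  qed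
  \<comment> \<open>On the unit sphere every coordinate is at most 1 in modulus, which bounds the
    integrand and makes it integrable for the finite measure \<open>\<Gamma>\<close>.\<close>
  have sphere: "AE s in \<Gamma>. (\<Sum>t\<in>S. (s t)\<^sup>2) = 1"
    by (rule AE_I[OF _ null]) auto
  have int: "integrable \<Gamma> (\<lambda>s. \<bar>\<Sum>t\<in>S. u t * s t\<bar> powr \<alpha>)" for u :: "'b \<Rightarrow> real"
  proof (rule G.integrable_const_bound[where B = "(\<Sum>t\<in>S. \<bar>u t\<bar>) powr \<alpha>"])
    show "AE s in \<Gamma>. norm (\<bar>\<Sum>t\<in>S. u t * s t\<bar> powr \<alpha>) \<le> (\<Sum>t\<in>S. \<bar>u t\<bar>) powr \<alpha>"
      using sphere
    proof eventually_elim
      case (elim s)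
      have "\<bar>s t\<bar> \<le> 1" if "t \<in> S" for t
        using that elim member_le_sum[of t S "\<lambda>t. (s t)\<^sup>2"] \<open>finite S\<close> by (simp add: abs_square_le_1)
      then have "\<bar>\<Sum>t\<in>S. u t * s t\<bar> \<le> (\<Sum>t\<in>S. \<bar>u t\<bar>)"
        by (intro order_trans[OF sum_abs] sum_mono) (auto simp: abs_mult mult_left_le)
      then show ?case using \<alpha> by (auto intro!: powr_mono2)
    qed
  qed measurable
  have [measurable]: "lincomb S X u \<in> borel_measurable M" for u
  proof -
    have "(\<lambda>\<omega>. \<Sum>t\<in>S. u t * X t \<omega>) \<in> borel_measurable M"
      by (intro borel_measurable_sum borel_measurable_times borel_measurable_const meas)
    then show ?thesis by (simp add: lincomb_def[abs_def])
  qed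
  have cf': "(CLINT \<omega>|M. cis (lincomb S X u \<omega>)) = complex_of_real (exp (- \<psi> u))" for u
    using cf[of u] by (simp add: lincomb_def \<psi>_def)
  have "even_exponent M S X \<psi>"
  proof
    show "X t \<in> borel_measurable M" if "t \<in> S" for t using that by (rule meas)
    show "(\<integral>\<omega>. cos (lincomb S X z \<omega>) \<partial>M) = exp (- \<psi> z)" for z
    proof -
      have "integrable M (\<lambda>\<omega>. cis (lincomb S X z \<omega>))"
        by (rule integrable_const_bound[where B = 1]) auto
      then have "(\<integral>\<omega>. Re (cis (lincomb S X z \<omega>)) \<partial>M) = Re (CLINT \<omega>|M. cis (lincomb S X z \<omega>))"
        by (rule integral_Re)
      then show ?thesis by (simp add: cf')
    qed
    show "\<psi> (\<lambda>t. z t + v t) + \<psi> (\<lambda>t. z t - v t) \<le> 2 * \<psi> z + 2 * \<psi> v" for z v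
    proof -
      have "\<psi> (\<lambda>t. z t + v t) + \<psi> (\<lambda>t. z t - v t) =
          (\<integral>s. \<bar>\<Sum>t\<in>S. (z t + v t) * s t\<bar> powr \<alpha> + \<bar>\<Sum>t\<in>S. (z t - v t) * s t\<bar> powr \<alpha> \<partial>\<Gamma>)"
        unfolding \<psi>_def by (rule Bochner_Integration.integral_add[OF int int, symmetric])
      also have "\<dots> \<le> (\<integral>s. 2 * (\<bar>\<Sum>t\<in>S. z t * s t\<bar> powr \<alpha> + \<bar>\<Sum>t\<in>S. v t * s t\<bar> powr \<alpha>) \<partial>\<Gamma>)"
      proof (rule integral_mono)
        fix s
        show "\<bar>\<Sum>t\<in>S. (z t + v t) * s t\<bar> powr \<alpha> + \<bar>\<Sum>t\<in>S. (z t - v t) * s t\<bar> powr \<alpha>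
            \<le> 2 * (\<bar>\<Sum>t\<in>S. z t * s t\<bar> powr \<alpha> + \<bar>\<Sum>t\<in>S. v t * s t\<bar> powr \<alpha>)"
          using abs_powr_parallelogram_le[OF \<alpha>, of "\<Sum>t\<in>S. z t * s t" "\<Sum>t\<in>S. v t * s t"]
          by (simp add: sum.distrib sum_subtractf algebra_simps)
      qed (intro Bochner_Integration.integrable_add integrable_mult_right int)+
      also have "\<dots> = 2 * \<psi> z + 2 * \<psi> v"
        unfolding \<psi>_def using int[of z] int[of v] by simp
      finally show ?thesis .
    qed
  qed
  from that[OF this cf'] show thesis .
qed

text \<open>A difference of two indicators, so that it vanishes for t = s, as happens when a point
  is its own parent.\<close>

definition link_coeff :: "'i \<Rightarrow> 'i \<Rightarrow> 'i \<Rightarrow> real" where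
  "link_coeff t s x = (if x = t then 1 else 0) - (if x = s then 1 else 0)"

lemma lincomb_link_coeff:
  assumes "finite S" "s \<in> S" "t \<in> S"
  shows "lincomb S X (link_coeff t s) \<omega> = X t \<omega> - X s \<omega>"
proof -
  have "lincomb S X (link_coeff t s) \<omega> = (\<Sum>x\<in>S. if x = t then X x \<omega> else 0) - (\<Sum>x\<in>S. if x = s then X x \<omega> else 0)"
    unfolding lincomb_def link_coeff_def sum_subtractf[symmetric] by (intro sum.cong) auto
  then show ?thesis using assms by simp
qed

text \<open>\<open>H\<close> is a tree of nets rooted at t0 with parent map p. Bumps of width a k
  cap the links of level k at 4 a k. On levels in J the cap is not summed: the maximum is at most b
  k plus b k^(1-\<gamma>) times the sum of the \<gamma>-th powers, and the tilted mean of this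
  excess over all J is at most \<epsilon>/8. Markov at \<epsilon>/4 keeps half of the tilted mass,
  and W \<le> 1 turns mass into probability.\<close>

lemma chain_small_ball:
  fixes X :: "'i \<Rightarrow> 'a \<Rightarrow> real" and H :: "nat \<Rightarrow> 'i set" and r a b :: "nat \<Rightarrow> real"
  assumes "prob_space M" and \<alpha>: "0 < \<alpha>" "\<alpha> \<le> 2" and sas: "sas_process M \<alpha> T X"
    and rho_nonneg: "\<And>s t. s \<in> T \<Longrightarrow> t \<in> T \<Longrightarrow> 0 \<le> \<rho> s t"
    and rho_scale: "\<And>s t u. s \<in> T \<Longrightarrow> t \<in> T \<Longrightarrow>
          (CLINT \<omega>|M. cis (u * (X t \<omega> - X s \<omega>)))
            = complex_of_real (exp (- (\<rho> t s powr \<alpha>) * \<bar>u\<bar> powr \<alpha>))"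
    and H: "\<And>k. k \<le> m \<Longrightarrow> finite (H k)" "\<And>k. k \<le> m \<Longrightarrow> H k \<subseteq> T" "H 0 = {t0}"
    and p: "\<And>k t. k \<in> {1..m} \<Longrightarrow> t \<in> H k \<Longrightarrow> p k t \<in> H (k - 1)"
      "\<And>k t. k \<in> {1..m} \<Longrightarrow> t \<in> H k \<Longrightarrow> \<rho> t (p k t) \<le> r k"
    and a: "\<And>k. k \<in> {1..m} \<Longrightarrow> 0 < a k"
    and \<gamma>: "\<alpha> < \<gamma>" "1 \<le> \<gamma>" and J: "J \<subseteq> {1..m}" and b: "\<And>k. k \<in> J \<Longrightarrow> 0 < b k"
    and sum_le: "(\<Sum>k\<in>{1..m} - J. 4 * a k) + (\<Sum>k\<in>J. b k) \<le> \<epsilon> / 4"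
    and mom_le: "(\<Sum>k\<in>J. b k powr (1 - \<gamma>) * (real (card (H k)) * (moment_const \<alpha> \<gamma> * r k powr \<alpha> * a k powr (\<gamma> - \<alpha>)))) \<le> \<epsilon> / 8"
    and "0 < \<epsilon>"
  shows "1/2 * (\<Prod>k\<in>{1..m}. stable_bump \<alpha> (r k / a k) ^ card (H k)) \<le>
      measure M {\<omega> \<in> space M. \<forall>s\<in>H m. \<forall>t\<in>H m. \<bar>X s \<omega> - X t \<omega>\<bar> \<le> \<epsilon>}"
proof -
  define S where "S = (\<Union>k\<le>m. H k)"
  have S: "finite S" "S \<subseteq> T" using H by (auto simp: S_def)
  have HS: "t \<in> H k \<Longrightarrow> k \<le> m \<Longrightarrow> t \<in> S" for t k by (auto simp: S_def)
  have pS: "t \<in> H k \<Longrightarrow> k \<in> {1..m} \<Longrightarrow> p k t \<in> S" for t k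
    using p(1)[of k t] HS[of "p k t" "k - 1"] by auto
  have vec: "sas_vector M \<alpha> S X" and X_meas: "\<And>t. t \<in> S \<Longrightarrow> X t \<in> borel_measurable M"
    using sas S unfolding sas_process_def by auto
  obtain \<psi> where "even_exponent M S X \<psi>"
    and cf: "\<And>u. (CLINT \<omega>|M. cis (lincomb S X u \<omega>)) = complex_of_real (exp (- \<psi> u))"
    using sas_vector_even_exponent[OF \<open>prob_space M\<close> S(1) X_meas \<alpha> vec] by blast
  then interpret E: even_exponent M S X \<psi> by simp
  \<comment> \<open>The scale \<rho> and the exponent describe the same characteristic function, so
    injectivity of exp identifies them on increments.\<close>
  have link: "\<psi> (\<lambda>x. u * link_coeff t s x) = (\<rho> t s * \<bar>u\<bar>) powr \<alpha>" if "s \<in> S" "t \<in> S" for s t u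
  proof -
    have "complex_of_real (exp (- \<psi> (\<lambda>x. u * link_coeff t s x))) = complex_of_real (exp (- (\<rho> t s powr \<alpha>) * \<bar>u\<bar> powr \<alpha>))"
      unfolding cf[symmetric] lincomb_linear lincomb_link_coeff[OF S(1) that]
      using that S(2) by (intro rho_scale) auto
    then have "\<psi> (\<lambda>x. u * link_coeff t s x) = \<rho> t s powr \<alpha> * \<bar>u\<bar> powr \<alpha>"
      by (simp only: of_real_eq_iff exp_inj_iff)
    then show ?thesis using that S(2) rho_nonneg by (simp add: powr_mult subset_iff)
  qed
  \<comment> \<open>Links are indexed by level and point, since one point may occur in several nets
    with different parents and caps.\<close>
  define I where "I = Sigma {1..m} H"
  have I: "finite I" using H by (auto simp: I_def)
  define l where "l = (\<lambda>(k, t). link_coeff t (p k t))"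
  define A where "A = (\<lambda>(k :: nat, t :: 'i). a k)"
  define R where "R = (\<lambda>(k, t). \<rho> t (p k t))"
  have IS: "t \<in> S" "p k t \<in> S" if "(k, t) \<in> I" for k t
    using that HS[of t k] pS[of t k] by (auto simp: I_def)
  have Apos: "0 < A i" if "i \<in> I" for i using that a by (auto simp: A_def I_def)
  have Rnn: "0 \<le> R i" if "i \<in> I" for i
  proof -
    obtain k t where kt: "i = (k, t)" by (cases i)
    have "t \<in> T" "p k t \<in> T" using IS[of k t] that S(2) kt by auto
    then show ?thesis using rho_nonneg[of t "p k t"] by (simp add: R_def kt)
  qed
  have \<psi>I: "\<psi> (\<lambda>x. u * l i x) = (R i * \<bar>u\<bar>) powr \<alpha>" if "i \<in> I" for i u
    using that link IS by (cases i) (auto simp: l_def R_def)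
  have Y: "lincomb S X (l (k, t)) \<omega> = X t \<omega> - X (p k t) \<omega>" if "(k, t) \<in> I" for k t \<omega>
    using IS[OF that] S(1) by (simp add: l_def lincomb_link_coeff)
  define W where "W \<omega> = (\<Prod>i\<in>I. bump (lincomb S X (l i) \<omega> / A i))" for \<omega>
  have W: "E.dominated W" unfolding W_def by (rule E.dominated_prod_bump[OF I])
  note [measurable] = E.dominated_measurable[OF W] and Wb = E.dominated_bounds[OF W]
  have Wi: "integrable M W"
    using Wb by (intro E.integrable_bounded) (auto simp: abs_le_iff intro: order_trans[of _ 0])
  define w where "w = (\<integral>\<omega>. W \<omega> \<partial>M)"
  have prod_le: "(\<Prod>k\<in>{1..m}. stable_bump \<alpha> (r k / a k) ^ card (H k)) \<le> w"
  proof -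
    have "(\<Prod>k\<in>{1..m}. stable_bump \<alpha> (r k / a k) ^ card (H k)) = (\<Prod>k\<in>{1..m}. \<Prod>t\<in>H k. stable_bump \<alpha> (r k / a k))"
      by simp
    also have "\<dots> = (\<Prod>i\<in>I. stable_bump \<alpha> (r (fst i) / a (fst i)))"
      unfolding I_def using H by (subst prod.Sigma) (auto simp: case_prod_beta)
    also have "\<dots> \<le> (\<Prod>i\<in>I. stable_bump \<alpha> (R i / A i))"
    proof (intro prod_mono conjI)
      fix i assume i: "i \<in> I"
      obtain k t where kt: "i = (k, t)" by (cases i)
      show "stable_bump \<alpha> (r (fst i) / a (fst i)) \<le> stable_bump \<alpha> (R i / A i)"
        using \<alpha> i Apos[OF i] Rnn[OF i] p(2)[of k t] unfolding kt
        by (intro stable_bump_antimono) (auto simp: R_def A_def I_def intro!: divide_right_mono)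
    qed (auto simp: stable_bump_def intro!: Bochner_Integration.integral_nonneg)
    also have "\<dots> \<le> w" unfolding w_def W_def
      by (rule E.expectation_prod_bump_ge[OF I Apos Rnn \<psi>I])
    finally show ?thesis .
  qed
  have w0: "0 \<le> w" unfolding w_def using Wb by (intro Bochner_Integration.integral_nonneg) auto
  \<comment> \<open>The total excess over the thresholds b k, with each level maximum replaced by a
    sum of \<gamma>-th powers.\<close>
  define Z where "Z \<omega> = (\<Sum>k\<in>J. b k powr (1 - \<gamma>) * (\<Sum>t\<in>H k. \<bar>lincomb S X (l (k, t)) \<omega>\<bar> powr \<gamma>))" for \<omega>
  have [measurable]: "Z \<in> borel_measurable M" unfolding Z_def by measurable
  have Z0: "0 \<le> Z \<omega>" for \<omega> unfolding Z_def by (intro sum_nonneg mult_nonneg_nonneg) auto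
  have JI: "(k, t) \<in> I" if "k \<in> J" "t \<in> H k" for k t using that J by (auto simp: I_def)
  have supp: "\<bar>lincomb S X (l i) \<omega>\<bar> \<le> 4 * A i" if "W \<omega> \<noteq> 0" "i \<in> I" for i \<omega>
    using E.prod_bump_nonzero_imp[OF I] that Apos unfolding W_def by blast
  have WYi: "integrable M (\<lambda>\<omega>. W \<omega> * \<bar>lincomb S X (l i) \<omega>\<bar> powr \<gamma>)" if "i \<in> I" for i
  proof (rule E.integrable_const_bound[where B = "(4 * A i) powr \<gamma>"])
    show "AE \<omega> in M. norm (W \<omega> * \<bar>lincomb S X (l i) \<omega>\<bar> powr \<gamma>) \<le> (4 * A i) powr \<gamma>"
    proof
      fix \<omega>
      show "norm (W \<omega> * \<bar>lincomb S X (l i) \<omega>\<bar> powr \<gamma>) \<le> (4 * A i) powr \<gamma>"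
      proof (cases "W \<omega> = 0")
        case False
        have "W \<omega> * \<bar>lincomb S X (l i) \<omega>\<bar> powr \<gamma> \<le> 1 * (4 * A i) powr \<gamma>"
          using supp[OF False that] Wb \<gamma> by (intro mult_mono powr_mono2) auto
        then show ?thesis using Wb by (simp add: abs_mult)
      qed simp
    qed
  qed measurable
  have EWZ: "(\<integral>\<omega>. W \<omega> * Z \<omega> \<partial>M) \<le> \<epsilon> / 8 * w" and WZi: "integrable M (\<lambda>\<omega>. W \<omega> * Z \<omega>)"
  proof -
    have eq: "W \<omega> * Z \<omega> = (\<Sum>k\<in>J. b k powr (1 - \<gamma>) * (\<Sum>t\<in>H k. W \<omega> * \<bar>lincomb S X (l (k, t)) \<omega>\<bar> powr \<gamma>))" for \<omega>
      by (simp add: Z_def sum_distrib_left mult_ac)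
    show "integrable M (\<lambda>\<omega>. W \<omega> * Z \<omega>)"
      unfolding eq by (intro Bochner_Integration.integrable_sum integrable_mult_right WYi JI)
    have inner: "(\<integral>\<omega>. (\<Sum>t\<in>H k. W \<omega> * \<bar>lincomb S X (l (k, t)) \<omega>\<bar> powr \<gamma>) \<partial>M) =
        (\<Sum>t\<in>H k. \<integral>\<omega>. W \<omega> * \<bar>lincomb S X (l (k, t)) \<omega>\<bar> powr \<gamma> \<partial>M)" if "k \<in> J" for k
      by (rule Bochner_Integration.integral_sum) (intro WYi JI that)
    have "(\<integral>\<omega>. W \<omega> * Z \<omega> \<partial>M) = (\<Sum>k\<in>J. b k powr (1 - \<gamma>) * (\<Sum>t\<in>H k. \<integral>\<omega>. W \<omega> * \<bar>lincomb S X (l (k, t)) \<omega>\<bar> powr \<gamma> \<partial>M))"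
      unfolding eq by (subst Bochner_Integration.integral_sum)
        (auto intro!: Bochner_Integration.integrable_sum WYi JI sum.cong simp: inner)
    also have "\<dots> \<le> (\<Sum>k\<in>J. b k powr (1 - \<gamma>) * (\<Sum>t\<in>H k. moment_const \<alpha> \<gamma> * r k powr \<alpha> * a k powr (\<gamma> - \<alpha>) * w))"
    proof (intro sum_mono mult_left_mono)
      fix k t assume kt: "k \<in> J" "t \<in> H k"
      note i = JI[OF kt]
      have "(\<integral>\<omega>. W \<omega> * \<bar>lincomb S X (l (k, t)) \<omega>\<bar> powr \<gamma> \<partial>M) \<le> moment_const \<alpha> \<gamma> * R (k, t) powr \<alpha> * A (k, t) powr (\<gamma> - \<alpha>) * w"
        unfolding w_def by (rule E.dominated_moment_le[OF W Apos[OF i] Rnn[OF i] \<alpha>(1) \<gamma>(1) \<psi>I[OF i] supp[OF _ i]])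
      also have "\<dots> \<le> moment_const \<alpha> \<gamma> * r k powr \<alpha> * A (k, t) powr (\<gamma> - \<alpha>) * w"
      proof (intro mult_right_mono mult_left_mono powr_mono2)
        show "R (k, t) \<le> r k" using p(2)[of k t] i by (simp add: R_def I_def)
        have "2 powr (\<alpha> - \<gamma>) < 2 powr 0" using \<gamma> by (intro powr_less_mono) auto
        then show "0 \<le> moment_const \<alpha> \<gamma>" by (simp add: moment_const_def)
      qed (use w0 \<alpha> Rnn[OF i] in auto)
      finally show "(\<integral>\<omega>. W \<omega> * \<bar>lincomb S X (l (k, t)) \<omega>\<bar> powr \<gamma> \<partial>M) \<le> moment_const \<alpha> \<gamma> * r k powr \<alpha> * a k powr (\<gamma> - \<alpha>) * w"
        by (simp add: A_def)
    qed auto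
    also have "\<dots> = (\<Sum>k\<in>J. b k powr (1 - \<gamma>) * (real (card (H k)) * (moment_const \<alpha> \<gamma> * r k powr \<alpha> * a k powr (\<gamma> - \<alpha>)))) * w"
      by (simp add: sum_distrib_right mult.assoc)
    also have "\<dots> \<le> \<epsilon> / 8 * w" using mom_le w0 by (intro mult_right_mono)
    finally show "(\<integral>\<omega>. W \<omega> * Z \<omega> \<partial>M) \<le> \<epsilon> / 8 * w" .
  qed
  define G where "G = {\<omega> \<in> space M. \<forall>s\<in>H m. \<forall>t\<in>H m. \<bar>X s \<omega> - X t \<omega>\<bar> \<le> \<epsilon>}"
  have G [measurable]: "G \<in> sets M"
  proof -
    have [measurable]: "X t \<in> borel_measurable M" if "t \<in> H m" for t using that HS X_meas by blast
    have "countable (H m)" using H by (simp add: countable_finite)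
    then show ?thesis unfolding G_def by measurable
  qed
  have good: "\<omega> \<in> G" if \<omega>: "\<omega> \<in> space M" "W \<omega> \<noteq> 0" "Z \<omega> \<le> \<epsilon> / 4" for \<omega>
  proof -
    define B where "B k = (if k \<in> J then b k + b k powr (1 - \<gamma>) * (\<Sum>t\<in>H k. \<bar>lincomb S X (l (k, t)) \<omega>\<bar> powr \<gamma>) else 4 * a k)" for k
    have step: "\<bar>X t \<omega> - X (p k t) \<omega>\<bar> \<le> B k" if kt: "(k, t) \<in> I" for k t
    proof (cases "k \<in> J")
      case False
      then show ?thesis using supp[OF \<omega>(2) kt] Y[OF kt] by (simp add: B_def A_def)
    next
      case True
      define y where "y = \<bar>X t \<omega> - X (p k t) \<omega>\<bar>"
      have bk: "0 < b k" using b True by simp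
      \<comment> \<open>Above the threshold y = y^(1-\<gamma>) y^\<gamma>, and the first factor
        decreases in y because \<gamma> \<ge> 1.\<close>
      have "y \<le> b k + b k powr (1 - \<gamma>) * y powr \<gamma>"
      proof (cases "y \<le> b k")
        case True
        then show ?thesis by (simp add: add_increasing2)
      next
        case False
        then have y: "y > 0" using bk by simp
        have "y = y powr (1 - \<gamma>) * y powr \<gamma>" using y by (simp flip: powr_add)
        also have "\<dots> \<le> b k powr (1 - \<gamma>) * y powr \<gamma>"
          using False bk \<gamma> by (intro mult_right_mono powr_mono2') auto
        finally show ?thesis using bk by linarith
      qed
      also have "y powr \<gamma> \<le> (\<Sum>t\<in>H k. \<bar>lincomb S X (l (k, t)) \<omega>\<bar> powr \<gamma>)"
      proof -
        have "y powr \<gamma> = \<bar>lincomb S X (l (k, t)) \<omega>\<bar> powr \<gamma>" by (simp add: y_def Y[OF kt])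
        also have "\<dots> \<le> (\<Sum>t\<in>H k. \<bar>lincomb S X (l (k, t)) \<omega>\<bar> powr \<gamma>)"
          using kt H by (intro member_le_sum) (auto simp: I_def)
        finally show ?thesis .
      qed
      finally show ?thesis using True by (simp add: B_def y_def mult_left_mono)
    qed
    have chain: "\<forall>t\<in>H k. \<bar>X t \<omega> - X t0 \<omega>\<bar> \<le> (\<Sum>i\<in>{1..k}. B i)" if "k \<le> m" for k
      using that
    proof (induction k)
      case 0
      then show ?case using H by simp
    next
      case (Suc k)
      show ?case
      proof
        fix t assume t: "t \<in> H (Suc k)"
        have kt: "(Suc k, t) \<in> I" using t Suc by (simp add: I_def)
        have "p (Suc k) t \<in> H k" using p(1)[of "Suc k" t] t Suc by simp
        then have "\<bar>X (p (Suc k) t) \<omega> - X t0 \<omega>\<bar> \<le> (\<Sum>i\<in>{1..k}. B i)" using Suc by simp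
        then show "\<bar>X t \<omega> - X t0 \<omega>\<bar> \<le> (\<Sum>i\<in>{1..Suc k}. B i)" using step[OF kt] by simp
      qed
    qed
    have "(\<Sum>i\<in>{1..m}. B i) = (\<Sum>i\<in>{1..m} - J. B i) + (\<Sum>i\<in>J. B i)"
      using J by (intro sum.subset_diff) auto
    also have "(\<Sum>i\<in>{1..m} - J. B i) = (\<Sum>i\<in>{1..m} - J. 4 * a i)"
      by (intro sum.cong) (auto simp: B_def)
    also have "(\<Sum>i\<in>J. B i) = (\<Sum>i\<in>J. b i) + Z \<omega>"
      by (simp add: B_def Z_def sum.distrib)
    finally have "(\<Sum>i\<in>{1..m}. B i) \<le> \<epsilon> / 2" using sum_le \<omega>(3) by linarith
    then have *: "\<bar>X t \<omega> - X t0 \<omega>\<bar> \<le> \<epsilon> / 2" if "t \<in> H m" for t using chain[of m] that by fastforce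
    have "\<bar>X s \<omega> - X t \<omega>\<bar> \<le> \<epsilon>" if "s \<in> H m" "t \<in> H m" for s t
      using *[OF that(1)] *[OF that(2)] by linarith
    then show ?thesis using \<omega> by (simp add: G_def)
  qed
  \<comment> \<open>Markov's inequality without normalising the tilt: W (1 - 4 Z / \<epsilon>) is at
    most the indicator of \<open>G\<close>, being nonpositive off \<open>G\<close> and at most 1 on
    it.\<close>
  have "w - 4 / \<epsilon> * (\<integral>\<omega>. W \<omega> * Z \<omega> \<partial>M) = (\<integral>\<omega>. W \<omega> - 4 / \<epsilon> * (W \<omega> * Z \<omega>) \<partial>M)"
    unfolding w_def using Wb WZi
    by (subst Bochner_Integration.integral_diff) (auto simp: Wi)
  also have "\<dots> \<le> (\<integral>\<omega>. indicator G \<omega> \<partial>M)"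
  proof (rule integral_mono)
    show "integrable M (\<lambda>\<omega>. W \<omega> - 4 / \<epsilon> * (W \<omega> * Z \<omega>))"
      using WZi by (intro Bochner_Integration.integrable_diff integrable_mult_right Wi)
    show "integrable M (indicator G :: 'a \<Rightarrow> real)" by (intro E.integrable_bounded) (auto simp: indicator_def)
    fix \<omega> assume "\<omega> \<in> space M"
    show "W \<omega> - 4 / \<epsilon> * (W \<omega> * Z \<omega>) \<le> indicator G \<omega>"
    proof (cases "\<omega> \<in> G")
      case True
      have "0 \<le> 4 / \<epsilon> * (W \<omega> * Z \<omega>)" using Wb Z0 \<open>0 < \<epsilon>\<close> by simp
      then show ?thesis using True Wb(2)[of \<omega>] by simp
    next
      case False
      have "W \<omega> * 1 \<le> W \<omega> * (4 / \<epsilon> * Z \<omega>)"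
      proof (cases "W \<omega> = 0")
        case W0: False
        then have "Z \<omega> > \<epsilon> / 4" using False good \<open>\<omega> \<in> space M\<close> by fastforce
        then show ?thesis using Wb \<open>0 < \<epsilon>\<close> by (intro mult_left_mono) (auto simp: field_simps)
      qed simp
      then show ?thesis using False by (simp add: mult_ac)
    qed
  qed
  also have "\<dots> = measure M G" by simp
  finally have "w - 4 / \<epsilon> * (\<epsilon> / 8 * w) \<le> measure M G"
    using EWZ \<open>0 < \<epsilon>\<close> mult_left_mono[OF EWZ, of "4 / \<epsilon>"] by simp
  then show ?thesis using prod_le \<open>0 < \<epsilon>\<close> by (simp add: G_def)
qed

subsection \<open>Power sums\<close>

lemma powr_MVT:
  fixes e :: real
  assumes "1 \<le> (n :: nat)"
  obtains z where "real n < z" "z < real (Suc n)"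
    "real (Suc n) powr e - real n powr e = e * z powr (e - 1)"
proof -
  have "\<exists>z. real n < z \<and> z < real (Suc n) \<and>
      real (Suc n) powr e - real n powr e = (real (Suc n) - real n) * (e * z powr (e - 1))"
    using assms by (intro MVT2 has_real_derivative_powr) auto
  then show thesis using that by auto
qed

lemma powr_diff_lower:
  fixes s :: real
  assumes "1 < s" "1 \<le> (n :: nat)"
  shows "(s - 1) * real (Suc n) powr - s \<le> real n powr (1 - s) - real (Suc n) powr (1 - s)"
proof -
  obtain z where z: "real n < z" "z < real (Suc n)"
    "real (Suc n) powr (1 - s) - real n powr (1 - s) = (1 - s) * z powr (1 - s - 1)"
    using powr_MVT[OF assms(2)] .
  have "(s - 1) * real (Suc n) powr - s \<le> (s - 1) * z powr - s"
    using z assms by (intro mult_left_mono powr_mono2') auto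
  then show ?thesis using z by (simp add: algebra_simps)
qed

text \<open>The terms after the first telescope against N^(1-s)/(s-1). The first term is at most
  N^(1-s), whence the constant 1 + 1/(s-1).\<close>

lemma sum_powr_tail_le:
  fixes s :: real
  assumes "1 < s" "1 \<le> N"
  shows "(\<Sum>n\<in>{N..M}. real n powr - s) \<le> s / (s - 1) * real N powr (1 - s)"
proof (cases "N \<le> M")
  case True
  have "(\<Sum>n\<in>{N..M}. real n powr - s) \<le> real N powr - s + (real N powr (1 - s) - real M powr (1 - s)) / (s - 1)"
    using True
  proof (induction M rule: dec_induct)
    case (step n)
    have "real (Suc n) powr - s \<le> (real n powr (1 - s) - real (Suc n) powr (1 - s)) / (s - 1)"
      using powr_diff_lower[OF assms(1), of n] step assms by (simp add: field_simps)
    moreover have "{N..Suc n} = insert (Suc n) {N..n}" using step by auto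
    ultimately show ?case using step by (simp add: diff_divide_distrib)
  qed simp
  also have "\<dots> \<le> real N powr (1 - s) + real N powr (1 - s) / (s - 1)"
    using assms by (intro add_mono divide_right_mono powr_mono) auto
  also have "\<dots> = s / (s - 1) * real N powr (1 - s)"
    using assms by (simp add: field_simps)
  finally show ?thesis .
qed (use assms in auto)

lemma sum_powr_head_le:
  fixes q :: real
  assumes "0 < q" "q < 1"
  shows "(\<Sum>n\<in>{1..N}. real n powr - q) \<le> real N powr (1 - q) / (1 - q)"
proof (induction N)
  case (Suc n)
  have "real (Suc n) powr - q \<le> (real (Suc n) powr (1 - q) - real n powr (1 - q)) / (1 - q)"
  proof (cases "n = 0")
    case False
    obtain z where z: "real n < z" "z < real (Suc n)"
      "real (Suc n) powr (1 - q) - real n powr (1 - q) = (1 - q) * z powr (1 - q - 1)"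
      using powr_MVT[of n "1 - q"] False by auto
    have "(1 - q) * real (Suc n) powr - q \<le> (1 - q) * z powr - q"
      using z assms by (intro mult_left_mono powr_mono2') auto
    then show ?thesis using z assms by (simp add: field_simps)
  qed (use assms in \<open>simp add: field_simps\<close>)
  then show ?case using Suc by (simp add: diff_divide_distrib)
qed simp

lemma sum_inverse_le_ln:
  assumes "1 \<le> N"
  shows "(\<Sum>n\<in>{1..N}. real n powr - 1) \<le> 1 + ln (real N)"
  using assms
proof (induction N rule: dec_induct)
  case (step n)
  have n: "real n > 0" using step by simp
  have "ln (real n / real (Suc n)) \<le> real n / real (Suc n) - 1"
    using n by (intro ln_le_minus_one) auto
  then have "1 / real (Suc n) \<le> ln (real (Suc n)) - ln (real n)"
    using n by (simp add: ln_div field_simps)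
  then show ?case using step n by (simp add: powr_minus_divide)
qed simp

subsection \<open>Small balls along geometric nets\<close>

text \<open>Both sums are governed by Q = \<epsilon>^(-\<alpha>) N^(\<alpha>-\<beta>): they are at
  most constants times \<epsilon> Q^(1/\<gamma>) and N Q. The lower bound on N says exactly that Q
  \<le> \<Lambda>^(-(\<beta>-\<alpha>)), which a large \<Lambda> makes small independently of
  \<epsilon>.\<close>

lemma tail_level_sums:
  fixes \<alpha> \<beta> \<gamma> \<eta> :: real
  assumes "0 < \<alpha>" "\<alpha> < \<gamma>" "1 < \<gamma>" "\<gamma> < \<beta>" "0 < \<eta>"
  obtains \<Lambda> where "1 \<le> \<Lambda>"
    "\<And>\<epsilon> N M. 0 < \<epsilon> \<Longrightarrow> 1 \<le> N \<Longrightarrow> \<Lambda> * \<epsilon> powr (- (\<alpha> / (\<beta> - \<alpha>))) \<le> real N \<Longrightarrow>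
        (\<Sum>n\<in>{N..M}. (\<epsilon> / real N) powr (1 - \<alpha> / \<gamma>) * real n powr - (\<beta> / \<gamma>)) \<le> \<eta> * \<epsilon>"
    "\<And>\<epsilon> N M. 0 < \<epsilon> \<Longrightarrow> 1 \<le> N \<Longrightarrow> \<Lambda> * \<epsilon> powr (- (\<alpha> / (\<beta> - \<alpha>))) \<le> real N \<Longrightarrow>
        (\<Sum>n\<in>{N..M}. real n powr - \<beta> * (\<epsilon> / real N) powr - \<alpha>) \<le> \<beta> / (\<beta> - 1) * real N"
proof -
  define c where "c = (\<beta> / \<gamma>) / (\<beta> / \<gamma> - 1)"
  have s: "1 < \<beta> / \<gamma>" using assms by (simp add: field_simps)
  have c: "0 < c" unfolding c_def using s assms by (intro divide_pos_pos) linarith+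
  \<comment> \<open>The second entry solves c \<Lambda>^(-(\<beta>-\<alpha>)/\<gamma>) = \<eta>; the
    entry 1 ensures Q \<le> 1 for the second sum.\<close>
  define \<Lambda> where "\<Lambda> = max 1 ((c / \<eta>) powr (\<gamma> / (\<beta> - \<alpha>)))"
  have \<Lambda>: "1 \<le> \<Lambda>" by (simp add: \<Lambda>_def)
  have Q: "\<epsilon> powr - \<alpha> * real N powr (\<alpha> - \<beta>) \<le> \<Lambda> powr - (\<beta> - \<alpha>)"
    if "0 < \<epsilon>" "1 \<le> N" "\<Lambda> * \<epsilon> powr (- (\<alpha> / (\<beta> - \<alpha>))) \<le> real N" for \<epsilon> N
  proof -
    have "real N powr (\<alpha> - \<beta>) \<le> (\<Lambda> * \<epsilon> powr (- (\<alpha> / (\<beta> - \<alpha>)))) powr (\<alpha> - \<beta>)"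
      using that \<Lambda> assms by (intro powr_mono2') auto
    also have "\<dots> = \<Lambda> powr - (\<beta> - \<alpha>) * \<epsilon> powr \<alpha>"
    proof -
      have "- (\<alpha> / (\<beta> - \<alpha>)) * (\<alpha> - \<beta>) = \<alpha>" using assms by (simp add: field_simps)
      then show ?thesis using \<Lambda> that by (simp add: powr_mult powr_powr)
    qed
    finally have "\<epsilon> powr - \<alpha> * real N powr (\<alpha> - \<beta>) \<le> \<epsilon> powr - \<alpha> * (\<Lambda> powr - (\<beta> - \<alpha>) * \<epsilon> powr \<alpha>)"
      by (intro mult_left_mono) auto
    also have "\<dots> = \<Lambda> powr - (\<beta> - \<alpha>)" using that by (simp add: powr_minus field_simps)
    finally show ?thesis .
  qed
  show thesis
  proof (rule that[OF \<Lambda>])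
    fix \<epsilon> :: real and N M :: nat
    assume *: "0 < \<epsilon>" "1 \<le> N" "\<Lambda> * \<epsilon> powr (- (\<alpha> / (\<beta> - \<alpha>))) \<le> real N"
    have N: "0 < real N" using * by simp
    have "(\<Sum>n\<in>{N..M}. (\<epsilon> / real N) powr (1 - \<alpha> / \<gamma>) * real n powr - (\<beta> / \<gamma>))
        \<le> (\<epsilon> / real N) powr (1 - \<alpha> / \<gamma>) * (c * real N powr (1 - \<beta> / \<gamma>))"
      unfolding sum_distrib_left[symmetric] c_def using s * by (intro mult_left_mono sum_powr_tail_le) auto
    also have "\<dots> = c * \<epsilon> * (\<epsilon> powr - \<alpha> * real N powr (\<alpha> - \<beta>)) powr (1 / \<gamma>)"
    proof -
      have "(\<epsilon> powr - \<alpha> * real N powr (\<alpha> - \<beta>)) powr (1 / \<gamma>) = \<epsilon> powr - (\<alpha> / \<gamma>) * real N powr ((\<alpha> - \<beta>) / \<gamma>)"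
        using * N by (simp add: powr_mult powr_powr)
      moreover have "(\<epsilon> / real N) powr (1 - \<alpha> / \<gamma>) = \<epsilon> * \<epsilon> powr - (\<alpha> / \<gamma>) * real N powr (\<alpha> / \<gamma> - 1)"
      proof -
        have "\<epsilon> powr (1 - \<alpha> / \<gamma>) = \<epsilon> powr (1 + - (\<alpha> / \<gamma>))" by simp
        also have "\<dots> = \<epsilon> * \<epsilon> powr - (\<alpha> / \<gamma>)" unfolding powr_add using * by simp
        moreover have "real N powr (\<alpha> / \<gamma> - 1) = 1 / real N powr (1 - \<alpha> / \<gamma>)"
          by (simp flip: powr_minus_divide)
        ultimately show ?thesis using * N by (simp add: powr_divide)
      qed
      moreover have "real N powr (\<alpha> / \<gamma> - 1) * real N powr (1 - \<beta> / \<gamma>) = real N powr ((\<alpha> - \<beta>) / \<gamma>)"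
        by (simp add: diff_divide_distrib flip: powr_add)
      ultimately show ?thesis by (simp add: mult_ac)
    qed
    also have "\<dots> \<le> c * \<epsilon> * (\<Lambda> powr - (\<beta> - \<alpha>)) powr (1 / \<gamma>)"
      using Q[OF *] * c assms by (intro mult_left_mono powr_mono2) auto
    also have "(\<Lambda> powr - (\<beta> - \<alpha>)) powr (1 / \<gamma>) \<le> \<eta> / c"
    proof -
      have "(\<Lambda> powr - (\<beta> - \<alpha>)) powr (1 / \<gamma>) = \<Lambda> powr - ((\<beta> - \<alpha>) / \<gamma>)" by (simp add: powr_powr diff_divide_distrib)
      also have "\<dots> \<le> ((c / \<eta>) powr (\<gamma> / (\<beta> - \<alpha>))) powr - ((\<beta> - \<alpha>) / \<gamma>)"
        using c assms by (intro powr_mono2') (auto simp: \<Lambda>_def)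
      also have "\<dots> = (c / \<eta>) powr - 1"
      proof -
        have "\<gamma> / (\<beta> - \<alpha>) * - ((\<beta> - \<alpha>) / \<gamma>) = - 1" using assms by (simp add: field_simps)
        then show ?thesis by (simp only: powr_powr)
      qed
      also have "\<dots> = \<eta> / c" using c assms by (simp add: powr_minus_divide)
      finally show ?thesis .
    qed
    finally show "(\<Sum>n\<in>{N..M}. (\<epsilon> / real N) powr (1 - \<alpha> / \<gamma>) * real n powr - (\<beta> / \<gamma>)) \<le> \<eta> * \<epsilon>"
      using * c by (simp add: field_simps)
  next
    fix \<epsilon> :: real and N M :: nat
    assume *: "0 < \<epsilon>" "1 \<le> N" "\<Lambda> * \<epsilon> powr (- (\<alpha> / (\<beta> - \<alpha>))) \<le> real N"
    have N: "0 < real N" using * by simp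
    have b: "1 < \<beta>" using assms by simp
    have "(\<Sum>n\<in>{N..M}. real n powr - \<beta> * (\<epsilon> / real N) powr - \<alpha>) \<le> \<beta> / (\<beta> - 1) * real N powr (1 - \<beta>) * (\<epsilon> / real N) powr - \<alpha>"
      unfolding sum_distrib_right[symmetric] using b * by (intro mult_right_mono sum_powr_tail_le) auto
    also have "\<dots> = \<beta> / (\<beta> - 1) * real N * (\<epsilon> powr - \<alpha> * real N powr (\<alpha> - \<beta>))"
    proof -
      have "real N powr (1 - \<beta>) * (\<epsilon> / real N) powr - \<alpha> = \<epsilon> powr - \<alpha> * (real N powr (1 - \<beta>) * real N powr \<alpha>)"
        using * N by (simp add: powr_divide powr_minus field_simps)
      also have "real N powr (1 - \<beta>) * real N powr \<alpha> = real N powr (1 + (\<alpha> - \<beta>))"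
        by (simp add: algebra_simps flip: powr_add)
      also have "\<dots> = real N * real N powr (\<alpha> - \<beta>)" unfolding powr_add using N by simp
      finally show ?thesis by (simp add: mult_ac)
    qed
    also have "\<dots> \<le> \<beta> / (\<beta> - 1) * real N * 1"
    proof (intro mult_left_mono)
      have "\<Lambda> powr - (\<beta> - \<alpha>) \<le> 1" using \<Lambda> assms powr_mono[of "- (\<beta> - \<alpha>)" 0 \<Lambda>] by simp
      then show "\<epsilon> powr - \<alpha> * real N powr (\<alpha> - \<beta>) \<le> 1" using Q[OF *] by simp
    qed (use b in auto)
    finally show "(\<Sum>n\<in>{N..M}. real n powr - \<beta> * (\<epsilon> / real N) powr - \<alpha>) \<le> \<beta> / (\<beta> - 1) * real N" by simp
  qed
qed

text \<open>n0 is the first net level used, n1 the level where deterministic caps give way to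
  averaging, and s bounds the sum that fixes the intermediate caps. The cost has one term for each
  of these three ranges; it does not depend on F, which is merely attached as a last level.\<close>

lemma net_small_ball:
  fixes X :: "'i \<Rightarrow> 'a \<Rightarrow> real" and G :: "nat \<Rightarrow> 'i set"
  assumes "prob_space M" and \<alpha>: "0 < \<alpha>" "\<alpha> \<le> 2" and sas: "sas_process M \<alpha> T X"
    and rho_nonneg: "\<And>s t. s \<in> T \<Longrightarrow> t \<in> T \<Longrightarrow> 0 \<le> \<rho> s t"
    and rho_scale: "\<And>s t u. s \<in> T \<Longrightarrow> t \<in> T \<Longrightarrow>
          (CLINT \<omega>|M. cis (u * (X t \<omega> - X s \<omega>)))
            = complex_of_real (exp (- (\<rho> t s powr \<alpha>) * \<bar>u\<bar> powr \<alpha>))"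
    and \<beta>: "max 1 \<alpha> < \<beta>" and t0: "t0 \<in> T" and \<sigma>: "1 \<le> \<sigma>" "\<And>t. t \<in> T \<Longrightarrow> \<rho> t t0 \<le> \<sigma>"
    and C: "0 < C"
    and G: "\<And>n. 1 \<le> n \<Longrightarrow> finite (G n)" "\<And>n. 1 \<le> n \<Longrightarrow> G n \<subseteq> T"
      "\<And>n t. 1 \<le> n \<Longrightarrow> t \<in> T \<Longrightarrow> \<exists>s\<in>G n. \<rho> t s \<le> 2 powr - real n"
      "\<And>n. 1 \<le> n \<Longrightarrow> real (card (G n)) \<le> C * 2 powr (real n * \<alpha>) * real n powr - \<beta>"
  obtains K \<Lambda> where "0 < K" "1 \<le> \<Lambda>"
    "\<And>\<epsilon> n0 n1 s F. 0 < \<epsilon> \<Longrightarrow> \<epsilon> \<le> 1 \<Longrightarrow> 1 \<le> n0 \<Longrightarrow> 1 \<le> n1 \<Longrightarrow>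
       \<Lambda> * \<epsilon> powr (- (\<alpha> / (\<beta> - \<alpha>))) \<le> real n1 \<Longrightarrow> 0 < s \<Longrightarrow>
       (\<Sum>n\<in>{n0<..<n1}. real n powr - (\<beta> / (1 + \<alpha>))) \<le> s \<Longrightarrow> finite F \<Longrightarrow> F \<subseteq> T \<Longrightarrow>
       exp (- K * (1 + 2 powr (real n0 * \<alpha>) * real n0 powr - \<beta> * (1 - ln \<epsilon>)
              + \<epsilon> powr - \<alpha> * s powr (1 + \<alpha>) + real n1))
         \<le> measure M {\<omega> \<in> space M. \<forall>s\<in>F. \<forall>t\<in>F. \<bar>X s \<omega> - X t \<omega>\<bar> \<le> \<epsilon>}"
proof -
  define \<gamma> where "\<gamma> = (max 1 \<alpha> + \<beta>) / 2"
  define q where "q = \<beta> / (1 + \<alpha>)"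
  define A where "A = sinc4_moment \<alpha>"
  define D where "D = C * A * 2 powr \<alpha>"
  define E where "E = moment_const \<alpha> \<gamma> * C * 2 powr \<alpha>"
  define c0 where "c0 = exp (- 1) * (2 * (cos 1) ^ 4 / sinc4_mass)"
  \<comment> \<open>Chosen so that exp(ln \<epsilon> - A1) is below the polynomial bound c0
    \<epsilon> / (64 \<sigma>) for a first link.\<close>
  define A1 where "A1 = max 1 (ln (64 * \<sigma> / c0))"
  \<comment> \<open>The budget \<epsilon>/4 is spent in four sixteenths: first link, last link,
    intermediate levels, thresholds b. The entry 1/(8 E) keeps the mean excess within
    \<epsilon>/8.\<close>
  define \<eta> where "\<eta> = min (1 / 16) (1 / (8 * E))"
  have \<gamma>: "\<alpha> < \<gamma>" "1 < \<gamma>" "\<gamma> < \<beta>" using \<beta> by (auto simp: \<gamma>_def max_def split: if_splits)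
  have "2 powr (\<alpha> - \<gamma>) < 2 powr 0" using \<gamma> by (intro powr_less_mono) auto
  then have mc: "0 < moment_const \<alpha> \<gamma>" by (simp add: moment_const_def)
  then have E: "0 < E" using C by (simp add: E_def)
  have A: "0 \<le> A" unfolding A_def sinc4_moment_def by (intro Bochner_Integration.integral_nonneg) auto
  have D: "0 \<le> D" using A C by (simp add: D_def)
  have c0: "0 < c0" using sinc4_mass_pos cos_one_pos by (simp add: c0_def)
  have \<eta>: "0 < \<eta>" using E by (simp add: \<eta>_def)
  obtain \<Lambda> where \<Lambda>: "1 \<le> \<Lambda>"
    "\<And>\<epsilon> N M. 0 < \<epsilon> \<Longrightarrow> 1 \<le> N \<Longrightarrow> \<Lambda> * \<epsilon> powr (- (\<alpha> / (\<beta> - \<alpha>))) \<le> real N \<Longrightarrow>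
        (\<Sum>n\<in>{N..M}. (\<epsilon> / real N) powr (1 - \<alpha> / \<gamma>) * real n powr - (\<beta> / \<gamma>)) \<le> \<eta> * \<epsilon>"
    "\<And>\<epsilon> N M. 0 < \<epsilon> \<Longrightarrow> 1 \<le> N \<Longrightarrow> \<Lambda> * \<epsilon> powr (- (\<alpha> / (\<beta> - \<alpha>))) \<le> real N \<Longrightarrow>
        (\<Sum>n\<in>{N..M}. real n powr - \<beta> * (\<epsilon> / real N) powr - \<alpha>) \<le> \<beta> / (\<beta> - 1) * real N"
    using tail_level_sums[OF \<alpha>(1) \<gamma> \<eta>] by blast
  \<comment> \<open>ln 2 absorbs the factor 1/2 of \<open>chain_small_ball\<close>, 1 the level of
    F, and the other terms the three cost estimates.\<close>
  define K where "K = ln 2 + 1 + C * A1 + D * 64 powr \<alpha> + D * (\<beta> / (\<beta> - 1))"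
  have A1: "1 \<le> A1" by (simp add: A1_def)
  have "0 < C * A1" using C A1 by simp
  moreover have "0 \<le> D * 64 powr \<alpha>" "0 \<le> D * (\<beta> / (\<beta> - 1))" using D \<beta> by auto
  moreover have "0 < ln (2 :: real)" by simp
  ultimately have K: "0 < K" "ln 2 + 1 \<le> K" "C * A1 \<le> K" "D * 64 powr \<alpha> \<le> K" "D * (\<beta> / (\<beta> - 1)) \<le> K"
    unfolding K_def by linarith+
  have Ksum: "ln 2 + (C * A1 * y1 + 1 + D * 64 powr \<alpha> * y2 + D * (\<beta> / (\<beta> - 1)) * y3) \<le> K * (1 + y1 + y2 + y3)"
    if "0 \<le> y1" "0 \<le> y2" "0 \<le> y3" for y1 y2 y3
  proof -
    have "C * A1 * y1 \<le> K * y1" "D * 64 powr \<alpha> * y2 \<le> K * y2" "D * (\<beta> / (\<beta> - 1)) * y3 \<le> K * y3"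
      by (rule mult_right_mono[OF K(3) that(1)] mult_right_mono[OF K(4) that(2)] mult_right_mono[OF K(5) that(3)])+
    then show ?thesis using K(2) unfolding distrib_left by linarith
  qed
  show thesis
  proof (rule that[OF K(1) \<Lambda>(1)])
    fix \<epsilon> :: real and n0 n1 :: nat and s :: real and F
    assume \<epsilon>: "0 < \<epsilon>" "\<epsilon> \<le> 1" and n: "1 \<le> n0" "1 \<le> n1" "\<Lambda> * \<epsilon> powr (- (\<alpha> / (\<beta> - \<alpha>))) \<le> real n1"
      and s: "0 < s" "(\<Sum>n\<in>{n0<..<n1}. real n powr - (\<beta> / (1 + \<alpha>))) \<le> s" and F: "finite F" "F \<subseteq> T"
    \<comment> \<open>The last net is so fine that all links into F together cost at most 1. The
      depth depends on F, but the sums over levels are bounded uniformly in the depth.\<close>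
    obtain n2 where n2: "n0 \<le> n2" "real (card F) * A * (64 / \<epsilon>) powr \<alpha> * (2 powr - \<alpha>) ^ n2 \<le> 1"
    proof -
      have "2 powr - \<alpha> < 2 powr 0" using \<alpha> by (intro powr_less_mono) auto
      then have "(\<lambda>n. real (card F) * A * (64 / \<epsilon>) powr \<alpha> * (2 powr - \<alpha>) ^ n) \<longlonglongrightarrow> real (card F) * A * (64 / \<epsilon>) powr \<alpha> * 0"
        by (intro tendsto_mult_left LIMSEQ_power_zero) auto
      then have "eventually (\<lambda>n. real (card F) * A * (64 / \<epsilon>) powr \<alpha> * (2 powr - \<alpha>) ^ n < 1) sequentially"
        by (rule order_tendstoD) simp
      then have "eventually (\<lambda>n. n0 \<le> n \<and> real (card F) * A * (64 / \<epsilon>) powr \<alpha> * (2 powr - \<alpha>) ^ n < 1) sequentially"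
        using eventually_ge_at_top[of n0] by eventually_elim auto
      then show thesis using that by (auto dest!: eventually_happens simp: less_imp_le)
    qed
    \<comment> \<open>With this m, level m - 1 is the net of mesh 2^(-n2) and level m is F; level 0
      is the root and level 1 the net of mesh 2^(-n0).\<close>
    define m where "m = n2 - n0 + 2"
    define lev where "lev k = n0 + k - 1" for k
    define H where "H k = (if k = 0 then {t0} else if k = m then F else G (lev k))" for k
    \<comment> \<open>A link is as long as the mesh of the parent's net, hence the exponent 1 -
      \<open>lev k\<close>. The first link comes from t0 and may be as long as \<sigma>.\<close>
    define r where "r k = (if k = 1 then \<sigma> else 2 powr (1 - real (lev k)))" for k :: nat
    \<comment> \<open>From n1 on the cap needs no summable decay, since these levels enter the sum
      only through b.\<close>
    define a where "a k = (if k = 1 \<or> k = m then \<epsilon> / 64 else if lev k < n1 then \<epsilon> * real (lev k) powr - q / (64 * s)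
        else \<epsilon> / real n1)" for k
    \<comment> \<open>Solves b^\<gamma> = n^(-\<beta>) (\<epsilon>/n1)^(\<gamma>-\<alpha>), so that
      the threshold and the mean excess bound of a level have the same order.\<close>
    define b where "b k = (\<epsilon> / real n1) powr (1 - \<alpha> / \<gamma>) * real (lev k) powr - (\<beta> / \<gamma>)" for k
    define J where "J = {k \<in> {2..<m}. n1 \<le> lev k}"
    define I where "I = {k \<in> {2..<m}. lev k < n1}"
    define p where "p k t = (SOME s. s \<in> H (k - 1) \<and> \<rho> t s \<le> r k)" for k t
    have m2: "2 \<le> m" by (simp add: m_def)
    have levge: "1 \<le> lev k" if "1 \<le> k" for k using that n by (simp add: lev_def)
    have H1: "finite (H k)" "H k \<subseteq> T" for k
      using F G levge[of k] t0 by (auto simp: H_def)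
    have parent: "\<exists>s. s \<in> H (k - 1) \<and> \<rho> t s \<le> r k" if "k \<in> {1..m}" "t \<in> H k" for k t
    proof (cases "k = 1")
      case True
      have "t \<in> T" using that H1(2)[of k] by blast
      then show ?thesis using True \<sigma>(2) by (auto simp: H_def r_def)
    next
      case False
      then have "1 \<le> k - 1" "k - 1 \<noteq> m" "k - 1 \<noteq> 0" using that by auto
      moreover have "\<exists>s\<in>G (lev (k - 1)). \<rho> t s \<le> 2 powr - real (lev (k - 1))"
        using that H1 levge[of "k - 1"] calculation by (intro G(3)) auto
      moreover have "- real (lev (k - 1)) = 1 - real (lev k)" using False that n by (simp add: lev_def of_nat_diff)
      ultimately show ?thesis using False by (auto simp: H_def r_def)
    qed
    then have p: "p k t \<in> H (k - 1)" "\<rho> t (p k t) \<le> r k" if "k \<in> {1..m}" "t \<in> H k" for k t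
      using someI_ex[OF parent[OF that]] by (auto simp: p_def)
    have apos: "0 < a k" if "k \<in> {1..m}" for k
      using that \<epsilon> s n levge[of k] by (auto simp: a_def)
    have bpos: "0 < b k" if "k \<in> J" for k
      using that \<epsilon> n levge[of k] by (auto simp: b_def J_def)
    have inj: "inj_on lev A" if "A \<subseteq> {1..}" for A
    proof (rule inj_onI)
      fix x y assume xy: "x \<in> A" "y \<in> A" "lev x = lev y"
      then have "1 \<le> x" "1 \<le> y" using that by auto
      then show "x = y" using xy(3) unfolding lev_def by linarith
    qed
    have injIJ: "inj_on lev I" "inj_on lev J" by (rule inj; force simp: I_def J_def)+
    have sumI: "(\<Sum>k\<in>I. f (lev k)) \<le> (\<Sum>n\<in>{n0<..<n1}. f n)" if "\<And>n. 0 \<le> f n" for f :: "nat \<Rightarrow> real"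
    proof -
      have "(\<Sum>k\<in>I. f (lev k)) = (\<Sum>n\<in>lev ` I. f n)" using sum.reindex[OF injIJ(1), of f] by simp
      also have "\<dots> \<le> (\<Sum>n\<in>{n0<..<n1}. f n)" using that by (intro sum_mono2) (auto simp: I_def lev_def)
      finally show ?thesis .
    qed
    have sumJ: "(\<Sum>k\<in>J. f (lev k)) \<le> (\<Sum>n\<in>{n1..n2}. f n)" if "\<And>n. 0 \<le> f n" for f :: "nat \<Rightarrow> real"
    proof -
      have "(\<Sum>k\<in>J. f (lev k)) = (\<Sum>n\<in>lev ` J. f n)" using sum.reindex[OF injIJ(2), of f] by simp
      also have "\<dots> \<le> (\<Sum>n\<in>{n1..n2}. f n)" using that n2 by (intro sum_mono2) (auto simp: J_def lev_def m_def)
      finally show ?thesis .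
    qed
    have dec: "{1..m} = insert 1 (insert m (I \<union> J))" "1 \<noteq> m" "1 \<notin> I \<union> J" "m \<notin> I \<union> J" "I \<inter> J = {}" "finite I" "finite J"
      using m2 by (auto simp: I_def J_def)
    have sum_dec: "(\<Sum>k\<in>{1..m}. f k) = f 1 + (f m + ((\<Sum>k\<in>I. f k) + (\<Sum>k\<in>J. f k)))" for f :: "nat \<Rightarrow> real"
      using dec by (simp add: sum.union_disjoint)
    have sum_b: "(\<Sum>k\<in>J. b k) \<le> \<eta> * \<epsilon>"
      unfolding b_def using sumJ[of "\<lambda>n. (\<epsilon> / real n1) powr (1 - \<alpha> / \<gamma>) * real n powr - (\<beta> / \<gamma>)"] \<Lambda>(2)[OF \<epsilon>(1) n(2,3), of n2] by fastforce
    have sum_le: "(\<Sum>k\<in>{1..m} - J. 4 * a k) + (\<Sum>k\<in>J. b k) \<le> \<epsilon> / 4"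
    proof -
      have "{1..m} - J = insert 1 (insert m I)" using dec by auto
      then have "(\<Sum>k\<in>{1..m} - J. 4 * a k) = 4 * a 1 + 4 * a m + (\<Sum>k\<in>I. 4 * a k)"
        using dec by simp
      moreover have "(\<Sum>k\<in>I. 4 * a k) = \<epsilon> / (16 * s) * (\<Sum>k\<in>I. real (lev k) powr - q)"
        unfolding sum_distrib_left by (intro sum.cong) (auto simp: I_def a_def)
      moreover have "\<epsilon> / (16 * s) * (\<Sum>k\<in>I. real (lev k) powr - q) \<le> \<epsilon> / (16 * s) * s"
        using sumI[of "\<lambda>n. real n powr - q"] s \<epsilon> by (intro mult_left_mono) (auto simp: q_def)
      moreover have "\<eta> * \<epsilon> \<le> 1 / 16 * \<epsilon>" using \<epsilon> by (intro mult_right_mono) (auto simp: \<eta>_def)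
      ultimately show ?thesis using sum_b s by (simp add: a_def)
    qed
    \<comment> \<open>The powers of 2 cancel: at each scale the number of links times their scale to
      the \<alpha> is of order n^(-\<beta>).\<close>
    have card_r: "real (card (H k)) * r k powr \<alpha> \<le> C * 2 powr \<alpha> * real (lev k) powr - \<beta>" if "k \<in> I \<union> J" for k
    proof -
      have k: "1 \<le> lev k" "k \<noteq> 0" "k \<noteq> 1" "k \<noteq> m" using that dec levge[of k] by (auto simp: I_def J_def)
      have "real (card (H k)) * r k powr \<alpha> \<le> C * 2 powr (real (lev k) * \<alpha>) * real (lev k) powr - \<beta> * r k powr \<alpha>"
        using G(4)[OF k(1)] k by (intro mult_right_mono) (auto simp: H_def)
      also have "\<dots> = C * 2 powr (real (lev k) * \<alpha>) * real (lev k) powr - \<beta> * (2 powr \<alpha> * 2 powr - (real (lev k) * \<alpha>))"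
        using k by (simp add: r_def powr_powr algebra_simps flip: powr_add)
      also have "\<dots> = C * 2 powr \<alpha> * real (lev k) powr - \<beta>"
        by (simp add: powr_minus field_simps)
      finally show ?thesis .
    qed
    have mom_le: "(\<Sum>k\<in>J. b k powr (1 - \<gamma>) * (real (card (H k)) * (moment_const \<alpha> \<gamma> * r k powr \<alpha> * a k powr (\<gamma> - \<alpha>)))) \<le> \<epsilon> / 8"
    proof -
      have "b k powr (1 - \<gamma>) * (real (card (H k)) * (moment_const \<alpha> \<gamma> * r k powr \<alpha> * a k powr (\<gamma> - \<alpha>))) \<le> E * b k" if k: "k \<in> J" for k
      proof -
        define x where "x = \<epsilon> / real n1"
        have x: "0 < x" using \<epsilon> n by (simp add: x_def)
        have lk: "0 < real (lev k)" using k levge[of k] by (simp add: J_def)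
        have ak: "a k = x" using k by (auto simp: J_def a_def x_def)
        have bg: "b k powr - \<gamma> = x powr - (\<gamma> - \<alpha>) * real (lev k) powr \<beta>"
        proof -
          have "b k powr - \<gamma> = x powr ((1 - \<alpha> / \<gamma>) * - \<gamma>) * real (lev k) powr (- (\<beta> / \<gamma>) * - \<gamma>)"
            unfolding b_def x_def[symmetric] using x lk by (simp add: powr_mult powr_powr)
          moreover have "(1 - \<alpha> / \<gamma>) * - \<gamma> = - (\<gamma> - \<alpha>)" "- (\<beta> / \<gamma>) * - \<gamma> = \<beta>" using \<gamma> by (simp_all add: field_simps)
          ultimately show ?thesis by simp
        qed
        have b1: "b k powr (1 - \<gamma>) = b k * b k powr - \<gamma>" using bpos[OF k] by (simp add: powr_diff powr_minus_divide)
        have "b k powr (1 - \<gamma>) * (real (card (H k)) * (moment_const \<alpha> \<gamma> * r k powr \<alpha> * a k powr (\<gamma> - \<alpha>)))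
            = b k powr (1 - \<gamma>) * moment_const \<alpha> \<gamma> * x powr (\<gamma> - \<alpha>) * (real (card (H k)) * r k powr \<alpha>)"
          by (simp add: ak mult_ac)
        also have "\<dots> \<le> b k powr (1 - \<gamma>) * moment_const \<alpha> \<gamma> * x powr (\<gamma> - \<alpha>) * (C * 2 powr \<alpha> * real (lev k) powr - \<beta>)"
          using k mc by (intro mult_left_mono card_r) auto
        also have "\<dots> = E * b k * (x powr - (\<gamma> - \<alpha>) * x powr (\<gamma> - \<alpha>)) * (real (lev k) powr \<beta> * real (lev k) powr - \<beta>)"
          unfolding b1 bg E_def by (simp only: mult_ac)
        also have "\<dots> = E * b k" using x lk by (simp flip: powr_add)
        finally show ?thesis .
      qed
      then have "(\<Sum>k\<in>J. b k powr (1 - \<gamma>) * (real (card (H k)) * (moment_const \<alpha> \<gamma> * r k powr \<alpha> * a k powr (\<gamma> - \<alpha>)))) \<le> E * (\<Sum>k\<in>J. b k)"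
        unfolding sum_distrib_left by (rule sum_mono)
      also have "\<dots> \<le> E * (\<eta> * \<epsilon>)" using sum_b E by (intro mult_left_mono) auto
      also have "\<dots> \<le> E * (1 / (8 * E) * \<epsilon>)" using E \<epsilon> by (intro mult_left_mono mult_right_mono) (auto simp: \<eta>_def)
      finally show ?thesis using E by simp
    qed
    \<comment> \<open>Bound for minus the logarithm of the price of one link: logarithmic at level
      1, Jensen elsewhere.\<close>
    define g where "g k = (if k = 1 then A1 - ln \<epsilon> else A * (r k / a k) powr \<alpha>)" for k
    have g: "exp (- g k) \<le> stable_bump \<alpha> (r k / a k)" if "k \<in> {1..m}" for k
    proof (cases "k = 1")
      case True
      define y where "y = 64 * \<sigma> / \<epsilon>"
      have y: "1 \<le> y" using \<epsilon> \<sigma> by (simp add: y_def field_simps)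
      have "exp (- g k) = exp (ln \<epsilon> - A1)" using True by (simp add: g_def)
      also have "\<dots> \<le> exp (ln \<epsilon> - ln (64 * \<sigma> / c0))" by (simp add: A1_def)
      also have "\<dots> = c0 / y" using \<epsilon> \<sigma> c0 by (simp add: exp_diff y_def)
      also have "\<dots> \<le> stable_bump \<alpha> y" using stable_bump_ge_inverse[OF \<alpha>(1) y] by (simp add: c0_def)
      also have "y = r k / a k" using True by (simp add: y_def r_def a_def)
      finally show ?thesis .
    next
      case False
      have "0 \<le> r k" using \<sigma> by (simp add: r_def)
      then show ?thesis using stable_bump_ge_exp[OF \<alpha>, of "r k / a k"] apos[OF that] False by (simp add: g_def A_def)
    qed
    have "exp (- (\<Sum>k\<in>{1..m}. real (card (H k)) * g k)) = (\<Prod>k\<in>{1..m}. exp (- g k) ^ card (H k))"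
      by (simp add: sum_negf[symmetric] exp_sum exp_of_nat_mult[symmetric])
    also have "\<dots> \<le> (\<Prod>k\<in>{1..m}. stable_bump \<alpha> (r k / a k) ^ card (H k))"
      using g by (intro prod_mono conjI power_mono) auto
    finally have prod_ge: "exp (- (\<Sum>k\<in>{1..m}. real (card (H k)) * g k)) \<le> (\<Prod>k\<in>{1..m}. stable_bump \<alpha> (r k / a k) ^ card (H k))" .
    have cost1: "real (card (H 1)) * g 1 \<le> C * A1 * (2 powr (real n0 * \<alpha>) * real n0 powr - \<beta> * (1 - ln \<epsilon>))"
    proof -
      have "ln \<epsilon> \<le> 0" using \<epsilon> by simp
      then have "g 1 \<le> A1 * (1 - ln \<epsilon>)" "0 \<le> g 1"
        using A1 mult_right_mono_neg[of 1 A1 "ln \<epsilon>"] by (auto simp: g_def algebra_simps)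
      moreover have "real (card (H 1)) \<le> C * 2 powr (real n0 * \<alpha>) * real n0 powr - \<beta>"
        using G(4)[OF n(1)] dec by (simp add: H_def lev_def)
      ultimately have "real (card (H 1)) * g 1 \<le> (C * 2 powr (real n0 * \<alpha>) * real n0 powr - \<beta>) * (A1 * (1 - ln \<epsilon>))"
        using C by (intro mult_mono) auto
      then show ?thesis by (simp add: mult_ac)
    qed
    have costm: "real (card (H m)) * g m \<le> 1"
    proof -
      have "real (lev m) = real n2 + 1" using n2 by (simp add: lev_def m_def)
      then have "r m / a m = 2 powr - real n2 * (64 / \<epsilon>)" using m2 by (simp add: r_def a_def)
      then have "(r m / a m) powr \<alpha> = 2 powr (- real n2 * \<alpha>) * (64 / \<epsilon>) powr \<alpha>"
        using \<epsilon> by (simp only: powr_mult powr_powr)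
      also have "2 powr (- real n2 * \<alpha>) = (2 powr - \<alpha>) ^ n2" by (simp add: powr_powr mult.commute flip: powr_realpow)
      finally show ?thesis using n2(2) m2 by (simp add: g_def H_def mult_ac)
    qed
    have costIJ: "real (card (H k)) * g k \<le> D * (real (lev k) powr - \<beta> * a k powr - \<alpha>)" if "k \<in> I \<union> J" for k
    proof -
      have k: "k \<in> {1..m}" "k \<noteq> 1" using that dec by auto
      have ak: "0 < a k" using apos k by simp
      have "real (card (H k)) * g k = A * a k powr - \<alpha> * (real (card (H k)) * r k powr \<alpha>)"
        using ak k \<sigma> by (simp add: g_def powr_divide powr_minus r_def field_simps)
      also have "\<dots> \<le> A * a k powr - \<alpha> * (C * 2 powr \<alpha> * real (lev k) powr - \<beta>)"
        using A that by (intro mult_left_mono card_r) auto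
      finally show ?thesis by (simp add: D_def mult_ac)
    qed
    have costI: "(\<Sum>k\<in>I. real (card (H k)) * g k) \<le> D * 64 powr \<alpha> * (\<epsilon> powr - \<alpha> * s powr (1 + \<alpha>))"
    proof -
      have "(\<Sum>k\<in>I. real (card (H k)) * g k) \<le> (\<Sum>k\<in>I. D * 64 powr \<alpha> * (\<epsilon> powr - \<alpha> * s powr \<alpha>) * real (lev k) powr - q)"
      proof (rule sum_mono)
        fix k assume k: "k \<in> I"
        have lk: "0 < real (lev k)" using k levge[of k] by (simp add: I_def)
        have eq1: "a k powr - \<alpha> = \<epsilon> powr - \<alpha> * (64 powr \<alpha> * s powr \<alpha>) * real (lev k) powr (q * \<alpha>)"
        proof -
          have "a k = \<epsilon> * (1 / (64 * s)) * real (lev k) powr - q" using k by (auto simp: I_def a_def)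
          then have "a k powr - \<alpha> = \<epsilon> powr - \<alpha> * (1 / (64 * s)) powr - \<alpha> * (real (lev k) powr - q) powr - \<alpha>"
            by (simp only: powr_mult)
          moreover have "(1 / (64 * s)) powr - \<alpha> = 64 powr \<alpha> * s powr \<alpha>"
            using s by (simp add: powr_divide powr_mult powr_minus field_simps)
          moreover have "(real (lev k) powr - q) powr - \<alpha> = real (lev k) powr (q * \<alpha>)"
            by (simp add: powr_powr)
          ultimately show ?thesis by simp
        qed
        \<comment> \<open>q = \<beta>/(1+\<alpha>) is the exponent for which cost and cap of a level
          decay alike, so the same sum bounded by s controls both.\<close>
        have eq2: "real (lev k) powr - \<beta> * real (lev k) powr (q * \<alpha>) = real (lev k) powr - q"
        proof -
          have "- \<beta> + q * \<alpha> = - q" using \<alpha> by (simp add: q_def field_simps)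
          then show ?thesis by (simp flip: powr_add)
        qed
        have "real (lev k) powr - \<beta> * a k powr - \<alpha> =
            64 powr \<alpha> * (\<epsilon> powr - \<alpha> * s powr \<alpha>) * (real (lev k) powr - \<beta> * real (lev k) powr (q * \<alpha>))"
          unfolding eq1 by (simp only: mult_ac)
        then have "real (lev k) powr - \<beta> * a k powr - \<alpha> = 64 powr \<alpha> * (\<epsilon> powr - \<alpha> * s powr \<alpha>) * real (lev k) powr - q"
          unfolding eq2 .
        then show "real (card (H k)) * g k \<le> D * 64 powr \<alpha> * (\<epsilon> powr - \<alpha> * s powr \<alpha>) * real (lev k) powr - q"
          using costIJ[of k] k by (simp add: mult.assoc)
      qed
      also have "\<dots> \<le> D * 64 powr \<alpha> * (\<epsilon> powr - \<alpha> * s powr \<alpha>) * s"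
        unfolding sum_distrib_left[symmetric] using sumI[of "\<lambda>n. real n powr - q"] s D
        by (intro mult_left_mono) (auto simp: q_def)
      finally show ?thesis using s by (simp add: powr_add mult_ac)
    qed
    have costJ: "(\<Sum>k\<in>J. real (card (H k)) * g k) \<le> D * (\<beta> / (\<beta> - 1)) * real n1"
    proof -
      have "(\<Sum>k\<in>J. real (card (H k)) * g k) \<le> (\<Sum>k\<in>J. D * (real (lev k) powr - \<beta> * (\<epsilon> / real n1) powr - \<alpha>))"
      proof (rule sum_mono)
        fix k assume k: "k \<in> J"
        then have "a k = \<epsilon> / real n1" by (auto simp: J_def a_def)
        then show "real (card (H k)) * g k \<le> D * (real (lev k) powr - \<beta> * (\<epsilon> / real n1) powr - \<alpha>)"
          using costIJ[of k] k by simp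
      qed
      also have "\<dots> \<le> D * (\<beta> / (\<beta> - 1) * real n1)"
        unfolding sum_distrib_left[symmetric]
        using sumJ[of "\<lambda>n. real n powr - \<beta> * (\<epsilon> / real n1) powr - \<alpha>"] \<Lambda>(3)[OF \<epsilon>(1) n(2,3), of n2] D
        by (intro mult_left_mono) auto
      finally show ?thesis by (simp add: mult.assoc)
    qed
    let ?Y = "1 + 2 powr (real n0 * \<alpha>) * real n0 powr - \<beta> * (1 - ln \<epsilon>) + \<epsilon> powr - \<alpha> * s powr (1 + \<alpha>) + real n1"
    have "ln 2 + (\<Sum>k\<in>{1..m}. real (card (H k)) * g k) \<le> K * ?Y"
    proof (rule order_trans[OF _ Ksum])
      show "0 \<le> 2 powr (real n0 * \<alpha>) * real n0 powr - \<beta> * (1 - ln \<epsilon>)"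
      proof -
        have "ln \<epsilon> \<le> 0" using \<epsilon> by simp
        then show ?thesis by (intro mult_nonneg_nonneg) auto
      qed
      show "0 \<le> \<epsilon> powr - \<alpha> * s powr (1 + \<alpha>)" by simp
      show "0 \<le> real n1" by simp
      show "ln 2 + (\<Sum>k\<in>{1..m}. real (card (H k)) * g k) \<le>
        ln 2 + (C * A1 * (2 powr (real n0 * \<alpha>) * real n0 powr - \<beta> * (1 - ln \<epsilon>)) + 1
          + D * 64 powr \<alpha> * (\<epsilon> powr - \<alpha> * s powr (1 + \<alpha>)) + D * (\<beta> / (\<beta> - 1)) * real n1)"
        unfolding sum_dec using cost1 costm costI costJ by linarith
    qed
    then have "exp (- K * ?Y) \<le> exp (- (ln 2 + (\<Sum>k\<in>{1..m}. real (card (H k)) * g k)))" by simp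
    also have "\<dots> = 1 / 2 * exp (- (\<Sum>k\<in>{1..m}. real (card (H k)) * g k))"
    proof -
      have "exp (- (ln 2 + x)) = exp (- ln 2) * exp (- x)" for x :: real by (simp flip: exp_add)
      then show ?thesis by (simp add: exp_minus)
    qed
    also have "\<dots> \<le> 1 / 2 * (\<Prod>k\<in>{1..m}. stable_bump \<alpha> (r k / a k) ^ card (H k))"
      using prod_ge by simp
    also have "\<dots> \<le> measure M {\<omega> \<in> space M. \<forall>s\<in>H m. \<forall>t\<in>H m. \<bar>X s \<omega> - X t \<omega>\<bar> \<le> \<epsilon>}"
    proof (rule chain_small_ball[where T = T and \<rho> = \<rho> and ?t0.0 = t0 and p = p and J = J and b = b and \<gamma> = \<gamma>])
      show "finite (H k)" "H k \<subseteq> T" if "k \<le> m" for k using H1 by auto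
      show "H 0 = {t0}" by (simp add: H_def)
      show "J \<subseteq> {1..m}" by (auto simp: J_def)
      show "1 \<le> \<gamma>" using \<gamma> by simp
    qed (fact assms(1) \<alpha> sas rho_nonneg rho_scale H1 p apos bpos \<gamma> sum_le mom_le \<epsilon>)+
    also have "H m = F" using m2 by (simp add: H_def)
    finally show "exp (- K * ?Y) \<le> measure M {\<omega> \<in> space M. \<forall>s\<in>F. \<forall>t\<in>F. \<bar>X s \<omega> - X t \<omega>\<bar> \<le> \<epsilon>}" .
  qed
qed

subsection \<open>Choice of levels in the three regimes\<close>

text \<open>n0 is about log2(1/\<epsilon>) and n1 about \<epsilon>^(-\<alpha>/(\<beta>-\<alpha>)) in
  every regime. What changes is where sum n^(-q), q = \<beta>/(1+\<alpha>), has its weight: at n1 if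
  q < 1, spread logarithmically if q = 1, at n0 if q > 1.\<close>

lemma level_choice:
  fixes \<alpha> \<beta> \<Lambda> :: real
  assumes \<alpha>: "0 < \<alpha>" and \<beta>: "max 1 \<alpha> < \<beta>" and \<Lambda>: "1 \<le> \<Lambda>"
  defines "R \<equiv> \<lambda>\<epsilon>. if \<beta> < 1 + \<alpha> then \<epsilon> powr (- 1 / (\<beta> / \<alpha> - 1))
                 else if \<beta> = 1 + \<alpha> then \<epsilon> powr (- \<alpha>) * \<bar>ln \<epsilon>\<bar> powr (1 + \<alpha>)
                 else \<epsilon> powr (- \<alpha>) * \<bar>ln \<epsilon>\<bar> powr (- \<beta> + 1 + \<alpha>)"
  shows "\<exists>C>0. \<forall>\<epsilon>. 0 < \<epsilon> \<and> \<epsilon> < exp (- 1) \<longrightarrow> (\<exists>n0 n1 s. 1 \<le> n0 \<and> 1 \<le> n1 \<and>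
      \<Lambda> * \<epsilon> powr (- (\<alpha> / (\<beta> - \<alpha>))) \<le> real n1 \<and> 0 < s \<and>
      (\<Sum>n\<in>{n0<..<n1}. real n powr - (\<beta> / (1 + \<alpha>))) \<le> s \<and>
      1 + 2 powr (real n0 * \<alpha>) * real n0 powr - \<beta> * (1 - ln \<epsilon>) + \<epsilon> powr - \<alpha> * s powr (1 + \<alpha>) + real n1 \<le> C * R \<epsilon>)"
proof -
  define \<kappa> where "\<kappa> = \<alpha> / (\<beta> - \<alpha>)"
  define q where "q = \<beta> / (1 + \<alpha>)"
  \<comment> \<open>The first level with 2^(-n0) \<le> \<epsilon>.\<close>
  define n0 where "n0 \<epsilon> = nat \<lceil>- ln \<epsilon> / ln 2\<rceil>" for \<epsilon> :: real
  define n1 where "n1 \<epsilon> = nat \<lceil>\<Lambda> * \<epsilon> powr - \<kappa>\<rceil>" for \<epsilon> :: real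
  have \<kappa>: "0 < \<kappa>" using \<alpha> \<beta> by (simp add: \<kappa>_def)
  have \<beta>': "1 < \<beta>" "\<alpha> < \<beta>" using \<beta> by auto
  have q: "0 < q" "(1 - q) * (1 + \<alpha>) = 1 + \<alpha> - \<beta>" using \<alpha> \<beta>' by (simp_all add: q_def field_simps)
  have common: "1 < - ln \<epsilon>" "\<bar>ln \<epsilon>\<bar> = - ln \<epsilon>" "- ln \<epsilon> \<le> real (n0 \<epsilon>)" "1 \<le> n0 \<epsilon>" "1 \<le> n1 \<epsilon>" "\<Lambda> * \<epsilon> powr - \<kappa> \<le> real (n1 \<epsilon>)"
      "real (n1 \<epsilon>) \<le> 2 * \<Lambda> * \<epsilon> powr - \<kappa>" "1 \<le> \<epsilon> powr - \<kappa>" "1 \<le> \<epsilon> powr - \<alpha>" "\<epsilon> < 1"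
      "2 powr (real (n0 \<epsilon>) * \<alpha>) * real (n0 \<epsilon>) powr - \<beta> * (1 - ln \<epsilon>) \<le> 2 powr (\<alpha> + 1) * (\<epsilon> powr - \<alpha> * (- ln \<epsilon>) powr (1 - \<beta>))"
    if \<epsilon>: "0 < \<epsilon>" "\<epsilon> < exp (- 1)" for \<epsilon>
  proof -
    define L where "L = - ln \<epsilon>"
    have "ln \<epsilon> < ln (exp (- 1))" using \<epsilon> by (subst ln_less_cancel_iff) auto
    then have L: "1 < L" by (simp add: L_def)
    then show "1 < - ln \<epsilon>" "\<bar>ln \<epsilon>\<bar> = - ln \<epsilon>" by (auto simp: L_def)
    show "\<epsilon> < 1" using \<epsilon> exp_le_one_iff[of "- 1"] by linarith
    then show p1: "1 \<le> \<epsilon> powr - \<kappa>" "1 \<le> \<epsilon> powr - \<alpha>" using \<epsilon> \<kappa> \<alpha> by (simp_all add: powr_minus_divide powr_le1)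
    have l2: "0 < ln (2 :: real)" "ln (2 :: real) < 1" using ln_less_self[of 2] ln_2_less_1 by auto
    have "L \<le> L / ln 2" using L l2 by (simp add: field_simps)
    moreover have "L / ln 2 \<le> real (n0 \<epsilon>)" "real (n0 \<epsilon>) \<le> L / ln 2 + 1"
    proof -
      have "0 < - ln \<epsilon> / ln 2" using L l2 by (intro divide_pos_pos) (auto simp: L_def)
      then show "L / ln 2 \<le> real (n0 \<epsilon>)" "real (n0 \<epsilon>) \<le> L / ln 2 + 1"
        unfolding n0_def L_def by linarith+
    qed
    ultimately have n0: "L \<le> real (n0 \<epsilon>)" "real (n0 \<epsilon>) \<le> L / ln 2 + 1" by auto
    then show "- ln \<epsilon> \<le> real (n0 \<epsilon>)" "1 \<le> n0 \<epsilon>" using L by (auto simp: L_def)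
    have "1 * 1 \<le> \<Lambda> * \<epsilon> powr - \<kappa>" using \<Lambda> p1 by (intro mult_mono) auto
    moreover from this have "\<Lambda> * \<epsilon> powr - \<kappa> \<le> real (n1 \<epsilon>)" "real (n1 \<epsilon>) \<le> \<Lambda> * \<epsilon> powr - \<kappa> + 1"
      unfolding n1_def by linarith+
    ultimately show "1 \<le> n1 \<epsilon>" "\<Lambda> * \<epsilon> powr - \<kappa> \<le> real (n1 \<epsilon>)" "real (n1 \<epsilon>) \<le> 2 * \<Lambda> * \<epsilon> powr - \<kappa>"
      by linarith+
    have "2 powr (real (n0 \<epsilon>) * \<alpha>) \<le> 2 powr ((L / ln 2 + 1) * \<alpha>)"
      using n0 \<alpha> by (intro powr_mono mult_right_mono) auto
    also have "\<dots> = 2 powr \<alpha> * \<epsilon> powr - \<alpha>"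
    proof -
      have "2 powr ((L / ln 2 + 1) * \<alpha>) = exp (L * \<alpha> + \<alpha> * ln 2)" using l2 by (simp add: powr_def field_simps)
      then show ?thesis using \<epsilon> by (simp add: powr_def L_def algebra_simps flip: exp_add)
    qed
    finally have "2 powr (real (n0 \<epsilon>) * \<alpha>) * real (n0 \<epsilon>) powr - \<beta> * (1 - ln \<epsilon>) \<le> (2 powr \<alpha> * \<epsilon> powr - \<alpha>) * L powr - \<beta> * (2 * L)"
      using L n0 \<beta>' by (intro mult_mono powr_mono2') (auto simp: L_def)
    also have "\<dots> = 2 powr (\<alpha> + 1) * (\<epsilon> powr - \<alpha> * L powr (1 - \<beta>))"
    proof -
      have "L powr (1 + - \<beta>) = L * L powr - \<beta>" unfolding powr_add using L by simp
      then show ?thesis by (simp add: powr_add)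
    qed
    finally show "2 powr (real (n0 \<epsilon>) * \<alpha>) * real (n0 \<epsilon>) powr - \<beta> * (1 - ln \<epsilon>) \<le> 2 powr (\<alpha> + 1) * (\<epsilon> powr - \<alpha> * (- ln \<epsilon>) powr (1 - \<beta>))"
      by (simp add: L_def)
  qed
  have finish: ?thesis
    if C: "0 < C" and s: "\<And>\<epsilon>. 0 < \<epsilon> \<Longrightarrow> \<epsilon> < exp (- 1) \<Longrightarrow> 0 < s \<epsilon>"
      "\<And>\<epsilon>. 0 < \<epsilon> \<Longrightarrow> \<epsilon> < exp (- 1) \<Longrightarrow> (\<Sum>n\<in>{n0 \<epsilon><..<n1 \<epsilon>}. real n powr - q) \<le> s \<epsilon>"
      "\<And>\<epsilon>. 0 < \<epsilon> \<Longrightarrow> \<epsilon> < exp (- 1) \<Longrightarrow> 1 + 2 powr (\<alpha> + 1) * (\<epsilon> powr - \<alpha> * (- ln \<epsilon>) powr (1 - \<beta>))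
          + \<epsilon> powr - \<alpha> * s \<epsilon> powr (1 + \<alpha>) + 2 * \<Lambda> * \<epsilon> powr - \<kappa> \<le> C * R \<epsilon>"
    for C s
  proof (intro exI[of _ C] conjI C allI impI)
    fix \<epsilon> :: real assume "0 < \<epsilon> \<and> \<epsilon> < exp (- 1)"
    then have \<epsilon>: "0 < \<epsilon>" "\<epsilon> < exp (- 1)" by auto
    note c = common[OF \<epsilon>] and t = s(1)[OF \<epsilon>] s(2)[OF \<epsilon>] s(3)[OF \<epsilon>]
    have "1 + 2 powr (real (n0 \<epsilon>) * \<alpha>) * real (n0 \<epsilon>) powr - \<beta> * (1 - ln \<epsilon>) + \<epsilon> powr - \<alpha> * s \<epsilon> powr (1 + \<alpha>) + real (n1 \<epsilon>) \<le> C * R \<epsilon>"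
      using c(7,11) t(3) by linarith
    with c(4,5,6) t(1,2) show "\<exists>n0 n1 s. 1 \<le> n0 \<and> 1 \<le> n1 \<and>
      \<Lambda> * \<epsilon> powr (- (\<alpha> / (\<beta> - \<alpha>))) \<le> real n1 \<and> 0 < s \<and>
      (\<Sum>n\<in>{n0<..<n1}. real n powr - (\<beta> / (1 + \<alpha>))) \<le> s \<and>
      1 + 2 powr (real n0 * \<alpha>) * real n0 powr - \<beta> * (1 - ln \<epsilon>) + \<epsilon> powr - \<alpha> * s powr (1 + \<alpha>) + real n1 \<le> C * R \<epsilon>"
      unfolding \<kappa>_def q_def by (intro exI[of _ "n0 \<epsilon>"] exI[of _ "n1 \<epsilon>"] exI[of _ "s \<epsilon>"] conjI)
  qed
  consider "\<beta> < 1 + \<alpha>" | "\<beta> = 1 + \<alpha>" | "1 + \<alpha> < \<beta>" by linarith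
  then show ?thesis
  proof cases
    case 1
    have q1: "q < 1" using 1 \<alpha> by (simp add: q_def)
    have R: "R \<epsilon> = \<epsilon> powr - \<kappa>" for \<epsilon>
    proof -
      have "- 1 / (\<beta> / \<alpha> - 1) = - \<kappa>" using \<alpha> \<beta>' by (simp add: \<kappa>_def field_simps)
      then show ?thesis using 1 by (simp add: R_def)
    qed
    define c where "c = (1 / (1 - q)) powr (1 + \<alpha>) * (2 * \<Lambda>) powr (1 + \<alpha> - \<beta>)"
    have c: "0 < c" using q1 \<Lambda> by (simp add: c_def)
    show ?thesis
    \<comment> \<open>The sum is governed by its upper end. With n1 of order \<epsilon>^(-\<kappa>)
      the intermediate and the averaged levels cost the same order, which is the balance behind the
      exponent \<kappa>.\<close>
    proof (rule finish[of "1 + 2 powr (\<alpha> + 1) + c + 2 * \<Lambda>" "\<lambda>\<epsilon>. real (n1 \<epsilon>) powr (1 - q) / (1 - q)"])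
      show "0 < 1 + 2 powr (\<alpha> + 1) + c + 2 * \<Lambda>" using c \<Lambda> powr_gt_zero[of 2 "\<alpha> + 1"] by linarith
    next
      fix \<epsilon> :: real assume \<epsilon>: "0 < \<epsilon>" "\<epsilon> < exp (- 1)"
      note C = common[OF \<epsilon>]
      define P where "P = \<epsilon> powr - \<kappa>"
      show "0 < real (n1 \<epsilon>) powr (1 - q) / (1 - q)" using C(5) q1 by simp
      have "(\<Sum>n\<in>{n0 \<epsilon><..<n1 \<epsilon>}. real n powr - q) \<le> (\<Sum>n\<in>{1..n1 \<epsilon>}. real n powr - q)"
        by (intro sum_mono2) auto
      also have "\<dots> \<le> real (n1 \<epsilon>) powr (1 - q) / (1 - q)" by (rule sum_powr_head_le[OF q(1) q1])
      finally show "(\<Sum>n\<in>{n0 \<epsilon><..<n1 \<epsilon>}. real n powr - q) \<le> real (n1 \<epsilon>) powr (1 - q) / (1 - q)" .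
      have "(real (n1 \<epsilon>) powr (1 - q) / (1 - q)) powr (1 + \<alpha>) = (1 / (1 - q)) powr (1 + \<alpha>) * real (n1 \<epsilon>) powr (1 + \<alpha> - \<beta>)"
        using q1 by (simp add: powr_divide powr_powr q(2))
      also have "\<dots> \<le> (1 / (1 - q)) powr (1 + \<alpha>) * (2 * \<Lambda> * P) powr (1 + \<alpha> - \<beta>)"
        using C(7) 1 by (intro mult_left_mono powr_mono2) (auto simp: P_def)
      also have "\<dots> = c * P powr (1 + \<alpha> - \<beta>)" using \<Lambda> by (simp add: c_def powr_mult)
      finally have "\<epsilon> powr - \<alpha> * (real (n1 \<epsilon>) powr (1 - q) / (1 - q)) powr (1 + \<alpha>) \<le> \<epsilon> powr - \<alpha> * (c * P powr (1 + \<alpha> - \<beta>))"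
        by (intro mult_left_mono) auto
      also have "\<dots> = c * P"
      proof -
        have "- \<alpha> + - \<kappa> * (1 + \<alpha> - \<beta>) = - \<kappa>" using \<beta>' by (simp add: \<kappa>_def field_simps)
        then have "\<epsilon> powr - \<alpha> * P powr (1 + \<alpha> - \<beta>) = P" by (simp add: P_def powr_powr flip: powr_add)
        then show ?thesis by (simp add: mult.left_commute)
      qed
      finally have 2: "\<epsilon> powr - \<alpha> * (real (n1 \<epsilon>) powr (1 - q) / (1 - q)) powr (1 + \<alpha>) \<le> c * P" .
      have "\<alpha> * (\<beta> - \<alpha>) \<le> \<alpha> * 1" using 1 \<alpha> by (intro mult_left_mono) auto
      then have "\<alpha> \<le> \<kappa>" using \<beta>' by (simp add: \<kappa>_def field_simps)
      then have "\<epsilon> powr - \<alpha> \<le> P" unfolding P_def using \<epsilon> C(10) by (intro powr_mono') auto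
      moreover have "(- ln \<epsilon>) powr (1 - \<beta>) \<le> 1" using C(1) \<beta>' powr_mono[of "1 - \<beta>" 0 "- ln \<epsilon>"] by simp
      ultimately have "\<epsilon> powr - \<alpha> * (- ln \<epsilon>) powr (1 - \<beta>) \<le> P * 1" by (intro mult_mono) (auto simp: P_def)
      then have 3: "2 powr (\<alpha> + 1) * (\<epsilon> powr - \<alpha> * (- ln \<epsilon>) powr (1 - \<beta>)) \<le> 2 powr (\<alpha> + 1) * P"
        by (intro mult_left_mono) auto
      have "1 \<le> P" using C(8) by (simp add: P_def)
      with 2 3 show "1 + 2 powr (\<alpha> + 1) * (\<epsilon> powr - \<alpha> * (- ln \<epsilon>) powr (1 - \<beta>))
          + \<epsilon> powr - \<alpha> * (real (n1 \<epsilon>) powr (1 - q) / (1 - q)) powr (1 + \<alpha>) + 2 * \<Lambda> * \<epsilon> powr - \<kappa>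
          \<le> (1 + 2 powr (\<alpha> + 1) + c + 2 * \<Lambda>) * R \<epsilon>"
        unfolding R P_def[symmetric] distrib_right by linarith
    qed
  next
    case 2
    have R: "R \<epsilon> = \<epsilon> powr - \<alpha> * \<bar>ln \<epsilon>\<bar> powr (1 + \<alpha>)" for \<epsilon> using 2 by (simp add: R_def)
    have \<kappa>\<alpha>: "\<kappa> = \<alpha>" "q = 1" using 2 \<alpha> by (simp_all add: \<kappa>_def q_def)
    define c where "c = 1 + ln (2 * \<Lambda>) + \<alpha>"
    have l0: "0 \<le> ln (2 * \<Lambda>)" using \<Lambda> by simp
    then have c: "0 < c" using \<alpha> by (simp add: c_def)
    show ?thesis
    \<comment> \<open>Now q = 1 and \<kappa> = \<alpha>: the sum is of order ln n1, hence of order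
      ln(1/\<epsilon>), and n1 itself stays below the rate.\<close>
    proof (rule finish[of "1 + 2 powr (\<alpha> + 1) + c powr (1 + \<alpha>) + 2 * \<Lambda>" "\<lambda>\<epsilon>. c * - ln \<epsilon>"])
      show "0 < 1 + 2 powr (\<alpha> + 1) + c powr (1 + \<alpha>) + 2 * \<Lambda>"
        using \<Lambda> powr_ge_zero[of 2 "\<alpha> + 1"] powr_ge_zero[of c "1 + \<alpha>"] by linarith
    next
      fix \<epsilon> :: real assume \<epsilon>: "0 < \<epsilon>" "\<epsilon> < exp (- 1)"
      note C = common[OF \<epsilon>]
      define L where "L = - ln \<epsilon>"
      have L: "1 < L" using C(1) by (simp add: L_def)
      show "0 < c * - ln \<epsilon>" using c C(1) by (intro mult_pos_pos) auto
      have "(\<Sum>n\<in>{n0 \<epsilon><..<n1 \<epsilon>}. real n powr - q) \<le> (\<Sum>n\<in>{1..n1 \<epsilon>}. real n powr - 1)"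
        unfolding \<kappa>\<alpha> by (intro sum_mono2) auto
      also have "\<dots> \<le> 1 + ln (real (n1 \<epsilon>))" by (rule sum_inverse_le_ln[OF C(5)])
      also have "ln (real (n1 \<epsilon>)) \<le> ln (2 * \<Lambda> * \<epsilon> powr - \<alpha>)"
        using C(5,7) \<Lambda> \<epsilon> by (subst ln_le_cancel_iff) (auto simp: \<kappa>\<alpha>)
      also have "\<dots> = ln (2 * \<Lambda>) + \<alpha> * L" using \<Lambda> \<epsilon> by (simp add: ln_mult ln_powr L_def)
      also have "1 + (ln (2 * \<Lambda>) + \<alpha> * L) \<le> c * L"
        using L l0 mult_left_mono[of 1 L "ln (2 * \<Lambda>)"] by (simp add: c_def distrib_right)
      finally show "(\<Sum>n\<in>{n0 \<epsilon><..<n1 \<epsilon>}. real n powr - q) \<le> c * - ln \<epsilon>" by (simp add: L_def)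
      define Q where "Q = \<epsilon> powr - \<alpha> * L powr (1 + \<alpha>)"
      have "1 \<le> L powr (1 + \<alpha>)" using L \<alpha> by (simp add: ge_one_powr_ge_zero)
      then have eQ: "\<epsilon> powr - \<alpha> \<le> Q" unfolding Q_def using mult_left_mono[of 1 "L powr (1 + \<alpha>)" "\<epsilon> powr - \<alpha>"] by simp
      then have "2 * \<Lambda> * \<epsilon> powr - \<alpha> \<le> 2 * \<Lambda> * Q" using \<Lambda> by (intro mult_left_mono) auto
      moreover have "1 \<le> Q" using eQ C(9) by linarith
      moreover have "\<epsilon> powr - \<alpha> * (c * L) powr (1 + \<alpha>) = c powr (1 + \<alpha>) * Q"
        using c L by (simp add: Q_def powr_mult)
      moreover have "2 powr (\<alpha> + 1) * (\<epsilon> powr - \<alpha> * L powr (1 - \<beta>)) \<le> 2 powr (\<alpha> + 1) * Q"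
      proof -
        have "L powr (1 - \<beta>) \<le> L powr (1 + \<alpha>)" using L \<alpha> \<beta>' by (intro powr_mono) auto
        then show ?thesis unfolding Q_def by (intro mult_left_mono) auto
      qed
      ultimately show "1 + 2 powr (\<alpha> + 1) * (\<epsilon> powr - \<alpha> * (- ln \<epsilon>) powr (1 - \<beta>))
          + \<epsilon> powr - \<alpha> * (c * - ln \<epsilon>) powr (1 + \<alpha>) + 2 * \<Lambda> * \<epsilon> powr - \<kappa>
          \<le> (1 + 2 powr (\<alpha> + 1) + c powr (1 + \<alpha>) + 2 * \<Lambda>) * R \<epsilon>"
        unfolding R C(2) \<kappa>\<alpha> L_def[symmetric] Q_def[symmetric] distrib_right by linarith
    qed
  next
    case 3
    have q1: "1 < q" using 3 \<alpha> by (simp add: q_def)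
    have R: "R \<epsilon> = \<epsilon> powr - \<alpha> * \<bar>ln \<epsilon>\<bar> powr (1 + \<alpha> - \<beta>)" for \<epsilon>
    proof -
      have eq: "- \<beta> + 1 + \<alpha> = 1 + \<alpha> - \<beta>" by simp
      have "R \<epsilon> = \<epsilon> powr - \<alpha> * \<bar>ln \<epsilon>\<bar> powr (- \<beta> + 1 + \<alpha>)" using 3 by (simp add: R_def)
      then show ?thesis unfolding eq .
    qed
    define c where "c = q / (q - 1)"
    define p where "p = \<beta> - 1 - \<alpha>"
    define d where "d = \<alpha> - \<kappa>"
    have c: "0 < c" and p: "0 < p" using q1 3 by (simp_all add: c_def p_def)
    have "\<alpha> * 1 < \<alpha> * (\<beta> - \<alpha>)" using 3 \<alpha> by (intro mult_strict_left_mono) auto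
    then have d: "0 < d" using \<beta>' by (simp add: d_def \<kappa>_def field_simps)
    \<comment> \<open>Constant in ln(1/\<epsilon>)^p \<le> c3 \<epsilon>^(-d). Since \<kappa> =
      \<alpha> - d < \<alpha>, the term n1 is polynomially smaller than \<epsilon>^(-\<alpha>) and
      survives division by the power p of the logarithm.\<close>
    define c3 where "c3 = (p / d) powr p"
    have c3: "0 < c3" using p d by (simp add: c3_def)
    show ?thesis
    \<comment> \<open>The series converges, so s is its tail from n0 on, of order
      ln(1/\<epsilon>)^(1-q).\<close>
    proof (rule finish[of "c3 + 2 powr (\<alpha> + 1) + c powr (1 + \<alpha>) + 2 * \<Lambda> * c3" "\<lambda>\<epsilon>. c * (- ln \<epsilon>) powr (1 - q)"])
      show "0 < c3 + 2 powr (\<alpha> + 1) + c powr (1 + \<alpha>) + 2 * \<Lambda> * c3"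
        using \<Lambda> c3 by (intro add_pos_nonneg) auto
    next
      fix \<epsilon> :: real assume \<epsilon>: "0 < \<epsilon>" "\<epsilon> < exp (- 1)"
      note C = common[OF \<epsilon>]
      define L where "L = - ln \<epsilon>"
      have L: "1 < L" using C(1) by (simp add: L_def)
      show "0 < c * (- ln \<epsilon>) powr (1 - q)" using c C(1) by (intro mult_pos_pos) auto
      have "(\<Sum>n\<in>{n0 \<epsilon><..<n1 \<epsilon>}. real n powr - q) \<le> (\<Sum>n\<in>{n0 \<epsilon>..n1 \<epsilon>}. real n powr - q)"
        by (intro sum_mono2) auto
      also have "\<dots> \<le> c * real (n0 \<epsilon>) powr (1 - q)" unfolding c_def by (rule sum_powr_tail_le[OF q1 C(4)])
      also have "\<dots> \<le> c * L powr (1 - q)" using c C(3) L q1 by (intro mult_left_mono powr_mono2') (auto simp: L_def)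
      finally show "(\<Sum>n\<in>{n0 \<epsilon><..<n1 \<epsilon>}. real n powr - q) \<le> c * (- ln \<epsilon>) powr (1 - q)" by (simp add: L_def)
      define Q where "Q = \<epsilon> powr - \<alpha> * L powr (1 + \<alpha> - \<beta>)"
      have PQ: "\<epsilon> powr - \<kappa> \<le> c3 * Q"
      proof -
        have "ln (1 / \<epsilon>) \<le> (1 / \<epsilon>) powr (d / p) / (d / p)"
          using \<epsilon> C(10) d p by (intro ln_powr_bound) auto
        then have "L \<le> p / d * \<epsilon> powr - (d / p)"
          using \<epsilon> by (simp add: L_def ln_div powr_divide powr_minus field_simps)
        then have "L powr p \<le> (p / d * \<epsilon> powr - (d / p)) powr p" using L p by (intro powr_mono2) auto
        also have "\<dots> = c3 * \<epsilon> powr (- (d / p) * p)" by (simp only: c3_def powr_mult powr_powr)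
        also have "- (d / p) * p = - d" using p by simp
        finally have "L powr p \<le> c3 * \<epsilon> powr - d" .
        have "\<epsilon> powr - \<kappa> = \<epsilon> powr - \<kappa> * (L powr p * L powr - p)" using L by (simp flip: powr_add)
        also have "\<dots> \<le> \<epsilon> powr - \<kappa> * (c3 * \<epsilon> powr - d * L powr - p)"
          using \<open>L powr p \<le> c3 * \<epsilon> powr - d\<close> by (intro mult_left_mono mult_right_mono) auto
        also have "\<dots> = c3 * ((\<epsilon> powr - \<kappa> * \<epsilon> powr - d) * L powr - p)"
          by (simp only: mult_ac)
        also have "\<epsilon> powr - \<kappa> * \<epsilon> powr - d = \<epsilon> powr - \<alpha>" by (simp add: d_def flip: powr_add)
        also have "- p = 1 + \<alpha> - \<beta>" by (simp add: p_def)
        finally show ?thesis unfolding Q_def .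
      qed
      then have "2 * \<Lambda> * \<epsilon> powr - \<kappa> \<le> 2 * \<Lambda> * c3 * Q" using \<Lambda> mult_left_mono[OF PQ, of "2 * \<Lambda>"] by (simp add: mult.assoc)
      moreover have "1 \<le> c3 * Q" using PQ C(8) by linarith
      moreover have "\<epsilon> powr - \<alpha> * (c * L powr (1 - q)) powr (1 + \<alpha>) = c powr (1 + \<alpha>) * Q"
        using c L by (simp add: Q_def powr_mult powr_powr q(2))
      moreover have "2 powr (\<alpha> + 1) * (\<epsilon> powr - \<alpha> * L powr (1 - \<beta>)) \<le> 2 powr (\<alpha> + 1) * Q"
      proof -
        have "L powr (1 - \<beta>) \<le> L powr (1 + \<alpha> - \<beta>)" using L \<alpha> \<beta>' by (intro powr_mono) auto
        then show ?thesis unfolding Q_def by (intro mult_left_mono) auto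
      qed
      ultimately show "1 + 2 powr (\<alpha> + 1) * (\<epsilon> powr - \<alpha> * (- ln \<epsilon>) powr (1 - \<beta>))
          + \<epsilon> powr - \<alpha> * (c * (- ln \<epsilon>) powr (1 - q)) powr (1 + \<alpha>) + 2 * \<Lambda> * \<epsilon> powr - \<kappa>
          \<le> (c3 + 2 powr (\<alpha> + 1) + c powr (1 + \<alpha>) + 2 * \<Lambda> * c3) * R \<epsilon>"
        unfolding R C(2) L_def[symmetric] Q_def[symmetric] distrib_right by linarith
    qed
  qed
qed

subsection \<open>Covering numbers and separability\<close>

text \<open>Raise x \<le> exp x at x = (\<alpha> ln 2 / \<beta>) n to the power \<beta>. It makes
  the cardinality bound hold for singletons at every level.\<close>

lemma one_le_two_powr_times_powr:
  fixes \<alpha> \<beta> :: real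
  assumes "0 < \<alpha>" "0 < \<beta>" "1 \<le> (n :: nat)"
  shows "1 \<le> (\<alpha> * ln 2 / \<beta>) powr - \<beta> * 2 powr (real n * \<alpha>) * real n powr - \<beta>"
proof -
  define a where "a = \<alpha> * ln 2 / \<beta>"
  have a: "0 < a" using assms by (simp add: a_def)
  have n: "0 < real n" using assms by simp
  have "a * real n \<le> exp (a * real n)" using exp_ge_add_one_self[of "a * real n"] by linarith
  then have "(a * real n) powr \<beta> \<le> exp (a * real n) powr \<beta>"
    using a n assms by (intro powr_mono2) auto
  also have "\<dots> = 2 powr (real n * \<alpha>)" using assms by (simp add: powr_def a_def mult.commute)
  finally have "(a * real n) powr - \<beta> * (a * real n) powr \<beta> \<le> (a * real n) powr - \<beta> * 2 powr (real n * \<alpha>)"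
    by (intro mult_left_mono) auto
  moreover have "(a * real n) powr - \<beta> * (a * real n) powr \<beta> = 1" using a n by (simp flip: powr_add)
  moreover have "(a * real n) powr - \<beta> = a powr - \<beta> * real n powr - \<beta>" by (rule powr_mult)
  ultimately have "1 \<le> a powr - \<beta> * real n powr - \<beta> * 2 powr (real n * \<alpha>)" by simp
  then show ?thesis unfolding a_def by (simp only: mult_ac)
qed

text \<open>At \<epsilon> = 2^(-n) the logarithm is n ln 2, so the covering bound becomes a power of
  n. Optimal nets attain the covering number because total boundedness makes the minimum range over
  a nonempty set.\<close>

lemma geometric_nets:
  fixes \<rho> :: "'i \<Rightarrow> 'i \<Rightarrow> real" and \<alpha> \<beta> C :: real
  assumes "0 < \<alpha>" "0 < \<beta>" "0 < C" and t0: "t0 \<in> T"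
    and bdd: "bdd_above ((\<lambda>p. \<rho> (fst p) (snd p)) ` (T \<times> T))"
    and tb: "totally_bounded_pm T \<rho>"
    and cover: "\<And>\<epsilon>. 0 < \<epsilon> \<Longrightarrow> \<epsilon> < diam_pm T \<rho> \<Longrightarrow> \<epsilon> \<noteq> 1 \<Longrightarrow>
          real (covering_number T \<rho> \<epsilon>) \<le> C * \<epsilon> powr (- \<alpha>) * \<bar>ln \<epsilon>\<bar> powr (- \<beta>)"
  obtains C' G where "0 < C'" "\<And>n. 1 \<le> n \<Longrightarrow> is_eps_net T \<rho> (2 powr - real n) (G n)"
    "\<And>n. 1 \<le> n \<Longrightarrow> real (card (G n)) \<le> C' * 2 powr (real n * \<alpha>) * real n powr - \<beta>"
proof -
  define c where "c = (\<alpha> * ln 2 / \<beta>) powr - \<beta>"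
  define C' where "C' = max (C * ln 2 powr - \<beta>) c"
  have "\<exists>F. is_eps_net T \<rho> (2 powr - real n) F \<and> real (card F) \<le> C' * 2 powr (real n * \<alpha>) * real n powr - \<beta>"
    if n: "1 \<le> n" for n
  proof (cases "2 powr - real n < diam_pm T \<rho>")
    case True
    have "\<exists>k F. is_eps_net T \<rho> (2 powr - real n) F \<and> card F = k"
      using tb unfolding totally_bounded_pm_def by (metis powr_gt_zero zero_neq_numeral)
    from LeastI_ex[OF this] obtain F where F: "is_eps_net T \<rho> (2 powr - real n) F"
      "card F = covering_number T \<rho> (2 powr - real n)"
      unfolding covering_number_def by blast
    \<comment> \<open>Keeps the radius away from 1, which the covering hypothesis excludes.\<close>
    have "2 powr - real n < 2 powr 0" using n by (intro powr_less_mono) auto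
    then have "real (card F) \<le> C * (2 powr - real n) powr - \<alpha> * \<bar>ln (2 powr - real n)\<bar> powr - \<beta>"
      unfolding F(2) using True n by (intro cover) auto
    also have "\<dots> = C * ln 2 powr - \<beta> * 2 powr (real n * \<alpha>) * real n powr - \<beta>"
      by (simp add: powr_powr ln_powr abs_mult powr_mult)
    also have "\<dots> \<le> C' * 2 powr (real n * \<alpha>) * real n powr - \<beta>"
      by (intro mult_right_mono) (auto simp: C'_def)
    finally show ?thesis using F by blast
  next
    \<comment> \<open>The covering hypothesis says nothing at radii from the diameter upwards; there
      a single point is a net.\<close>
    case False
    have "\<rho> t t0 \<le> diam_pm T \<rho>" if "t \<in> T" for t
      unfolding diam_pm_def using that t0 cSUP_upper[OF _ bdd, of "(t, t0)"] by simp
    then have "is_eps_net T \<rho> (2 powr - real n) {t0}"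
      using False t0 unfolding is_eps_net_def by fastforce
    moreover have "1 \<le> C' * 2 powr (real n * \<alpha>) * real n powr - \<beta>"
      by (rule order_trans[OF one_le_two_powr_times_powr[OF assms(1,2) n]], intro mult_right_mono)
        (auto simp: C'_def c_def)
    ultimately show ?thesis by (intro exI[of _ "{t0}"]) auto
  qed
  then have *: "\<forall>n. \<exists>F. 1 \<le> n \<longrightarrow> is_eps_net T \<rho> (2 powr - real n) F \<and> real (card F) \<le> C' * 2 powr (real n * \<alpha>) * real n powr - \<beta>"
    by blast
  obtain G where G: "\<And>n. 1 \<le> n \<Longrightarrow> is_eps_net T \<rho> (2 powr - real n) (G n) \<and> real (card (G n)) \<le> C' * 2 powr (real n * \<alpha>) * real n powr - \<beta>"
    using choice[OF *] by blast
  have "0 < C * ln 2 powr - \<beta>" using assms by simp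
  then have "0 < C'" by (simp add: C'_def)
  then show thesis using G that by blast
qed

text \<open>Finite sets exhaust the countable separant, and continuity from above passes the bound
  to it. Limits along the separant extend the closed inequality to T off a null set. For uncountable
  T the event may fail to be measurable for M, hence the completion.\<close>

lemma separable_small_ball:
  fixes X :: "'i \<Rightarrow> 'a \<Rightarrow> real"
  assumes "prob_space M" and meas: "\<And>t. t \<in> T \<Longrightarrow> X t \<in> borel_measurable M" and "T \<noteq> {}"
    and "separable_process M T \<rho> X"
    and fin: "\<And>F. finite F \<Longrightarrow> F \<subseteq> T \<Longrightarrow>
       c \<le> measure M {\<omega> \<in> space M. \<forall>s\<in>F. \<forall>t\<in>F. \<bar>X s \<omega> - X t \<omega>\<bar> \<le> \<epsilon>}"
  shows "c \<le> measure (completion M) {\<omega> \<in> space M. \<forall>s\<in>T. \<forall>t\<in>T. \<bar>X s \<omega> - X t \<omega>\<bar> \<le> \<epsilon>}"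
proof -
  interpret prob_space M by fact
  obtain D N where D: "countable D" "D \<subseteq> T" and N: "N \<in> null_sets M"
    and sep: "\<And>\<omega> t. \<omega> \<in> space M - N \<Longrightarrow> t \<in> T \<Longrightarrow> \<exists>d :: nat \<Rightarrow> 'i. (\<forall>n. d n \<in> D) \<and>
           (\<lambda>n. \<rho> (d n) t) \<longlonglongrightarrow> 0 \<and> (\<lambda>n. X (d n) \<omega>) \<longlonglongrightarrow> X t \<omega>"
    using assms(4) unfolding separable_process_def by blast
  define E where "E S = {\<omega> \<in> space M. \<forall>s\<in>S. \<forall>t\<in>S. \<bar>X s \<omega> - X t \<omega>\<bar> \<le> \<epsilon>}" for S
  have E_sets: "E S \<in> sets M" if "countable S" "S \<subseteq> T" for S
  proof -
    have [measurable]: "X t \<in> borel_measurable M" if "t \<in> S" for t using that meas \<open>S \<subseteq> T\<close> by blast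
    show ?thesis unfolding E_def using \<open>countable S\<close> by measurable
  qed
  have ED: "E D \<in> sets M" using D by (intro E_sets)
  have "c \<le> measure M (E D)"
  \<comment> \<open>\<open>from_nat_into\<close> enumerates D only if D is nonempty.\<close>
  proof (cases "D = {}")
    case True
    then show ?thesis using fin[of "{}"] by (simp add: E_def)
  next
    case False
    define F where "F k = from_nat_into D ` {..<k}" for k :: nat
    have F: "finite (F k)" "F k \<subseteq> D" for k using from_nat_into[OF False] by (auto simp: F_def)
    have FD: "(\<Union>k. F k) = D"
    proof -
      have "(\<Union>k. F k) = range (from_nat_into D)" by (auto simp: F_def)
      then show ?thesis using range_from_nat_into[OF False D(1)] by simp
    qed
    have mono: "F j \<subseteq> F k" if "j \<le> k" for j k using that by (auto simp: F_def)
    have dec: "decseq (\<lambda>k. E (F k))" using mono by (fastforce simp: decseq_def E_def)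
    have "E (F k) \<in> sets M" for k
      using F[of k] D by (intro E_sets) (auto intro: countable_finite)
    then have "range (\<lambda>k. E (F k)) \<subseteq> sets M" by auto
    from finite_Lim_measure_decseq[OF this dec]
    have "(\<lambda>k. measure M (E (F k))) \<longlonglongrightarrow> measure M (\<Inter>k. E (F k))" .
    moreover have "(\<Inter>k. E (F k)) = E D"
    proof (intro equalityI subsetI)
      fix \<omega> assume \<omega>: "\<omega> \<in> (\<Inter>k. E (F k))"
      have "\<bar>X s \<omega> - X t \<omega>\<bar> \<le> \<epsilon>" if st: "s \<in> D" "t \<in> D" for s t
      proof -
        obtain i j where "s \<in> F i" "t \<in> F j" using st FD by blast
        then have "s \<in> F (max i j)" "t \<in> F (max i j)" using mono[of i "max i j"] mono[of j "max i j"] by auto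
        then show ?thesis using \<omega> unfolding E_def by blast
      qed
      then show "\<omega> \<in> E D" using \<omega> by (auto simp: E_def)
    next
      fix \<omega> assume "\<omega> \<in> E D"
      then show "\<omega> \<in> (\<Inter>k. E (F k))" using F(2) unfolding E_def by blast
    qed
    moreover have "c \<le> measure M (E (F k))" for k
      unfolding E_def using F D by (intro fin) auto
    ultimately show ?thesis by (intro LIMSEQ_le_const) auto
  qed
  also have "\<dots> = measure M (E D - N)" by (rule measure_Diff_null_set[OF ED N, symmetric])
  also have "\<dots> = measure (completion M) (E D - N)"
    using ED N by (intro measure_completion[symmetric]) auto
  also have "\<dots> \<le> measure (completion M) (E T)"
  proof -
    interpret C: finite_measure "completion M"
      by (rule finite_measureI) (simp add: emeasure_space_1)
    have sub: "E D - N \<subseteq> E T"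
    proof
      fix \<omega> assume \<omega>: "\<omega> \<in> E D - N"
      have "\<bar>X s \<omega> - X t \<omega>\<bar> \<le> \<epsilon>" if st: "s \<in> T" "t \<in> T" for s t
      proof -
        have w: "\<omega> \<in> space M - N" using \<omega> by (simp add: E_def)
        obtain d e where d: "\<And>n. d n \<in> D" "(\<lambda>n. X (d n) \<omega>) \<longlonglongrightarrow> X s \<omega>"
          and e: "\<And>n. e n \<in> D" "(\<lambda>n. X (e n) \<omega>) \<longlonglongrightarrow> X t \<omega>"
          using sep[OF w st(1)] sep[OF w st(2)] by blast
        have "(\<lambda>n. \<bar>X (d n) \<omega> - X (e n) \<omega>\<bar>) \<longlonglongrightarrow> \<bar>X s \<omega> - X t \<omega>\<bar>"
          by (intro tendsto_intros d e)
        then show ?thesis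
          by (rule LIMSEQ_le_const2) (use \<omega> d e in \<open>auto simp: E_def\<close>)
      qed
      then show "\<omega> \<in> E T" using \<omega> by (simp add: E_def)
    qed
    have "E T \<subseteq> E D" using D(2) unfolding E_def by blast
    \<comment> \<open>Writes the event as a measurable set plus a subset of a null set, which makes
      it measurable in the completion.\<close>
    then have "E T = (E D - N) \<union> (E T \<inter> N)" using sub by blast
    moreover have "E T \<inter> N \<in> null_sets (completion M)"
      using null_sets_completion_subset[of "E T \<inter> N" N M] N null_sets_completionI by blast
    moreover have "E D - N \<in> sets (completion M)" using ED N by auto
    ultimately have "E T \<in> sets (completion M)" by (metis null_setsD2 sets.Un)
    then show ?thesis by (intro C.finite_measure_mono sub)
  qed
  finally show ?thesis by (simp add: E_def)
qed

theorem theorem6: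
  fixes M :: "'a measure" and X :: "'i \<Rightarrow> 'a \<Rightarrow> real" and T :: "'i set"
    and \<rho> :: "'i \<Rightarrow> 'i \<Rightarrow> real" and \<alpha> \<beta> C :: real
  assumes "prob_space M"
    and "0 < \<alpha>" and "\<alpha> < 2"
    and "T \<noteq> {}"
    and "sas_process M \<alpha> T X"
    and "separable_process M T \<rho> X"
    and rho_nonneg: "\<And>s t. s \<in> T \<Longrightarrow> t \<in> T \<Longrightarrow> 0 \<le> \<rho> s t"
    and rho_scale: "\<And>s t u. s \<in> T \<Longrightarrow> t \<in> T \<Longrightarrow>
          (CLINT \<omega>|M. cis (u * (X t \<omega> - X s \<omega>)))
            = complex_of_real (exp (- (\<rho> t s powr \<alpha>) * \<bar>u\<bar> powr \<alpha>))"
    and "bdd_above ((\<lambda>p. \<rho> (fst p) (snd p)) ` (T \<times> T))"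
    and "totally_bounded_pm T \<rho>"
    and "C > 0" and "\<beta> > max 1 \<alpha>"
    and cover: "\<And>\<epsilon>. 0 < \<epsilon> \<Longrightarrow> \<epsilon> < diam_pm T \<rho> \<Longrightarrow> \<epsilon> \<noteq> 1 \<Longrightarrow>
          real (covering_number T \<rho> \<epsilon>) \<le> C * \<epsilon> powr (- \<alpha>) * \<bar>ln \<epsilon>\<bar> powr (- \<beta>)"
  shows "\<exists>K>0. \<exists>\<epsilon>0>0. \<forall>\<epsilon>. 0 < \<epsilon> \<and> \<epsilon> < \<epsilon>0 \<longrightarrow>
           measure (completion M) {\<omega> \<in> space M. \<forall>s\<in>T. \<forall>t\<in>T. \<bar>X s \<omega> - X t \<omega>\<bar> \<le> \<epsilon>}
             \<ge> exp (- K * (if \<beta> < 1 + \<alpha> then \<epsilon> powr (- 1 / (\<beta> / \<alpha> - 1))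
                          else if \<beta> = 1 + \<alpha> then \<epsilon> powr (- \<alpha>) * \<bar>ln \<epsilon>\<bar> powr (1 + \<alpha>)
                          else \<epsilon> powr (- \<alpha>) * \<bar>ln \<epsilon>\<bar> powr (- \<beta> + 1 + \<alpha>)))"
proof -
  obtain t0 where t0: "t0 \<in> T" using assms(4) by blast
  \<comment> \<open>Besides bounding the first links, \<sigma> \<ge> 1 guarantees 64 \<sigma> /
    \<epsilon> \<ge> 1, as the polynomial bound requires.\<close>
  define \<sigma> where "\<sigma> = max 1 (diam_pm T \<rho>)"
  have \<sigma>: "1 \<le> \<sigma>" "\<rho> t t0 \<le> \<sigma>" if "t \<in> T" for t
    using that t0 cSUP_upper[OF _ assms(9), of "(t, t0)"] by (auto simp: \<sigma>_def diam_pm_def)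
  have \<alpha>2: "\<alpha> \<le> 2" and \<beta>0: "0 < \<beta>" using assms by auto
  obtain C' G where C': "0 < C'" and net: "\<And>n. 1 \<le> n \<Longrightarrow> is_eps_net T \<rho> (2 powr - real n) (G n)"
    and card: "\<And>n. 1 \<le> n \<Longrightarrow> real (card (G n)) \<le> C' * 2 powr (real n * \<alpha>) * real n powr - \<beta>"
    using geometric_nets[OF assms(2) \<beta>0 assms(11) t0 assms(9,10) cover] by blast
  have G: "\<And>n. 1 \<le> n \<Longrightarrow> finite (G n)" "\<And>n. 1 \<le> n \<Longrightarrow> G n \<subseteq> T"
    "\<And>n t. 1 \<le> n \<Longrightarrow> t \<in> T \<Longrightarrow> \<exists>s\<in>G n. \<rho> t s \<le> 2 powr - real n"
    using net by (auto simp: is_eps_net_def)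
  obtain K \<Lambda> where K: "0 < K" and \<Lambda>: "1 \<le> \<Lambda>" and ball:
    "\<And>\<epsilon> n0 n1 s F. 0 < \<epsilon> \<Longrightarrow> \<epsilon> \<le> 1 \<Longrightarrow> 1 \<le> n0 \<Longrightarrow> 1 \<le> n1 \<Longrightarrow>
       \<Lambda> * \<epsilon> powr (- (\<alpha> / (\<beta> - \<alpha>))) \<le> real n1 \<Longrightarrow> 0 < s \<Longrightarrow>
       (\<Sum>n\<in>{n0<..<n1}. real n powr - (\<beta> / (1 + \<alpha>))) \<le> s \<Longrightarrow> finite F \<Longrightarrow> F \<subseteq> T \<Longrightarrow>
       exp (- K * (1 + 2 powr (real n0 * \<alpha>) * real n0 powr - \<beta> * (1 - ln \<epsilon>)
              + \<epsilon> powr - \<alpha> * s powr (1 + \<alpha>) + real n1))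
         \<le> measure M {\<omega> \<in> space M. \<forall>s\<in>F. \<forall>t\<in>F. \<bar>X s \<omega> - X t \<omega>\<bar> \<le> \<epsilon>}"
    using net_small_ball[OF assms(1,2) \<alpha>2 assms(5) rho_nonneg rho_scale assms(12) t0 \<sigma>(1)[OF t0] \<sigma>(2) C' G card]
    by blast
  define R where "R \<epsilon> = (if \<beta> < 1 + \<alpha> then \<epsilon> powr (- 1 / (\<beta> / \<alpha> - 1))
                 else if \<beta> = 1 + \<alpha> then \<epsilon> powr (- \<alpha>) * \<bar>ln \<epsilon>\<bar> powr (1 + \<alpha>)
                 else \<epsilon> powr (- \<alpha>) * \<bar>ln \<epsilon>\<bar> powr (- \<beta> + 1 + \<alpha>))" for \<epsilon>
  obtain c where c: "0 < c" and levels: "\<And>\<epsilon>. 0 < \<epsilon> \<and> \<epsilon> < exp (- 1) \<Longrightarrow> \<exists>n0 n1 s. 1 \<le> n0 \<and> 1 \<le> n1 \<and>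
      \<Lambda> * \<epsilon> powr (- (\<alpha> / (\<beta> - \<alpha>))) \<le> real n1 \<and> 0 < s \<and>
      (\<Sum>n\<in>{n0<..<n1}. real n powr - (\<beta> / (1 + \<alpha>))) \<le> s \<and>
      1 + 2 powr (real n0 * \<alpha>) * real n0 powr - \<beta> * (1 - ln \<epsilon>) + \<epsilon> powr - \<alpha> * s powr (1 + \<alpha>) + real n1 \<le> c * R \<epsilon>"
    using level_choice[OF assms(2,12) \<Lambda>] unfolding R_def by blast
  have "exp (- (K * c) * R \<epsilon>) \<le> measure (completion M) {\<omega> \<in> space M. \<forall>s\<in>T. \<forall>t\<in>T. \<bar>X s \<omega> - X t \<omega>\<bar> \<le> \<epsilon>}"
    if \<epsilon>: "0 < \<epsilon>" "\<epsilon> < exp (- 1)" for \<epsilon>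
  proof (rule separable_small_ball[OF assms(1) _ assms(4,6)])
    show "X t \<in> borel_measurable M" if "t \<in> T" for t using assms(5) that by (simp add: sas_process_def)
    fix F assume F: "finite F" "F \<subseteq> T"
    have "\<epsilon> \<le> 1" using \<epsilon> exp_le_one_iff[of "- 1"] by linarith
    obtain n0 n1 s where n: "1 \<le> n0" "1 \<le> n1" "\<Lambda> * \<epsilon> powr (- (\<alpha> / (\<beta> - \<alpha>))) \<le> real n1" "0 < s"
      "(\<Sum>n\<in>{n0<..<n1}. real n powr - (\<beta> / (1 + \<alpha>))) \<le> s"
      "1 + 2 powr (real n0 * \<alpha>) * real n0 powr - \<beta> * (1 - ln \<epsilon>) + \<epsilon> powr - \<alpha> * s powr (1 + \<alpha>) + real n1 \<le> c * R \<epsilon>"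
      using levels[of \<epsilon>] \<epsilon> by blast
    have "exp (- (K * c) * R \<epsilon>) \<le> exp (- K * (1 + 2 powr (real n0 * \<alpha>) * real n0 powr - \<beta> * (1 - ln \<epsilon>)
              + \<epsilon> powr - \<alpha> * s powr (1 + \<alpha>) + real n1))"
      using mult_left_mono[OF n(6), of K] K by (simp add: mult.assoc)
    also have "\<dots> \<le> measure M {\<omega> \<in> space M. \<forall>s\<in>F. \<forall>t\<in>F. \<bar>X s \<omega> - X t \<omega>\<bar> \<le> \<epsilon>}"
      by (rule ball[OF \<epsilon>(1) \<open>\<epsilon> \<le> 1\<close> n(1-5) F])
    finally show "exp (- (K * c) * R \<epsilon>) \<le> measure M {\<omega> \<in> space M. \<forall>s\<in>F. \<forall>t\<in>F. \<bar>X s \<omega> - X t \<omega>\<bar> \<le> \<epsilon>}" .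
  qed
  then show ?thesis using K c unfolding R_def
    by (intro exI[of _ "K * c"] exI[of _ "exp (- 1)"] conjI) auto
qed

end
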